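(* For every $m\ge0$ the following hold. 1. Let $N\ge1$ be an integer. Under the residue pairing between $V_m$ and $S^m(z^{N-1}\mathbb{C}[z]\,dz)$, the charge-$m$ component of the restricted dual of $W_0^{\sqrt{2N}}$ is identified with the annihilator of $I_{2N}\cap V_m$, and this is $$\left(W_0^{\sqrt{2N}}\right)^*_m\simeq\Big\{\prod_{i<j}(z_i-z_j)^{2N}f(z_1,\dots,z_m)\,(z_1\cdots z_m)^{N-1}\,dz_1\,dz_2\cdots dz_m\;\Big|\;f\text{ is a symmetric polynomial}\Big\}.$$ 2. Let $N\ge0$ be an integer. Under the residue pairing between $U_m$ and the space of forms $g(z_1,\dots,z_m)\frac{dz_1\cdots dz_m}{z_1\cdots z_m}$ with $g$ an antisymmetric polynomial, the charge-$m$ component of the restricted dual of $W_0^{\sqrt{2N+1}}$ is identified with the annihilator of $I_{2N+1}\cap U_m$, and this is $$\left(W_0^{\sqrt{2N+1}}\right)^*_m\simeq\Big\{\prod_{i<j}(z_i-z_j)^{2N+1}f(z_1,\dots,z_m)\,\frac{dz_1\,dz_2\cdots dz_m}{z_1\cdots z_m}\;\Big|\;f\text{ is a symmetric polynomial}\Big\}.$$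
   Context: **Lattice vertex superalgebra.** The Heisenberg Lie algebra is $\mathfrak{H}=\langle C, a_n \mid n\in\mathbb{Z}\rangle_{\mathbb{C}}$ with $[a_n,a_m]=n\,\delta_{n+m,0}\,C$ and $C$ central. $F_\mu$ is the Fock module with highest weight vector $|\mu\rangle$: $C$ acts by $1$, $a_0|\mu\rangle=\mu|\mu\rangle$, $a_n|\mu\rangle=0$ for $n>0$, and $F_\mu$ is freely generated from $|\mu\rangle$ by the $a_{n}$, $n<0$. For a positive integer $M$, $V_{\sqrt{M}\,\mathbb{Z}}=\bigoplus_{\mu\in\sqrt{M}\,\mathbb{Z}}F_\mu$, with vertex operators ($\mu\in\sqrt M\,\mathbb{Z}$) $$V_\mu(z)=e^{\mu q}\,z^{\mu a_0}\exp\Big(-\mu\sum_{n<0}\frac{a_n}{n}z^{-n}\Big)\exp\Big(-\mu\sum_{n>0}\frac{a_n}{n}z^{-n}\Big),$$ where $[a_0,q]=1$, $[a_n,q]=0$ for $n\neq0$, so $e^{\mu q}$ commutes with $a_n$ ($n\ne 0$) and $e^{\mu q}|\lambda\rangle=|\lambda+\mu\rangle$. **Modes and basic subspaces.** For $M=2N$: $V_{\sqrt{2N}}(z)=\sum_{n\in\mathbb{Z}}e_n z^{-n-N}$; the $e_n$ commute and $e_n|0\rangle=0$ for $n>-N$. For $M=2N+1$: $V_{\sqrt{2N+1}}(z)=\sum_{n\in\mathbb{Z}}\theta_n z^{-n}$; the $\theta_n$ anticommute and $\theta_n|0\rangle=0$ for $n>0$. $W_0^{\sqrt{2N}}$ (resp.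 $W_0^{\sqrt{2N+1}}$) is the span of all products of modes $e_i$ (resp. $\theta_i$) applied to $|0\rangle$. Let $I_{2N}$ be the kernel of $\mathbb{C}[e_{-N},e_{-N-1},\dots]\to W_0^{\sqrt{2N}}$, $P\mapsto P|0\rangle$ (commuting variables), and $I_{2N+1}$ the kernel of $\mathbb{C}\{\theta_0,\theta_{-1},\dots\}\to W_0^{\sqrt{2N+1}}$, $P\mapsto P|0\rangle$ (anticommuting variables); both maps are surjective, so $W_0^{\sqrt{2N}}$ and $W_0^{\sqrt{2N+1}}$ are the corresponding quotients. Charge is the number of variables in a monomial; $V_m$ and $U_m$ are the charge-$m$ subspaces of $\mathbb{C}[e_{-N},e_{-N-1},\dots]$ and $\mathbb{C}\{\theta_0,\theta_{-1},\dots\}$. There is also the grading $\deg_q$ with $\deg_q e_n=\deg_q\theta_n=-n$. The restricted dual is the direct sum of the duals of the (finite-dimensional) components homogeneous in charge and $\deg_q$; the subscript $m$ denotes its charge-$m$ part. **Pairings.** Write $e_n=z^n\otimes e$, and extend linearly to $\varphi\otimes e$ for $\varphi\in\frac1{x^N}\mathbb{C}[\frac1x]$. Elements of $S^m(z^{N-1}\mathbb{C}[z]\,dz)$ are forms $(z_1\cdots z_m)^{N-1}f(z_1,\dots,z_m)\,dz_1\cdots dz_m$ with $f$ a symmetric polynomial, and $$\langle (z_1\cdots z_m)^{N-1}f\,dz_1\cdots dz_m,\ (\varphi_1\otimes e)\cdots(\varphi_m\otimes e)\rangle=\operatorname{Res}_{z_1=\dots=z_m=0}(z_1\cdots z_m)^{N-1}f(z_1,\dots,z_m)\,\varphi_1(z_1)\cdots\varphi_m(z_m)\,dz_1\cdots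 dz_m.$$ In the odd case, similarly, with $\theta_n=z^n\otimes\theta$, $\varphi_i\in\mathbb{C}[\frac1x]$ and $g$ an antisymmetric polynomial, $$\Big\langle g\,\tfrac{dz_1\cdots dz_m}{z_1\cdots z_m},\ (\varphi_1\otimes\theta)\cdots(\varphi_m\otimes\theta)\Big\rangle=\operatorname{Res}_{z_1=\dots=z_m=0}g(z_1,\dots,z_m)\,\varphi_1(z_1)\cdots\varphi_m(z_m)\,\tfrac{dz_1\cdots dz_m}{z_1\cdots z_m}.$$ *)

theory Defs
  imports
    Complex_Main
    "HOL-Library.Poly_Mapping"
    "HOL-Library.Multiset"
    "HOL-Library.FSet"
    "HOL-Combinatorics.Permutations"
begin

abbreviation (input) lookup :: "('a \<Rightarrow>\<^sub>0 'b::zero) \<Rightarrow> 'a \<Rightarrow> 'b" where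
  "lookup \<equiv> Poly_Mapping.lookup"
abbreviation (input) keys :: "('a \<Rightarrow>\<^sub>0 'b::zero) \<Rightarrow> 'a set" where
  "keys \<equiv> Poly_Mapping.keys"
abbreviation (input) single :: "'a \<Rightarrow> 'b \<Rightarrow> 'a \<Rightarrow>\<^sub>0 'b::zero" where
  "single \<equiv> Poly_Mapping.single"

section \<open>Complex vector spaces with a chosen basis\<close>

text \<open>The type \<open>'a \<Rightarrow>\<^sub>0 complex\<close> is the complex vector space with basis \<open>'a\<close>; the basis
  vector of \<open>x\<close> is \<open>single x 1\<close>.\<close>

definition scl :: "complex \<Rightarrow> ('a \<Rightarrow>\<^sub>0 complex) \<Rightarrow> ('a \<Rightarrow>\<^sub>0 complex)" where
  "scl c v = Poly_Mapping.map ((*) c) v"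

lemma lookup_scl [simp]: "lookup (scl c v) x = c * lookup v x"
  by (simp add: scl_def Poly_Mapping.map.rep_eq when_def)

global_interpretation fvs: vector_space "scl :: complex \<Rightarrow> ('a \<Rightarrow>\<^sub>0 complex) \<Rightarrow> ('a \<Rightarrow>\<^sub>0 complex)"
  by standard (auto intro!: poly_mapping_eqI simp: lookup_add algebra_simps)

definition linext :: "('a \<Rightarrow> ('b \<Rightarrow>\<^sub>0 complex)) \<Rightarrow> ('a \<Rightarrow>\<^sub>0 complex) \<Rightarrow> ('b \<Rightarrow>\<^sub>0 complex)" where
  "linext f v = (\<Sum>x\<in>keys v. scl (lookup v x) (f x))"

lemma scl_single [simp]: "scl c (single x d) = single x (c * d)"
  by (rule poly_mapping_eqI) (simp add: lookup_single when_def)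

lemma linext_superset:
  assumes "finite A" "keys v \<subseteq> A"
  shows "linext f v = (\<Sum>x\<in>A. scl (lookup v x) (f x))"
  unfolding linext_def
  by (rule sum.mono_neutral_left) (use assms in \<open>auto simp: in_keys_iff\<close>)

lemma linext_single [simp]: "linext f (single x c) = scl c (f x)"
  by (subst linext_superset[of "{x}"]) auto

lemma linext_zero [simp]: "linext f 0 = 0"
  by (simp add: linext_def)

lemma linext_add: "linext f (u + v) = linext f u + linext f v"
proof -
  have "linext f w = (\<Sum>x\<in>keys u \<union> keys v. scl (lookup w x) (f x))" if "w \<in> {u, v, u + v}" for w
    using that keys_add[of u v] by (intro linext_superset) auto
  then show ?thesis
    by (simp add: lookup_add fvs.scale_left_distrib sum.distrib)
qed

lemma linext_scl: "linext f (scl c v) = scl c (linext f v)"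
proof -
  have "linext f (scl c v) = (\<Sum>x\<in>keys v. scl (lookup (scl c v) x) (f x))"
    by (rule linext_superset) (auto simp: in_keys_iff)
  then show ?thesis
    by (simp add: linext_def fvs.scale_sum_right)
qed

lemma fvs_induct [case_names zero single add]:
  fixes v :: "'a \<Rightarrow>\<^sub>0 complex"
  assumes "P 0" "\<And>x c. P (single x c)" "\<And>u v. P u \<Longrightarrow> P v \<Longrightarrow> P (u + v)"
  shows "P v"
proof -
  have "v = (\<Sum>x\<in>keys v. single x (lookup v x))"
    by (rule poly_mapping_eqI) (auto simp: lookup_sum lookup_single when_def in_keys_iff sum.If_cases)
  moreover have "P (\<Sum>x\<in>A. single x (lookup v x))" if "finite A" for A
    using that by (induction A) (use assms in auto)
  ultimately show ?thesis
    by (metis finite_keys)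
qed

section \<open>The lattice vertex superalgebra\<close>

text \<open>\<open>F\<^sub>\<mu>\<close> has the basis \<open>(\<Prod>i\<in>#\<kappa>. a\<^bsub>-(i+1)\<^esub>) |\<mu>\<rangle>\<close>, where \<open>\<kappa>\<close> runs over the finite multisets of natural
  numbers. The pair \<open>(k, \<kappa>)\<close> stands for this basis vector with \<open>\<mu> = k \<surd>M\<close>, so that \<open>fock\<close> is
  the direct sum of the \<open>F\<^sub>\<mu>\<close>, \<open>\<mu> \<in> \<surd>M \<int>\<close>. The central element \<open>C\<close> acts by \<open>1\<close>.\<close>

type_synonym fock = "(int \<times> nat multiset) \<Rightarrow>\<^sub>0 complex"

definition vac :: fock where
  "vac = single (0, {#}) 1"

definition sqrtM :: "nat \<Rightarrow> complex" where
  "sqrtM M = complex_of_real (sqrt (real M))"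

definition heis :: "nat \<Rightarrow> int \<Rightarrow> fock \<Rightarrow> fock" where
  "heis M n = linext (\<lambda>(k, \<kappa>).
     if n < 0 then single (k, add_mset (nat (- n) - 1) \<kappa>) 1
     else if n = 0 then single (k, \<kappa>) (of_int k * sqrtM M)
     else single (k, \<kappa> - {#nat n - 1#}) (of_int n * of_nat (count \<kappa> (nat n - 1))))"

lemma heis_add: "heis M n (u + v) = heis M n u + heis M n v"
  and heis_zero [simp]: "heis M n 0 = 0"
  and heis_scl: "heis M n (scl c v) = scl c (heis M n v)"
  by (simp_all add: heis_def linext_add linext_scl)

lemma heis_commutator:
  "heis M n (heis M m v) - heis M m (heis M n v) = (if n + m = 0 then scl (of_int n) v else 0)"
proof (induction v rule: fvs_induct)
  case zero
  then show ?case by simp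
next
  case (single x c)
  obtain k \<kappa> where x: "x = (k, \<kappa>)" by fastforce
  have pos: "heis M (int (Suc j)) (single (k, \<rho>) b)
      = single (k, \<rho> - {#j#}) (b * (of_nat (Suc j) * of_nat (count \<rho> j)))"
    and neg: "heis M (- int (Suc j)) (single (k, \<rho>) b) = single (k, add_mset j \<rho>) b"
    and zero: "heis M 0 (single (k, \<rho>) b) = single (k, \<rho>) (b * (of_int k * sqrtM M))"
    for b \<rho> j
    by (auto intro!: poly_mapping_eqI simp: heis_def lookup_single when_def nat_add_distrib)
  have mixed: "heis M (- int (Suc i)) (heis M (int (Suc j)) (single (k, \<kappa>) c))
      - heis M (int (Suc j)) (heis M (- int (Suc i)) (single (k, \<kappa>) c))
      = (if i = j then scl (- of_nat (Suc j)) (single (k, \<kappa>) c) else 0)" for i j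
  proof -
    have *: "add_mset i (\<kappa> - {#j#}) = add_mset i \<kappa> - {#j#}" if "j \<in># \<kappa>"
      using that by (simp add: multiset_eq_iff)
    show ?thesis
    proof (cases "i = j")
      case True
      have "add_mset j (\<kappa> - {#j#}) = \<kappa>" if "count \<kappa> j \<noteq> 0"
        using that by (meson count_eq_zero_iff insert_DiffM)
      then have "single (k, add_mset j (\<kappa> - {#j#})) (c * (of_nat (Suc j) * of_nat (count \<kappa> j)))
          = single (k, \<kappa>) (c * (of_nat (Suc j) * of_nat (count \<kappa> j)))"
        by (cases "count \<kappa> j = 0") (simp, metis)
      moreover have "c * (of_nat (Suc j) * of_nat (count \<kappa> j)) -
          c * (of_nat (Suc j) * of_nat (count (add_mset j \<kappa>) j)) = - of_nat (Suc j) * c"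
        by (simp add: algebra_simps)
      ultimately show ?thesis
        unfolding pos neg True by (simp only: add_mset_remove_trivial if_True refl scl_single flip: single_diff)
    next
      case False
      then show ?thesis
        unfolding pos neg using * by (cases "j \<in># \<kappa>") (simp_all add: not_in_iff)
    qed
  qed
  have signs: "l = 0 \<or> (\<exists>i. l = - int (Suc i)) \<or> (\<exists>i. l = int (Suc i))" for l
  proof (cases l "0::int" rule: linorder_cases)
    case less
    then have "l = - int (Suc (nat (- l) - 1))" by simp
    then show ?thesis by blast
  next
    case greater
    then have "l = int (Suc (nat l - 1))" by simp
    then show ?thesis by blast
  qed simp
  consider (zl) "n = 0" | (zr) "m = 0" | (nn) i j where "n = - int (Suc i)" "m = - int (Suc j)"
    | (pp) i j where "n = int (Suc i)" "m = int (Suc j)"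
    | (np) i j where "n = - int (Suc i)" "m = int (Suc j)"
    | (pn) i j where "m = - int (Suc i)" "n = int (Suc j)"
    using signs[of n] signs[of m] by blast
  then show ?case
  proof cases
    case zl
    from signs[of m] show ?thesis
      unfolding x zl by (elim disjE exE; simp only: pos neg zero) (simp_all add: mult_ac)
  next
    case zr
    from signs[of n] show ?thesis
      unfolding x zr by (elim disjE exE; simp only: pos neg zero) (simp_all add: mult_ac)
  next
    case nn
    show ?thesis
      unfolding x nn neg by (simp add: add_mset_commute)
  next
    case pp
    have "\<kappa> - {#j#} - {#i#} = \<kappa> - {#i#} - {#j#}"
      by (rule diff_right_commute)
    then show ?thesis
      unfolding x pp pos by (cases "i = j") (simp_all add: mult_ac)
  next
    case np
    then show ?thesis
      using mixed[of i j] by (simp add: x)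
  next
    case pn
    have "heis M n (heis M m (single x c)) - heis M m (heis M n (single x c))
        = - (if i = j then scl (- of_nat (Suc j)) (single x c) else 0)"
      unfolding x pn mixed[symmetric] by simp
    also have "\<dots> = (if n + m = 0 then scl (of_int n) (single x c) else 0)"
      by (auto simp: pn algebra_simps simp flip: single_uminus)
    finally show ?thesis .
  qed
next
  case (add u v)
  have "heis M n (heis M m (u + v)) - heis M m (heis M n (u + v)) =
      (heis M n (heis M m u) - heis M m (heis M n u)) + (heis M n (heis M m v) - heis M m (heis M n v))"
    by (simp add: heis_add)
  then show ?case
    by (simp add: add fvs.scale_right_distrib)
qed

text \<open>\<open>exp_coeff b r\<close> is the coefficient of \<open>t\<^sup>r\<close> in \<open>exp (\<Sum>n>0. b\<^sub>n t\<^sup>n)\<close>, obtained by expanding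
  \<open>\<Sum>l. (\<Sum>n>0. b\<^sub>n t\<^sup>n)\<^sup>l / l!\<close>; the lists are the compositions of \<open>r\<close>.\<close>

definition exp_coeff :: "(nat \<Rightarrow> fock \<Rightarrow> fock) \<Rightarrow> nat \<Rightarrow> fock \<Rightarrow> fock" where
  "exp_coeff b r v =
     (\<Sum>ns\<in>{ns. 0 \<notin> set ns \<and> sum_list ns = r}. scl (1 / fact (length ns)) (foldr b ns v))"

lemma finite_compositions: "finite {ns. 0 \<notin> set ns \<and> sum_list ns = (r::nat)}"
proof (rule finite_subset)
  have "length ns \<le> sum_list ns" if "0 \<notin> set ns" for ns :: "nat list"
    using that by (induction ns) auto
  then show "{ns. 0 \<notin> set ns \<and> sum_list ns = r} \<subseteq> {ns. set ns \<subseteq> {..r} \<and> length ns \<le> r}"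
    using member_le_sum_list by fastforce
  show "finite {ns. set ns \<subseteq> {..r} \<and> length ns \<le> r}"
    by (rule finite_lists_length_le) simp
qed

text \<open>For \<open>\<mu> = j \<surd>M\<close>: the coefficient of \<open>z\<^sup>s\<close> in \<open>exp (-\<mu> \<Sum>n<0. a\<^sub>n/n z\<^bsup>-n\<^esup>)\<close> and the coefficient of
  \<open>z\<^bsup>-r\<^esup>\<close> in \<open>exp (-\<mu> \<Sum>n>0. a\<^sub>n/n z\<^bsup>-n\<^esup>)\<close>.\<close>

definition exp_neg :: "nat \<Rightarrow> int \<Rightarrow> nat \<Rightarrow> fock \<Rightarrow> fock" where
  "exp_neg M j = exp_coeff (\<lambda>n v. scl (- (of_int j * sqrtM M) / of_int (- int n)) (heis M (- int n) v))"

definition exp_pos :: "nat \<Rightarrow> int \<Rightarrow> nat \<Rightarrow> fock \<Rightarrow> fock" where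
  "exp_pos M j = exp_coeff (\<lambda>n v. scl (- (of_int j * sqrtM M) / of_int (int n)) (heis M (int n) v))"

text \<open>The operator \<open>e\<^bsup>\<mu>q\<^esup>\<close> for \<open>\<mu> = j \<surd>M\<close>.\<close>

definition shift :: "int \<Rightarrow> fock \<Rightarrow> fock" where
  "shift j = linext (\<lambda>(k, \<kappa>). single (k + j, \<kappa>) 1)"

text \<open>The coefficient of \<open>z\<^sup>p\<close> in \<open>V\<^sub>\<mu>(z)\<close>, \<open>\<mu> = j \<surd>M\<close>. On \<open>F\<^sub>\<lambda>\<close> with \<open>\<lambda> = k \<surd>M\<close> the factor
  \<open>z\<^bsup>\<mu>a\<^sub>0\<^esup>\<close> is \<open>z\<^bsup>j k M\<^esup>\<close>. Only finitely many pairs \<open>(r, s)\<close> contribute on a given vector, see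
  \<open>finite_vertex_support\<close> below.\<close>

definition vertex_coeff :: "nat \<Rightarrow> int \<Rightarrow> int \<Rightarrow> fock \<Rightarrow> fock" where
  "vertex_coeff M j p = linext (\<lambda>(k, \<kappa>). shift j (Sum_any (\<lambda>(r, s).
     if j * k * int M + int s - int r = p
     then exp_neg M j s (exp_pos M j r (single (k, \<kappa>) 1)) else 0)))"

lemma exp_pos_eq_0:
  assumes "r > (\<Sum>i\<in>#\<kappa>. Suc i)"
  shows "exp_pos M j r (single (k, \<kappa>) 1) = 0"
proof -
  define b :: "nat \<Rightarrow> fock \<Rightarrow> fock"
    where "b = (\<lambda>n v. scl (- (of_int j * sqrtM M) / of_int (int n)) (heis M (int n) v))"
  have *: "\<exists>\<rho> c. foldr b ns (single (k, \<kappa>) 1) = single (k, \<rho>) c \<and>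
      (c \<noteq> 0 \<longrightarrow> sum_list ns + (\<Sum>i\<in>#\<rho>. Suc i) = (\<Sum>i\<in>#\<kappa>. Suc i))"
    if "0 \<notin> set ns" for ns
    using that
  proof (induction ns)
    case Nil
    show ?case
      by (intro exI[of _ \<kappa>] exI[of _ 1]) simp
  next
    case (Cons n ns)
    then obtain \<rho> c where IH: "foldr b ns (single (k, \<kappa>) 1) = single (k, \<rho>) c"
        "c \<noteq> 0 \<longrightarrow> sum_list ns + (\<Sum>i\<in>#\<rho>. Suc i) = (\<Sum>i\<in>#\<kappa>. Suc i)"
      by auto
    from Cons.prems obtain l where n: "n = Suc l"
      by (cases n) auto
    have step: "foldr b (n # ns) (single (k, \<kappa>) 1) =
        single (k, \<rho> - {#l#}) (- (of_int j * sqrtM M) * (c * of_nat (count \<rho> l)))"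
    proof -
      have "heis M (int n) (single (k, \<rho>) c) =
          single (k, \<rho> - {#l#}) (c * (of_nat (Suc l) * of_nat (count \<rho> l)))"
        by (simp add: n heis_def nat_add_distrib)
      moreover have "a / of_nat (Suc l) * (c * (of_nat (Suc l) * q)) = a * (c * q)" for a q :: complex
        using of_nat_neq_0[of l, where 'a = complex] by (simp del: of_nat_Suc)
      ultimately show ?thesis
        unfolding foldr.simps comp_apply IH(1) by (simp only: b_def scl_single of_int_of_nat_eq n)
    qed
    show ?case
    proof (cases "l \<in># \<rho>")
      case True
      then obtain \<rho>' where "\<rho> = add_mset l \<rho>'"
        by (metis insert_DiffM)
      with step IH(2) n show ?thesis
        by (intro exI[of _ \<rho>'] exI[of _ "- (of_int j * sqrtM M) * (c * of_nat (count \<rho> l))"])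
           (auto simp del: foldr.simps)
    next
      case False
      with step show ?thesis
        by (intro exI[of _ \<rho>] exI[of _ 0]) (simp del: foldr.simps add: not_in_iff)
    qed
  qed
  have "foldr b ns (single (k, \<kappa>) 1) = 0" if "0 \<notin> set ns" "sum_list ns = r" for ns
    using *[OF that(1)] that(2) assms by auto
  then show ?thesis
    unfolding exp_pos_def exp_coeff_def b_def[symmetric] by (intro sum.neutral) auto
qed

lemma exp_neg_zero [simp]: "exp_neg M j s 0 = 0"
proof -
  have "foldr (\<lambda>n v. scl (c n) (heis M (- int n) v)) ns 0 = 0" for c ns
    by (induction ns) auto
  then show ?thesis
    by (simp add: exp_neg_def exp_coeff_def)
qed

lemma finite_vertex_support:
  "finite {(r, s). j * k * int M + int s - int r = p \<and>
     exp_neg M j s (exp_pos M j r (single (k, \<kappa>) 1)) \<noteq> 0}"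
proof (rule finite_subset)
  let ?B = "\<Sum>i\<in>#\<kappa>. Suc i"
  show "{(r, s). j * k * int M + int s - int r = p \<and>
      exp_neg M j s (exp_pos M j r (single (k, \<kappa>) 1)) \<noteq> 0} \<subseteq>
      (\<lambda>r. (r, nat (p - j * k * int M + int r))) ` {..?B}"
  proof clarify
    fix r s
    assume "exp_neg M j s (exp_pos M j r (single (k, \<kappa>) 1)) \<noteq> 0"
    then have "r \<le> ?B"
      using exp_pos_eq_0 by (metis exp_neg_zero not_le)
    then show "(r, s) \<in> (\<lambda>r'. (r', nat (j * k * int M + int s - int r - j * k * int M + int r'))) ` {..?B}"
      by (auto simp: image_iff)
  qed
qed simp

definition e_mode :: "nat \<Rightarrow> int \<Rightarrow> fock \<Rightarrow> fock" where
  "e_mode N n = vertex_coeff (2 * N) 1 (- n - int N)"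

definition theta_mode :: "nat \<Rightarrow> int \<Rightarrow> fock \<Rightarrow> fock" where
  "theta_mode N n = vertex_coeff (2 * N + 1) 1 (- n)"

definition principal_subspace :: "(int \<Rightarrow> fock \<Rightarrow> fock) \<Rightarrow> fock set" where
  "principal_subspace Y = fvs.span {foldr Y ns vac | ns. True}"

definition W0_even :: "nat \<Rightarrow> fock set" where
  "W0_even N = principal_subspace (e_mode N)"

definition W0_odd :: "nat \<Rightarrow> fock set" where
  "W0_odd N = principal_subspace (theta_mode N)"

section \<open>Polynomials in the modes\<close>

text \<open>\<open>\<complex>[e\<^bsub>-N\<^esub>, e\<^bsub>-N-1\<^esub>, \<dots>]\<close>: the monomials are the finite multisets \<open>\<kappa>\<close> of natural numbers, where
  \<open>k\<close> stands for the variable \<open>e\<^bsub>-N-k\<^esub>\<close>; the ring structure is that of \<open>Poly_Mapping\<close>.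

  \<open>\<complex>{\<theta>\<^sub>0, \<theta>\<^bsub>-1\<^esub>, \<dots>}\<close>: the basis vector of a finite set \<open>{k\<^sub>1 < \<dots> < k\<^sub>m}\<close> is the monomial
  \<open>\<theta>\<^bsub>-k\<^sub>1\<^esub> \<dots> \<theta>\<^bsub>-k\<^sub>m\<^esub>\<close>, with the factors in this order. The product is given by
  \<open>theta_mult k\<close>, left multiplication by \<open>\<theta>\<^bsub>-k\<^esub>\<close>: the sign moves it to its place in the ordered monomial.\<close>

type_synonym epoly = "nat multiset \<Rightarrow>\<^sub>0 complex"
type_synonym tpoly = "nat fset \<Rightarrow>\<^sub>0 complex"

definition e_index :: "nat \<Rightarrow> nat \<Rightarrow> int" where
  "e_index N k = - int N - int k"

definition theta_index :: "nat \<Rightarrow> int" where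
  "theta_index k = - int k"

definition theta_mult :: "nat \<Rightarrow> tpoly \<Rightarrow> tpoly" where
  "theta_mult k = linext (\<lambda>S. if k |\<in>| S then 0
     else single (finsert k S) ((-1) ^ card {l \<in> fset S. l < k}))"

definition theta_word :: "nat list \<Rightarrow> tpoly" where
  "theta_word ks = foldr theta_mult ks (single {||} 1)"

text \<open>The maps \<open>P \<mapsto> P|0\<rangle>\<close>. As the modes \<open>e\<^sub>n\<close> commute, the order of the factors chosen for a
  commutative monomial is immaterial.\<close>

definition e_eval :: "nat \<Rightarrow> epoly \<Rightarrow> fock" where
  "e_eval N = linext (\<lambda>\<kappa>. foldr (\<lambda>k. e_mode N (e_index N k)) (sorted_list_of_multiset \<kappa>) vac)"

definition theta_eval :: "nat \<Rightarrow> tpoly \<Rightarrow> fock" where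
  "theta_eval N = linext (\<lambda>S. foldr (\<lambda>k. theta_mode N (theta_index k)) (sorted_list_of_fset S) vac)"

definition I_even :: "nat \<Rightarrow> epoly set" where
  "I_even N = {P. e_eval N P = 0}"

definition I_odd :: "nat \<Rightarrow> tpoly set" where
  "I_odd N = {P. theta_eval N P = 0}"

definition V_charge :: "nat \<Rightarrow> epoly set" where
  "V_charge m = {P. \<forall>\<kappa>\<in>keys P. size \<kappa> = m}"

definition U_charge :: "nat \<Rightarrow> tpoly set" where
  "U_charge m = {P. \<forall>S\<in>keys P. fcard S = m}"

definition V_hom :: "nat \<Rightarrow> nat \<Rightarrow> int \<Rightarrow> epoly set" where
  "V_hom N m d = {P \<in> V_charge m. \<forall>\<kappa>\<in>keys P. (\<Sum>k\<in>#\<kappa>. - e_index N k) = d}"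

definition U_hom :: "nat \<Rightarrow> int \<Rightarrow> tpoly set" where
  "U_hom m d = {P \<in> U_charge m. \<forall>S\<in>keys P. (\<Sum>k\<in>fset S. - theta_index k) = d}"

section \<open>Restricted duals\<close>

text \<open>Linear functionals on a subspace \<open>W\<close> of \<open>fock\<close> are represented by functions that vanish
  outside \<open>W\<close>.\<close>

definition functionals :: "fock set \<Rightarrow> (fock \<Rightarrow> complex) set" where
  "functionals W = {l. (\<forall>u\<in>W. \<forall>v\<in>W. l (u + v) = l u + l v) \<and>
     (\<forall>c. \<forall>u\<in>W. l (scl c u) = c * l u) \<and> (\<forall>u. u \<notin> W \<longrightarrow> l u = 0)}"

text \<open>For \<open>W\<close> the direct sum of components \<open>C m d\<close> (\<open>m\<close> the charge, \<open>d\<close> the value of \<open>deg\<^sub>q\<close>): the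
  direct sum over \<open>d\<close> of the duals of the \<open>C m d\<close>, regarded as functionals on \<open>W\<close>.\<close>

definition restricted_dual :: "fock set \<Rightarrow> (nat \<Rightarrow> int \<Rightarrow> fock set) \<Rightarrow> nat \<Rightarrow> (fock \<Rightarrow> complex) set" where
  "restricted_dual W C m = {l \<in> functionals W.
     (\<forall>m' d. m' \<noteq> m \<longrightarrow> (\<forall>w \<in> C m' d. l w = 0)) \<and> finite {d. \<exists>w \<in> C m d. l w \<noteq> 0}}"

definition W0_even_dual :: "nat \<Rightarrow> nat \<Rightarrow> (fock \<Rightarrow> complex) set" where
  "W0_even_dual N = restricted_dual (W0_even N) (\<lambda>m d. e_eval N ` V_hom N m d)"

definition W0_odd_dual :: "nat \<Rightarrow> nat \<Rightarrow> (fock \<Rightarrow> complex) set" where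
  "W0_odd_dual N = restricted_dual (W0_odd N) (\<lambda>m d. theta_eval N ` U_hom m d)"

section \<open>Differential forms and residues\<close>

text \<open>Laurent polynomials in \<open>z\<^sub>0, z\<^sub>1, \<dots>\<close>: the key \<open>\<alpha>\<close> is the monomial \<open>\<Prod>i. z\<^sub>i\<^bsup>\<alpha>(i)\<^esup>\<close>. The variables
  \<open>z\<^sub>1, \<dots>, z\<^sub>m\<close> of the mathematical text are \<open>z\<^sub>0, \<dots>, z\<^bsub>m-1\<^esub>\<close> here, and the form
  \<open>\<omega> dz\<^sub>1 \<dots> dz\<^sub>m\<close> is represented by \<open>\<omega>\<close>.\<close>

type_synonym laurent = "(nat \<Rightarrow>\<^sub>0 int) \<Rightarrow>\<^sub>0 complex"

definition zpow :: "nat \<Rightarrow> int \<Rightarrow> laurent" where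
  "zpow i n = single (single i n) 1"

definition is_poly :: "nat \<Rightarrow> laurent \<Rightarrow> bool" where
  "is_poly m f \<longleftrightarrow> (\<forall>\<alpha>\<in>keys f. keys \<alpha> \<subseteq> {..<m} \<and> (\<forall>i. 0 \<le> lookup \<alpha> i))"

text \<open>\<open>map_key \<pi> \<alpha>\<close> is the exponent \<open>\<alpha> \<circ> \<pi>\<close>.\<close>

definition sym_poly :: "nat \<Rightarrow> laurent \<Rightarrow> bool" where
  "sym_poly m f \<longleftrightarrow> is_poly m f \<and>
     (\<forall>\<pi> \<alpha>. \<pi> permutes {..<m} \<longrightarrow> lookup f (Poly_Mapping.map_key \<pi> \<alpha>) = lookup f \<alpha>)"

definition antisym_poly :: "nat \<Rightarrow> laurent \<Rightarrow> bool" where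
  "antisym_poly m g \<longleftrightarrow> is_poly m g \<and>
     (\<forall>\<pi> \<alpha>. \<pi> permutes {..<m} \<longrightarrow>
        lookup g (Poly_Mapping.map_key \<pi> \<alpha>) = of_int (sign \<pi>) * lookup g \<alpha>)"

definition even_forms :: "nat \<Rightarrow> nat \<Rightarrow> laurent set" where
  "even_forms N m = {(\<Prod>i<m. zpow i 1) ^ (N - 1) * f | f. sym_poly m f}"

definition odd_forms :: "nat \<Rightarrow> laurent set" where
  "odd_forms m = {g * (\<Prod>i<m. zpow i (-1)) | g. antisym_poly m g}"

definition vandermonde :: "nat \<Rightarrow> laurent" where
  "vandermonde m = (\<Prod>(i, j)\<in>{(i, j). i < j \<and> j < m}. zpow i 1 - zpow j 1)"

definition residue :: "nat \<Rightarrow> laurent \<Rightarrow> complex" where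
  "residue m \<omega> = lookup \<omega> (\<Sum>i<m. single i (-1))"

text \<open>\<open>Res \<omega>(z\<^sub>1, \<dots>, z\<^sub>m) \<phi>\<^sub>1(z\<^sub>1) \<dots> \<phi>\<^sub>m(z\<^sub>m) dz\<^sub>1 \<dots> dz\<^sub>m\<close> for \<open>\<phi>\<^sub>i = z\<^bsup>n\<^sub>i\<^esup>\<close>. A mode \<open>e\<^sub>n\<close> or \<open>\<theta>\<^sub>n\<close> is
  \<open>z\<^sup>n \<otimes> e\<close> or \<open>z\<^sup>n \<otimes> \<theta>\<close>, so by multilinearity these values determine the pairings.\<close>

definition res_modes :: "laurent \<Rightarrow> int list \<Rightarrow> complex" where
  "res_modes \<omega> ns = residue (length ns) (\<omega> * (\<Prod>i<length ns. zpow i (ns ! i)))"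

definition e_pairing :: "nat \<Rightarrow> laurent \<Rightarrow> epoly \<Rightarrow> complex" where
  "e_pairing N \<omega> P =
     (\<Sum>\<kappa>\<in>keys P. lookup P \<kappa> * res_modes \<omega> (map (e_index N) (sorted_list_of_multiset \<kappa>)))"

definition theta_pairing :: "laurent \<Rightarrow> tpoly \<Rightarrow> complex" where
  "theta_pairing \<omega> P =
     (\<Sum>S\<in>keys P. lookup P S * res_modes \<omega> (map theta_index (sorted_list_of_fset S)))"

subsection \<open>Products of modes in arbitrary order\<close>

text \<open>The pairings are given by the residue formula on all products of modes, not only on the
  ordered ones used in their definitions.\<close>

lemma theta_mult_single:
  "theta_mult k (single S c) = (if k |\<in>| S then 0
     else single (finsert k S) (c * (-1) ^ card {l \<in> fset S. l < k}))"
  by (simp add: theta_mult_def)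

lemma theta_mult_anticommute: "theta_mult k (theta_mult l P) = - theta_mult l (theta_mult k P)"
proof (induction P rule: fvs_induct)
  case zero
  show ?case by (simp add: theta_mult_def)
next
  case (single S c)
  have *: "theta_mult k (theta_mult l (single S c)) = - theta_mult l (theta_mult k (single S c))"
    if "k < l" for k l
  proof (cases "k |\<in>| S \<or> l |\<in>| S")
    case False
    have "{i \<in> fset (finsert k S). i < l} = insert k {i \<in> fset S. i < l}"
      and "{i \<in> fset (finsert l S). i < k} = {i \<in> fset S. i < k}"
      using that by auto
    moreover have "card (insert k {i \<in> fset S. i < l}) = Suc (card {i \<in> fset S. i < l})"
      using False by (subst card_insert_disjoint) auto
    ultimately have "theta_mult k (theta_mult l (single S c)) =
        single (finsert k (finsert l S)) (c * (-1) ^ card {i \<in> fset S. i < l} * (-1) ^ card {i \<in> fset S. i < k})"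
      and "theta_mult l (theta_mult k (single S c)) =
        single (finsert k (finsert l S)) (- (c * (-1) ^ card {i \<in> fset S. i < l} * (-1) ^ card {i \<in> fset S. i < k}))"
      using False that by (simp_all add: theta_mult_single finsert_commute mult_ac)
    then show ?thesis
      by (simp only: single_uminus) simp
  qed (auto simp: theta_mult_single theta_mult_def)
  consider "k < l" | "l < k" | "k = l" by linarith
  then show ?case
  proof cases
    case 1
    then show ?thesis by (rule *)
  next
    case 2
    then show ?thesis by (simp add: *)
  next
    case 3
    have "theta_mult k 0 = 0"
      by (simp add: theta_mult_def)
    with 3 show ?thesis by (simp add: theta_mult_single)
  qed
next
  case (add P Q)
  have "theta_mult i (X + Y) = theta_mult i X + theta_mult i Y" for i X Y
    by (simp add: theta_mult_def linext_add)
  with add show ?case by simp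
qed

lemma lookup_times_monomial:
  "lookup (\<omega> * single \<beta> 1) \<alpha> = lookup \<omega> (\<alpha> - \<beta>)" for \<omega> :: laurent
  by (induction \<omega> rule: fvs_induct)
     (auto simp: mult_single lookup_single when_def distrib_right lookup_add algebra_simps)

lemma lookup_sum_single:
  "lookup (\<Sum>i<m. single i (h i)) k = (if k < m then h k else 0)" for m :: nat
  by (simp add: lookup_sum lookup_single when_def)

lemma prod_zpow: "(\<Prod>i<m. zpow i (h i)) = single (\<Sum>i<m. single i (h i)) 1"
  by (induction m) (simp_all add: zpow_def mult_single)

lemma prod_zpow_power:
  "(\<Prod>i<m. zpow i 1) ^ n = single (\<Sum>i<m. single i (int n)) 1"
proof -
  have "zpow i 1 ^ n = zpow i (int n)" for i
    by (induction n) (simp_all add: zpow_def mult_single flip: single_add)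
  then have "(\<Prod>i<m. zpow i 1) ^ n = (\<Prod>i<m. zpow i (int n))"
    by (simp add: prod_power_distrib)
  then show ?thesis
    by (simp only: prod_zpow)
qed

lemma res_modes_eq:
  "res_modes \<omega> ns = lookup \<omega> (\<Sum>i<length ns. single i (-1 - ns ! i))"
proof -
  have "(\<Sum>i<length ns. single i (-1)) - (\<Sum>i<length ns. single i (ns ! i)) =
      (\<Sum>i<length ns. single i (-1 - ns ! i))"
    by (simp add: single_diff flip: sum_subtractf)
  then show ?thesis
    by (simp add: res_modes_def residue_def prod_zpow lookup_times_monomial)
qed

lemma res_modes_permute:
  assumes "\<And>\<alpha>. lookup \<omega> (Poly_Mapping.map_key \<pi> \<alpha>) = s * lookup \<omega> \<alpha>"
    and "\<pi> permutes {..<length ns}"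
  shows "res_modes \<omega> (permute_list \<pi> ns) = s * res_modes \<omega> ns"
proof -
  have "(\<Sum>i<length ns. single i (-1 - permute_list \<pi> ns ! i)) =
      Poly_Mapping.map_key \<pi> (\<Sum>i<length ns. single i (-1 - ns ! i))"
  proof (rule poly_mapping_eqI)
    fix k
    have "\<pi> k < length ns \<longleftrightarrow> k < length ns"
      using permutes_in_image[OF assms(2), of k] by simp
    then show "lookup (\<Sum>i<length ns. single i (-1 - permute_list \<pi> ns ! i)) k =
        lookup (Poly_Mapping.map_key \<pi> (\<Sum>i<length ns. single i (-1 - ns ! i))) k"
      using assms(2)
      by (simp add: map_key.rep_eq[OF permutes_inj[OF assms(2)]] lookup_sum_single permute_list_nth)
  qed
  then show ?thesis
    by (simp add: res_modes_eq assms(1))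
qed

lemma lookup_form:
  fixes m :: nat and c :: int and f :: laurent
  assumes "\<pi> permutes {..<m}" and "\<And>\<alpha>. lookup f (Poly_Mapping.map_key \<pi> \<alpha>) = s * lookup f \<alpha>"
  shows "lookup (f * single (\<Sum>i<m. single i c) 1) (Poly_Mapping.map_key \<pi> \<alpha>) =
    s * lookup (f * single (\<Sum>i<m. single i c) 1) \<alpha>"
proof -
  have "Poly_Mapping.map_key \<pi> \<alpha> - (\<Sum>i<m. single i c) =
      Poly_Mapping.map_key \<pi> (\<alpha> - (\<Sum>i<m. single i c))"
  proof (rule poly_mapping_eqI)
    fix k
    have "\<pi> k < m \<longleftrightarrow> k < m"
      using permutes_in_image[OF assms(1), of k] by simp
    then show "lookup (Poly_Mapping.map_key \<pi> \<alpha> - (\<Sum>i<m. single i c)) k =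
        lookup (Poly_Mapping.map_key \<pi> (\<alpha> - (\<Sum>i<m. single i c))) k"
      by (simp add: map_key.rep_eq[OF permutes_inj[OF assms(1)]] lookup_minus
          lookup_sum_single)
  qed
  then show ?thesis
    by (simp add: lookup_times_monomial assms(2))
qed

lemma e_pairing_word:
  assumes "\<omega> \<in> even_forms N (length ks)"
  shows "e_pairing N \<omega> (single (mset ks) 1) = res_modes \<omega> (map (e_index N) ks)"
proof -
  obtain f where f: "sym_poly (length ks) f"
      and \<omega>: "\<omega> = f * single (\<Sum>i<length ks. single i (int (N - 1))) 1"
    using assms by (auto simp: even_forms_def prod_zpow_power mult.commute)
  obtain \<pi> where \<pi>: "\<pi> permutes {..<length ks}" "permute_list \<pi> ks = sort ks"
    using mset_eq_permutation[of "sort ks" ks] by auto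
  have "res_modes \<omega> (permute_list \<pi> (map (e_index N) ks)) = 1 * res_modes \<omega> (map (e_index N) ks)"
    unfolding \<omega> using f \<pi>(1)
    by (intro res_modes_permute lookup_form) (auto simp: sym_poly_def)
  moreover have "permute_list \<pi> (map (e_index N) ks) = map (e_index N) (sort ks)"
    using permute_list_map[OF \<pi>(1)] \<pi>(2) by simp
  ultimately show ?thesis
    by (simp add: e_pairing_def sorted_list_of_multiset_mset)
qed

lemma theta_pairing_word:
  assumes "\<omega> \<in> odd_forms (length ks)"
  shows "theta_pairing \<omega> (theta_word ks) = res_modes \<omega> (map theta_index ks)"
proof -
  define m where "m = length ks"
  define D where "D = (\<lambda>ls. res_modes \<omega> (map theta_index ls))"
  obtain g where g: "antisym_poly m g" and \<omega>: "\<omega> = g * single (\<Sum>i<m. single i (-1)) 1"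
    using assms by (auto simp: odd_forms_def prod_zpow m_def)
  have swap: "D (xs @ a # b # ys) = - D (xs @ b # a # ys)"
    if "length (xs @ a # b # ys) = m" for xs a b ys
  proof -
    define \<pi> where "\<pi> = transpose (length xs) (Suc (length xs))"
    have \<pi>: "\<pi> permutes {..<m}"
      unfolding \<pi>_def by (rule permutes_swap_id) (use that in auto)
    have "res_modes \<omega> (permute_list \<pi> (map theta_index (xs @ b # a # ys))) =
        of_int (sign \<pi>) * D (xs @ b # a # ys)"
      unfolding \<omega> D_def using g \<pi> that
      by (intro res_modes_permute lookup_form) (auto simp: antisym_poly_def)
    moreover have "permute_list \<pi> (map theta_index (xs @ b # a # ys)) = map theta_index (xs @ a # b # ys)"
      by (rule nth_equalityI)
        (use \<pi> that in \<open>auto simp: permute_list_def \<pi>_def nth_append nth_Cons transpose_def split: nat.splits\<close>)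
    ultimately show ?thesis
      by (simp add: D_def \<pi>_def sign_swap_id)
  qed
  have move: "D (xs @ k # ls) = (if k \<in> set ls then 0
      else (-1) ^ card {l \<in> set ls. l < k} * D (xs @ insort k ls))"
    if "sorted ls" "distinct ls" "length (xs @ k # ls) = m" for xs k ls
    using that
  proof (induction ls arbitrary: xs)
    case (Cons l ls)
    consider "k < l" | "k = l" | "l < k" by linarith
    then show ?case
    proof cases
      case 1
      with Cons.prems have *: "{i \<in> set (l # ls). i < k} = {}" and "k \<notin> set (l # ls)"
        by auto
      with 1 show ?thesis unfolding * by simp
    next
      case 2
      with swap[of xs k k ls] Cons.prems show ?thesis by simp
    next
      case 3
      have "D (xs @ k # l # ls) = - D ((xs @ [l]) @ k # ls)"
        using swap[of xs k l ls] Cons.prems by simp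
      also have "\<dots> = - (if k \<in> set ls then 0
          else (-1) ^ card {i \<in> set ls. i < k} * D ((xs @ [l]) @ insort k ls))"
        using Cons.prems by (subst Cons.IH) auto
      moreover have "{i \<in> set (l # ls). i < k} = insert l {i \<in> set ls. i < k}"
        using 3 by auto
      ultimately show ?thesis
        using 3 Cons.prems by simp
    qed
  qed simp
  have "(theta_word ls = 0 \<and> (\<forall>xs. length (xs @ ls) = m \<longrightarrow> D (xs @ ls) = 0)) \<or>
      (\<exists>S c. theta_word ls = single S c \<and> fcard S = length ls \<and>
        (\<forall>xs. length (xs @ ls) = m \<longrightarrow> D (xs @ ls) = c * D (xs @ sorted_list_of_fset S)))" for ls
  proof (induction ls)
    case Nil
    show ?case
      by (intro disjI2 exI[of _ "{||}"] exI[of _ 1]) (simp add: theta_word_def sorted_list_of_fset.rep_eq)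
  next
    case (Cons k ls)
    have w: "theta_word (k # ls) = theta_mult k (theta_word ls)"
      by (simp add: theta_word_def)
    from Cons.IH show ?case
    proof (elim disjE exE conjE)
      assume "theta_word ls = 0" and *: "\<forall>xs. length (xs @ ls) = m \<longrightarrow> D (xs @ ls) = 0"
      moreover have "D (xs @ k # ls) = 0" if "length (xs @ k # ls) = m" for xs
        using *[rule_format, of "xs @ [k]"] that by simp
      ultimately show ?thesis
        by (simp add: w theta_mult_def)
    next
      fix S c
      assume S: "theta_word ls = single S c" "fcard S = length ls"
        and *: "\<forall>xs. length (xs @ ls) = m \<longrightarrow> D (xs @ ls) = c * D (xs @ sorted_list_of_fset S)"
      have len: "length (sorted_list_of_fset S) = length ls"
        using S(2) by (simp add: sorted_list_of_fset.rep_eq fcard.rep_eq)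
      have D: "D (xs @ k # ls) = c * (if k |\<in>| S then 0
          else (-1) ^ card {l \<in> fset S. l < k} * D (xs @ insort k (sorted_list_of_fset S)))"
        if "length (xs @ k # ls) = m" for xs
        using *[rule_format, of "xs @ [k]"] that len
          move[of "sorted_list_of_fset S" xs k]
        by (simp add: sorted_list_of_fset.rep_eq)
      show ?thesis
      proof (cases "k |\<in>| S")
        case True
        with D S show ?thesis
          by (auto simp: w theta_mult_single)
      next
        case False
        then have "insort k (sorted_list_of_fset S) = sorted_list_of_fset (finsert k S)"
          by (simp add: sorted_list_of_fset.rep_eq sorted_list_of_set_insert)
        with False D S show ?thesis
          by (intro disjI2 exI[of _ "finsert k S"] exI[of _ "c * (-1) ^ card {l \<in> fset S. l < k}"])
             (auto simp: w theta_mult_single fcard_finsert_disjoint)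
      qed
    qed
  qed
  from this[of ks] have "theta_pairing \<omega> (theta_word ks) = D ([] @ ks)"
  proof (elim disjE exE conjE)
    fix S c
    assume "theta_word ks = single S c"
      and "\<forall>xs. length (xs @ ks) = m \<longrightarrow> D (xs @ ks) = c * D (xs @ sorted_list_of_fset S)"
    then show ?thesis
      by (cases "c = 0") (simp_all add: theta_pairing_def m_def, simp_all add: D_def)
  qed (simp add: theta_pairing_def m_def)
  then show ?thesis
    by (simp add: D_def)
qed

definition e_annihilator :: "nat \<Rightarrow> nat \<Rightarrow> laurent set" where
  "e_annihilator N m = {\<omega> \<in> even_forms N m. \<forall>P \<in> I_even N \<inter> V_charge m. e_pairing N \<omega> P = 0}"

definition theta_annihilator :: "nat \<Rightarrow> nat \<Rightarrow> laurent set" where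
  "theta_annihilator N m = {\<omega> \<in> odd_forms m. \<forall>P \<in> I_odd N \<inter> U_charge m. theta_pairing \<omega> P = 0}"

text \<open>\<open>\<Phi>\<close> is a linear isomorphism from the space \<open>A\<close> of forms onto the space \<open>D\<close> of functionals such
  that \<open>\<Phi> \<omega>\<close> takes the value \<open>\<langle>\<omega>, P\<rangle>\<close> at \<open>P|0\<rangle>\<close>, for \<open>P\<close> of the given charge.\<close>

definition dual_iso ::
  "laurent set \<Rightarrow> (fock \<Rightarrow> complex) set \<Rightarrow> (laurent \<Rightarrow> ('b \<Rightarrow>\<^sub>0 complex) \<Rightarrow> complex) \<Rightarrow>
   (('b \<Rightarrow>\<^sub>0 complex) \<Rightarrow> fock) \<Rightarrow> ('b \<Rightarrow>\<^sub>0 complex) set \<Rightarrow> (laurent \<Rightarrow> fock \<Rightarrow> complex) \<Rightarrow> bool" where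
  "dual_iso A D pairing ev X \<Phi> \<longleftrightarrow>
     bij_betw \<Phi> A D \<and>
     (\<forall>\<omega>\<in>A. \<forall>\<eta>\<in>A. \<forall>w. \<Phi> (\<omega> + \<eta>) w = \<Phi> \<omega> w + \<Phi> \<eta> w) \<and>
     (\<forall>c. \<forall>\<omega>\<in>A. \<forall>w. \<Phi> (scl c \<omega>) w = c * \<Phi> \<omega> w) \<and>
     (\<forall>\<omega>\<in>A. \<forall>P\<in>X. \<Phi> \<omega> (ev P) = pairing \<omega> P)"

end

(* The vertex operators satisfy [a_n, Y(z)] = \<mu> z^n Y(z) for n > 0, hence the operators a_n act on
   Y(z_1) ... Y(z_m)|0> as multiplication by the power sums \<mu> p_n(z). Consequently every matrix
   coefficient of this vector is, up to a nonzero factor, a product of power sums times its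
   coefficient at the highest weight vector, which is the M-th power of the Vandermonde product.
   So a polynomial P of charge m in the modes kills the vacuum iff it pairs to zero with all products
   of power sums times Vandermonde^M. These products span Vandermonde^M times the symmetric
   polynomials, and they are homogeneous, so that the double annihilator in each degree is a
   statement on finite-dimensional spaces. *)

theory Submission
  imports Defs
begin

section \<open>Exponentials of operators\<close>

text \<open>Even and odd lattices share one argument: all statements are made for a general M, and a
  permutation of the variables multiplies Vandermonde^M times a symmetric polynomial by sign^M. The
  rules for reordering the modes and the vanishing of modes on the vacuum are read off from the
  matrix coefficients, which have this sign and contain no negative exponents. The Vandermonde power
  arises at the highest weight vector because there only the constant term of the creation
  exponential of the leftmost factor is visible. Its annihilation exponential, with w = z_m, passes
  each earlier factor at the price of (1 - z_i/w)^M and then meets the vacuum. The exchange rule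
  behind this rests on t d/dt exp B = (t B') exp B, a recursion for the coefficients of an
  exponential that makes induction on the index possible. Surjectivity onto the restricted dual
  needs a dual basis for the monomials in the modes; signed orbit sums provide it, up to the order
  of a stabilizer.\<close>

definition lin :: "(('a \<Rightarrow>\<^sub>0 complex) \<Rightarrow> ('b \<Rightarrow>\<^sub>0 complex)) \<Rightarrow> bool" where
  "lin f \<longleftrightarrow> (\<forall>u v. f (u + v) = f u + f v) \<and> (\<forall>c v. f (scl c v) = scl c (f v))"

lemma lin_add: "lin f \<Longrightarrow> f (u + v) = f u + f v"
  and lin_scl: "lin f \<Longrightarrow> f (scl c v) = scl c (f v)"
  by (simp_all add: lin_def)

lemma lin_zero: "lin f \<Longrightarrow> f 0 = 0"
  using lin_add[of f 0 0] by simp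

lemma lin_minus: "lin f \<Longrightarrow> f (u - v) = f u - f v"
  using lin_add[of f "u - v" v] by simp

lemma lin_sum: "lin f \<Longrightarrow> f (\<Sum>x\<in>A. g x) = (\<Sum>x\<in>A. f (g x))"
  by (induction A rule: infinite_finite_induct) (simp_all add: lin_zero lin_add)

lemma lin_linext: "lin (linext f)"
  by (simp add: lin_def linext_add linext_scl)

lemma lin_heis: "lin (heis M n)"
  by (simp add: lin_def heis_add heis_scl)

lemma lin_const_zero: "lin (\<lambda>v. 0)"
  by (simp add: lin_def)

lemma lin_plus: "lin f \<Longrightarrow> lin g \<Longrightarrow> lin (\<lambda>v. f v + g v)"
  by (simp add: lin_def fvs.scale_right_distrib)

lemma lin_scale: "lin f \<Longrightarrow> lin (\<lambda>v. scl c (f v))"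
  by (simp add: lin_def fvs.scale_right_distrib mult.commute)

lemma lin_compose: "lin f \<Longrightarrow> lin g \<Longrightarrow> lin (\<lambda>v. f (g v))"
  by (simp add: lin_def)

lemma lin_setsum: "(\<And>x. x \<in> A \<Longrightarrow> lin (f x)) \<Longrightarrow> lin (\<lambda>v. \<Sum>x\<in>A. f x v)"
  by (induction A rule: infinite_finite_induct) (auto simp: lin_const_zero lin_plus)

lemma lin_eqI:
  assumes "lin f" "lin g" "\<And>x. f (single x 1) = g (single x 1)"
  shows "f v = g v"
proof (induction v rule: fvs_induct)
  case (single x c)
  have "f (scl c (single x 1)) = g (scl c (single x 1))"
    by (simp only: lin_scl[OF assms(1)] lin_scl[OF assms(2)] assms(3))
  then show ?case by simp
qed (use assms in \<open>simp_all add: lin_zero lin_add\<close>)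

text \<open>The coefficient of t^r in the l-th power of B(t) = b_1 t + b_2 t^2 + ..., applied to v.
  It isolates the compositions of r with l parts and, unlike the list sum in
  \<open>exp_coeff\<close>, allows induction on l.\<close>

fun comp_sum :: "(nat \<Rightarrow> fock \<Rightarrow> fock) \<Rightarrow> nat \<Rightarrow> nat \<Rightarrow> fock \<Rightarrow> fock" where
  "comp_sum b 0 r v = (if r = 0 then v else 0)"
| "comp_sum b (Suc l) r v = (\<Sum>n=1..r. b n (comp_sum b l (r - n) v))"

lemma lin_comp_sum: "(\<And>n. lin (b n)) \<Longrightarrow> lin (comp_sum b l r)"
proof (induction l arbitrary: r)
  case 0
  then show ?case by (simp add: lin_def)
next
  case (Suc l)
  have "lin (\<lambda>v. b n (comp_sum b l (r - n) v))" for n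
    by (rule lin_compose[OF Suc.prems Suc.IH[OF Suc.prems]])
  then show ?case by (simp add: lin_setsum)
qed

lemma comp_sum_foldr:
  assumes "\<And>n. lin (b n)"
  shows "comp_sum b l r v = (\<Sum>ns | 0 \<notin> set ns \<and> sum_list ns = r \<and> length ns = l. foldr b ns v)"
proof (induction l arbitrary: r)
  case 0
  have "{ns. 0 \<notin> set ns \<and> sum_list ns = r \<and> length ns = 0} = (if r = 0 then {[]} else {})"
    by auto
  then show ?case by simp
next
  case (Suc l)
  let ?C = "\<lambda>(r::nat) (l::nat). {ns. 0 \<notin> set ns \<and> sum_list ns = r \<and> length ns = l}"
  have fin: "finite (?C r l)" for r l
    by (rule finite_subset[OF _ finite_compositions[of r]]) auto
  have eq: "?C r (Suc l) = (\<lambda>(n, ns). n # ns) ` (SIGMA n:{1..r}. ?C (r - n) l)"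
  proof (intro equalityI subsetI)
    fix ns assume "ns \<in> ?C r (Suc l)"
    then show "ns \<in> (\<lambda>(n, ns). n # ns) ` (SIGMA n:{1..r}. ?C (r - n) l)"
      by (cases ns) (auto simp: image_iff)
  qed auto
  have "comp_sum b (Suc l) r v = (\<Sum>n=1..r. \<Sum>ns\<in>?C (r - n) l. b n (foldr b ns v))"
    by (simp add: Suc.IH lin_sum[OF assms])
  also have "\<dots> = (\<Sum>(n, ns)\<in>(SIGMA n:{1..r}. ?C (r - n) l). b n (foldr b ns v))"
    using fin by (subst sum.Sigma) auto
  also have "\<dots> = (\<Sum>ns\<in>?C r (Suc l). foldr b ns v)"
    unfolding eq by (subst sum.reindex) (auto intro!: inj_onI sum.cong)
  finally show ?case .
qed

text \<open>A composition of r has at most r parts, so any L \<ge> r bounds the exponential series.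
  The free bound lets coefficients of different index be written over one range.\<close>

lemma exp_coeff_comp_sum:
  assumes "\<And>n. lin (b n)" "r \<le> L"
  shows "exp_coeff b r v = (\<Sum>l\<le>L. scl (1 / fact l) (comp_sum b l r v))"
proof -
  let ?C = "{ns. 0 \<notin> set ns \<and> sum_list ns = r}"
  have len: "length ns \<le> sum_list ns" if "0 \<notin> set ns" for ns :: "nat list"
    using that by (induction ns) auto
  have "(\<Sum>l\<le>L. scl (1 / fact l) (comp_sum b l r v)) =
      (\<Sum>l\<le>L. \<Sum>ns | ns \<in> ?C \<and> length ns = l. scl (1 / fact (length ns)) (foldr b ns v))"
    by (auto simp: comp_sum_foldr[OF assms(1)] fvs.scale_sum_right intro!: sum.cong)
  also have "\<dots> = exp_coeff b r v"
    unfolding exp_coeff_def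
  proof (rule sum.group)
    show "length ` ?C \<subseteq> {..L}"
      using len assms(2) by fastforce
  qed (use finite_compositions in auto)
  finally show ?thesis by simp
qed

lemma exp_coeff_0: "(\<And>n. lin (b n)) \<Longrightarrow> exp_coeff b 0 v = v"
  by (subst exp_coeff_comp_sum[of b 0 0]) auto

lemma lin_exp_coeff: "(\<And>n. lin (b n)) \<Longrightarrow> lin (exp_coeff b r)"
proof -
  assume *: "\<And>n. lin (b n)"
  have "exp_coeff b r = (\<lambda>v. \<Sum>l\<le>r. scl (1 / fact l) (comp_sum b l r v))"
    by (rule ext, rule exp_coeff_comp_sum) (use * in auto)
  then show ?thesis
    by (auto intro!: lin_setsum lin_scale lin_comp_sum *)
qed

text \<open>The commutator with A is a derivation and [A, B(t)] = c t^n is a scalar, hence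
  [A, B(t)^l] = l c t^n B(t)^(l-1). For l = 0 the factor l removes the default value of
  \<open>l - 1\<close>.\<close>

lemma comp_sum_commutator:
  assumes b: "\<And>n. lin (b n)" and "lin A" and "n > 0"
    and comm: "\<And>i v. i > 0 \<Longrightarrow> A (b i v) = b i (A v) + (if i = n then scl c v else 0)"
  shows "A (comp_sum b l r v) = comp_sum b l r (A v) +
    (if n \<le> r then scl (of_nat l * c) (comp_sum b (l - 1) (r - n) v) else 0)"
proof (induction l arbitrary: r)
  case 0
  then show ?case using lin_zero[OF assms(2)] by simp
next
  case (Suc l)
  have "A (comp_sum b (Suc l) r v) = (\<Sum>i=1..r. b i (A (comp_sum b l (r - i) v)) +
      (if i = n then scl c (comp_sum b l (r - i) v) else 0))"
    by (simp add: lin_sum[OF assms(2)] comm)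
  also have "\<dots> = (\<Sum>i=1..r. b i (A (comp_sum b l (r - i) v))) +
      (if n \<le> r then scl c (comp_sum b l (r - n) v) else 0)"
    using \<open>n > 0\<close> by (simp add: sum.distrib Suc_leI)
  also have "(\<Sum>i=1..r. b i (A (comp_sum b l (r - i) v))) = comp_sum b (Suc l) r (A v) +
      (\<Sum>i=1..r. if n \<le> r - i then scl (of_nat l * c) (b i (comp_sum b (l - 1) (r - i - n) v)) else 0)"
    unfolding comp_sum.simps sum.distrib[symmetric]
    by (intro sum.cong refl) (simp add: Suc.IH lin_add[OF b] lin_scl[OF b] lin_zero[OF b])
  \<comment> \<open>The condition confines i to 1..r - n, and over that range the terms form the
    power of exponent l at index r - n.\<close>
  also have "(\<Sum>i=1..r. if n \<le> r - i then scl (of_nat l * c) (b i (comp_sum b (l - 1) (r - i - n) v)) else 0)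
     = (if n \<le> r then scl (of_nat l * c) (comp_sum b l (r - n) v) else 0)"
  proof (cases l)
    case (Suc l')
    have "(\<Sum>i=1..r. if n \<le> r - i then scl (of_nat l * c) (b i (comp_sum b (l - 1) (r - i - n) v)) else 0)
      = (\<Sum>i\<in>(if n \<le> r then {1..r-n} else {}). scl (of_nat l * c) (b i (comp_sum b (l - 1) (r - n - i) v)))"
      using \<open>n > 0\<close> by (intro sum.mono_neutral_cong_right) (auto simp: add.commute split: if_splits)
    then show ?thesis
      by (simp add: Suc fvs.scale_sum_right)
  qed (auto intro!: sum.neutral)
  finally show ?case
    by (cases "n \<le> r") (simp_all add: distrib_right fvs.scale_left_distrib add_ac)
qed

text \<open>[A, exp B(t)] = c t^n exp B(t), because l / l! = 1 / (l-1)!. The bound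
  \<open>Suc r\<close> in the proof leaves the range up to r after l is shifted by one.\<close>

lemma exp_coeff_commutator:
  assumes b: "\<And>n. lin (b n)" and "lin A" and "n > 0"
    and comm: "\<And>i v. i > 0 \<Longrightarrow> A (b i v) = b i (A v) + (if i = n then scl c v else 0)"
  shows "A (exp_coeff b r v) = exp_coeff b r (A v) +
    (if n \<le> r then scl c (exp_coeff b (r - n) v) else 0)"
proof -
  have "A (exp_coeff b r v) = (\<Sum>l\<le>Suc r. scl (1 / fact l) (A (comp_sum b l r v)))"
    by (subst exp_coeff_comp_sum[OF b, of r "Suc r"])
      (simp_all only: le_SucI order_refl lin_sum[OF assms(2)] lin_scl[OF assms(2)])
  also have "\<dots> = exp_coeff b r (A v) + (if n \<le> r then
      (\<Sum>l\<le>Suc r. scl (1 / fact l * (of_nat l * c)) (comp_sum b (l - 1) (r - n) v)) else 0)"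
    by (subst exp_coeff_comp_sum[OF b, of r "Suc r"])
      (simp_all only: le_SucI order_refl comp_sum_commutator[OF assms] fvs.scale_right_distrib
        sum.distrib fvs.scale_scale if_distrib[of "scl _"] fvs.scale_zero_right split: if_splits, simp)
  also have "(\<Sum>l\<le>Suc r. scl (1 / fact l * (of_nat l * c)) (comp_sum b (l - 1) (r - n) v)) =
      (\<Sum>l\<le>r. scl c (scl (1 / fact l) (comp_sum b l (r - n) v)))"
    by (subst sum.atMost_Suc_shift) (simp add: field_simps del: of_nat_Suc)
  also have "\<dots> = scl c (exp_coeff b (r - n) v)"
    by (subst exp_coeff_comp_sum[OF b, of "r - n" r]) (simp_all add: fvs.scale_sum_right)
  finally show ?thesis .
qed

text \<open>The power rule t d/dt B^l = l (t B') B^(l-1) for commuting coefficients.\<close>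

lemma comp_sum_recursion:
  assumes b: "\<And>n. lin (b n)" and comm: "\<And>i j v. b i (b j v) = b j (b i v)"
  shows "scl (of_nat r) (comp_sum b l r v) =
    scl (of_nat l) (\<Sum>n=1..r. scl (of_nat n) (b n (comp_sum b (l - 1) (r - n) v)))"
proof (induction l arbitrary: r)
  case 0
  then show ?case by simp
next
  case (Suc l)
  \<comment> \<open>Leibniz rule: in r = i + (r - i) the first summand differentiates the outer
    factor, the second one the remaining power.\<close>
  have "scl (of_nat r) (comp_sum b (Suc l) r v) =
      (\<Sum>i=1..r. scl (of_nat i) (b i (comp_sum b l (r - i) v)) + b i (scl (of_nat (r - i)) (comp_sum b l (r - i) v)))"
    by (auto simp: fvs.scale_sum_right lin_scl[OF b] simp flip: fvs.scale_left_distrib of_nat_add intro!: sum.cong)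
  also have "\<dots> = (\<Sum>i=1..r. scl (of_nat i) (b i (comp_sum b l (r - i) v))) +
     (\<Sum>i=1..r. b i (scl (of_nat l) (\<Sum>n=1..r - i. scl (of_nat n) (b n (comp_sum b (l - 1) (r - i - n) v)))))"
    by (simp only: sum.distrib Suc.IH)
  also have "(\<Sum>i=1..r. b i (scl (of_nat l) (\<Sum>n=1..r - i. scl (of_nat n) (b n (comp_sum b (l - 1) (r - i - n) v)))))
    = scl (of_nat l) (\<Sum>n=1..r. scl (of_nat n) (b n (comp_sum b l (r - n) v)))"
  proof (cases l)
    case 0
    then show ?thesis by (simp add: lin_zero[OF b])
  next
    case (Suc l')
    let ?g = "\<lambda>i n. scl (of_nat l * of_nat n) (b i (b n (comp_sum b l' (r - i - n) v)))"
    have "(\<Sum>i=1..r. b i (scl (of_nat l) (\<Sum>n=1..r - i. scl (of_nat n) (b n (comp_sum b (l - 1) (r - i - n) v)))))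
      = (\<Sum>i=1..r. \<Sum>n=1..r-i. ?g i n)"
      by (simp add: Suc lin_scl[OF b] lin_sum[OF b] fvs.scale_sum_right)
    also have "\<dots> = (\<Sum>i=1..r. \<Sum>n\<in>{n\<in>{1..r}. i + n \<le> r}. ?g i n)"
      by (intro sum.cong refl) auto
    also have "\<dots> = (\<Sum>n=1..r. \<Sum>i\<in>{i\<in>{1..r}. i + n \<le> r}. ?g i n)"
      by (rule sum.swap_restrict) auto
    also have "\<dots> = (\<Sum>n=1..r. \<Sum>i=1..r-n. ?g i n)"
      by (intro sum.cong refl) auto
    also have "\<dots> = (\<Sum>n=1..r. scl (of_nat l * of_nat n) (\<Sum>i=1..r-n. b n (b i (comp_sum b l' (r - n - i) v))))"
      by (simp add: fvs.scale_sum_right comm add.commute)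
    also have "\<dots> = scl (of_nat l) (\<Sum>n=1..r. scl (of_nat n) (b n (comp_sum b l (r - n) v)))"
      by (simp add: Suc fvs.scale_sum_right lin_sum[OF b])
    finally show ?thesis .
  qed
  finally show ?case
    by (simp add: fvs.scale_left_distrib)
qed

text \<open>t d/dt exp B = (t B') exp B. For r > 0 it expresses the coefficient of index r through
  those of smaller index.\<close>

lemma exp_coeff_recursion:
  assumes b: "\<And>n. lin (b n)" and comm: "\<And>i j v. b i (b j v) = b j (b i v)"
  shows "scl (of_nat r) (exp_coeff b r v) = (\<Sum>n=1..r. scl (of_nat n) (b n (exp_coeff b (r - n) v)))"
proof -
  have E: "exp_coeff b (r - n) v = (\<Sum>l\<le>L. scl (1 / fact l) (comp_sum b l (r - n) v))" if "r \<le> L" for n L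
    using that by (intro exp_coeff_comp_sum[OF b]) auto
  have "scl (of_nat r) (exp_coeff b r v) = (\<Sum>l\<le>Suc r. scl (1 / fact l) (scl (of_nat r) (comp_sum b l r v)))"
    using E[of "Suc r" 0] by (simp only: diff_zero le_SucI order_refl fvs.scale_sum_right fvs.scale_left_commute)
  also have "\<dots> = (\<Sum>l\<le>Suc r. scl (1 / fact l * of_nat l) (\<Sum>n=1..r. scl (of_nat n) (b n (comp_sum b (l - 1) (r - n) v))))"
    by (intro sum.cong refl, subst comp_sum_recursion[OF assms], rule fvs.scale_scale)
  also have "\<dots> = (\<Sum>l\<le>r. scl (1 / fact l) (\<Sum>n=1..r. scl (of_nat n) (b n (comp_sum b l (r - n) v))))"
    by (subst sum.atMost_Suc_shift) (simp add: field_simps del: of_nat_Suc)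
  also have "\<dots> = (\<Sum>l\<le>r. \<Sum>n=1..r. scl (of_nat n) (b n (scl (1 / fact l) (comp_sum b l (r - n) v))))"
    by (simp only: fvs.scale_sum_right lin_scl[OF b] fvs.scale_left_commute)
  also have "\<dots> = (\<Sum>n=1..r. \<Sum>l\<le>r. scl (of_nat n) (b n (scl (1 / fact l) (comp_sum b l (r - n) v))))"
    by (rule sum.swap)
  also have "\<dots> = (\<Sum>n=1..r. scl (of_nat n) (b n (exp_coeff b (r - n) v)))"
    by (simp only: E[OF order_refl] fvs.scale_sum_right lin_sum[OF b])
  finally show ?thesis .
qed

section \<open>Commutation relations of the modes\<close>

lemma sqrtM_mult_self: "sqrtM M * sqrtM M = of_nat M"
  unfolding sqrtM_def by (simp flip: of_real_mult)

lemma lin_eq_on: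
  assumes "lin f" "lin g" "\<And>x. x \<in> keys v \<Longrightarrow> f (single x 1) = g (single x 1)"
  shows "f v = g v"
proof -
  have v: "v = (\<Sum>x\<in>keys v. scl (lookup v x) (single x 1))"
    by (rule poly_mapping_eqI) (auto simp: lookup_sum lookup_single when_def in_keys_iff sum.If_cases)
  have "f (\<Sum>x\<in>keys v. scl (lookup v x) (single x 1)) = g (\<Sum>x\<in>keys v. scl (lookup v x) (single x 1))"
    by (simp only: lin_sum[OF assms(1)] lin_sum[OF assms(2)] lin_scl[OF assms(1)] lin_scl[OF assms(2)] assms(3) cong: sum.cong)
  with v show ?thesis by simp
qed

lemma lookup_lin:
  assumes "lin f"
  shows "lookup (f v) y = (\<Sum>x\<in>keys v. lookup v x * lookup (f (single x 1)) y)"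
proof -
  have "f v = linext (\<lambda>x. f (single x 1)) v"
    by (rule lin_eqI[OF assms lin_linext]) simp
  then show ?thesis
    by (simp add: linext_def lookup_sum)
qed

lemma heis_commute: "n + m \<noteq> 0 \<Longrightarrow> heis M n (heis M m v) = heis M m (heis M n v)"
  using heis_commutator[of M n m v] by simp

lemma lin_exp_neg: "lin (exp_neg M j s)" and lin_exp_pos: "lin (exp_pos M j s)"
  unfolding exp_neg_def exp_pos_def by (intro lin_exp_coeff lin_scale lin_heis)+

lemma exp_neg_0: "exp_neg M j 0 v = v" and exp_pos_0: "exp_pos M j 0 v = v"
  unfolding exp_neg_def exp_pos_def by (intro exp_coeff_0 lin_scale lin_heis)+

lemma heis_exp_pos:
  assumes "n > 0"
  shows "heis M (int n) (exp_pos M j r v) = exp_pos M j r (heis M (int n) v)"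
proof -
  have "heis M (int n) (exp_pos M j r v) = exp_pos M j r (heis M (int n) v) +
      (if n \<le> r then scl 0 (exp_pos M j (r - n) v) else 0)"
    unfolding exp_pos_def
    by (rule exp_coeff_commutator[OF lin_scale[OF lin_heis] lin_heis assms])
      (use assms in \<open>simp only: heis_scl, simp add: heis_commute\<close>)
  then show ?thesis by simp
qed

lemma exp_pos_recursion:
  "scl (of_nat r) (exp_pos M j r v) =
    (\<Sum>n=1..r. scl (- (of_int j * sqrtM M)) (heis M (int n) (exp_pos M j (r - n) v)))"
proof -
  have comm: "heis M (int i) (heis M (int k) v) = heis M (int k) (heis M (int i) v)" for i k v
    by (cases "i = 0 \<and> k = 0") (auto simp: heis_commute)
  show ?thesis
    unfolding exp_pos_def
    by (subst exp_coeff_recursion[OF lin_scale[OF lin_heis]])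
      (simp only: heis_scl comm mult.commute fvs.scale_scale, auto intro!: sum.cong)
qed

text \<open>Integer indices, with value 0 below zero, let the shift from s to s - n in the
  commutation rule go through without a case distinction.\<close>

definition exp_neg_int :: "nat \<Rightarrow> int \<Rightarrow> fock \<Rightarrow> fock" where
  "exp_neg_int M s v = (if s < 0 then 0 else exp_neg M 1 (nat s) v)"

lemma lin_exp_neg_int: "lin (exp_neg_int M s)"
  unfolding exp_neg_int_def using lin_exp_neg by (cases "s < 0") (auto simp: lin_def)

text \<open>The scalar is \<mu> = \<open>sqrtM M\<close>: the coefficient \<mu>/n of a_{-n} in the
  exponent multiplies [a_n, a_{-n}] = n.\<close>

lemma heis_exp_neg_int:
  assumes "n > 0"
  shows "heis M (int n) (exp_neg_int M s v) =
    exp_neg_int M s (heis M (int n) v) + scl (sqrtM M) (exp_neg_int M (s - int n) v)"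
proof (cases "s < 0")
  case False
  have "heis M (int n) (exp_neg M 1 (nat s) v) = exp_neg M 1 (nat s) (heis M (int n) v) +
      (if n \<le> nat s then scl (sqrtM M) (exp_neg M 1 (nat s - n) v) else 0)"
    unfolding exp_neg_def
  proof (rule exp_coeff_commutator)
    fix i v assume "(i::nat) > 0"
    then show "heis M (int n) (scl (- (of_int 1 * sqrtM M) / of_int (- int i)) (heis M (- int i) v)) =
      scl (- (of_int 1 * sqrtM M) / of_int (- int i)) (heis M (- int i) (heis M (int n) v)) +
        (if i = n then scl (sqrtM M) v else 0)"
      using heis_commutator[of M "int n" "- int i" v] assms
      by (auto simp: heis_scl algebra_simps fvs.scale_right_distrib)
  qed (use assms in \<open>auto simp: lin_scale lin_heis\<close>)
  then show ?thesis
    using False by (auto simp: exp_neg_int_def nat_diff_distrib)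
qed (simp add: exp_neg_int_def)

lemma lin_shift: "lin (shift j)" and lin_vertex: "lin (vertex_coeff M j p)"
  by (simp_all add: shift_def vertex_coeff_def lin_linext)

text \<open>The exponent condition fixes s = p - k M + r, and r beyond the degree of \<kappa>
  contributes nothing. The bound B is free so that a vector and its images under lowering operators
  can share it.\<close>

lemma vertex_single:
  assumes "(\<Sum>i\<in>#\<kappa>. Suc i) \<le> B"
  shows "vertex_coeff M 1 p (single (k, \<kappa>) 1) =
    shift 1 (\<Sum>r\<le>B. exp_neg_int M (p - k * int M + int r) (exp_pos M 1 r (single (k, \<kappa>) 1)))"
proof -
  let ?v = "single (k, \<kappa>) 1 :: fock"
  let ?g = "\<lambda>(r, s). if 1 * k * int M + int s - int r = p then exp_neg M 1 s (exp_pos M 1 r ?v) else 0"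
  let ?R = "{r. r \<le> B \<and> 0 \<le> p - k * int M + int r}"
  let ?h = "\<lambda>r. (r, nat (p - k * int M + int r))"
  have "Sum_any ?g = sum ?g (?h ` ?R)"
  proof (rule Sum_any.expand_superset)
    show "{a. ?g a \<noteq> 0} \<subseteq> ?h ` ?R"
    proof (rule subsetI)
      fix a assume a: "a \<in> {a. ?g a \<noteq> 0}"
      obtain r s where rs: "a = (r, s)" by fastforce
      with a have p: "p = k * int M + int s - int r" and *: "exp_neg M 1 s (exp_pos M 1 r ?v) \<noteq> 0"
        by (auto split: if_splits)
      then have "r \<le> (\<Sum>i\<in>#\<kappa>. Suc i)"
        using exp_pos_eq_0 by (metis exp_neg_zero not_le)
      with assms p show "a \<in> ?h ` ?R"
        by (auto simp: image_iff rs)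
    qed
  qed simp
  also have "\<dots> = (\<Sum>r\<in>?R. exp_neg_int M (p - k * int M + int r) (exp_pos M 1 r ?v))"
    by (subst sum.reindex) (auto intro!: inj_onI sum.cong simp: exp_neg_int_def)
  also have "\<dots> = (\<Sum>r\<le>B. exp_neg_int M (p - k * int M + int r) (exp_pos M 1 r ?v))"
    by (rule sum.mono_neutral_left) (auto simp: exp_neg_int_def)
  finally show ?thesis
    by (simp add: vertex_coeff_def)
qed

lemma heis_shift:
  assumes "n > 0"
  shows "heis M (int n) (shift j v) = shift j (heis M (int n) v)"
proof (rule lin_eqI[where f = "\<lambda>v. heis M (int n) (shift j v)"])
  show "lin (\<lambda>v. heis M (int n) (shift j v))" "lin (\<lambda>v. shift j (heis M (int n) v))"
    by (rule lin_compose[OF lin_heis lin_shift], rule lin_compose[OF lin_shift lin_heis])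
  show "heis M (int n) (shift j (single x 1)) = shift j (heis M (int n) (single x 1))" for x
    using assms by (cases x) (auto simp: heis_def shift_def)
qed

text \<open>\<open>shift\<close> and \<open>exp_pos\<close> commute with a_n, so the extra term
  comes from \<open>exp_neg\<close> alone. Multiplying the series by z^n moves its coefficient index
  from p to p - n.\<close>

lemma heis_vertex:
  assumes "n > 0"
  shows "heis M (int n) (vertex_coeff M 1 p v) =
    vertex_coeff M 1 p (heis M (int n) v) + scl (sqrtM M) (vertex_coeff M 1 (p - int n) v)"
proof (rule lin_eqI[where f = "\<lambda>v. heis M (int n) (vertex_coeff M 1 p v)"])
  show "lin (\<lambda>v. heis M (int n) (vertex_coeff M 1 p v))"
    by (rule lin_compose[OF lin_heis lin_vertex])
  show "lin (\<lambda>v. vertex_coeff M 1 p (heis M (int n) v) + scl (sqrtM M) (vertex_coeff M 1 (p - int n) v))"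
    by (intro lin_plus lin_scale lin_vertex, rule lin_compose[OF lin_vertex lin_heis])
  fix x :: "int \<times> nat multiset"
  obtain k \<kappa> where x: "x = (k, \<kappa>)" by fastforce
  let ?v = "single (k, \<kappa>) 1 :: fock"
  define B where "B = (\<Sum>i\<in>#\<kappa>. Suc i)"
  define c :: complex where "c = of_int (int n) * of_nat (count \<kappa> (n - 1))"
  have h: "heis M (int n) ?v = scl c (single (k, \<kappa> - {#n - 1#}) 1)"
    using assms by (simp add: heis_def c_def)
  \<comment> \<open>Removing a part does not raise the degree, so the bound for \<kappa> also serves
    for a_n applied to the vector.\<close>
  have B': "(\<Sum>i\<in>#(\<kappa> - {#n - 1#}). Suc i) \<le> B"
    unfolding B_def by (cases "n - 1 \<in># \<kappa>") (auto dest!: multi_member_split)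
  have "heis M (int n) (vertex_coeff M 1 p ?v) = shift 1 (\<Sum>r\<le>B. heis M (int n)
      (exp_neg_int M (p - k * int M + int r) (exp_pos M 1 r ?v)))"
    by (subst vertex_single[of \<kappa> B]) (simp_all add: B_def heis_shift[OF assms] lin_sum[OF lin_heis])
  also have "\<dots> = shift 1 (\<Sum>r\<le>B. exp_neg_int M (p - k * int M + int r) (exp_pos M 1 r (heis M (int n) ?v)))
     + scl (sqrtM M) (shift 1 (\<Sum>r\<le>B. exp_neg_int M ((p - int n) - k * int M + int r) (exp_pos M 1 r ?v)))"
    by (simp add: heis_exp_neg_int[OF assms] heis_exp_pos[OF assms] sum.distrib lin_add[OF lin_shift]
        lin_scl[OF lin_shift] algebra_simps flip: fvs.scale_sum_right)
  also have "shift 1 (\<Sum>r\<le>B. exp_neg_int M ((p - int n) - k * int M + int r) (exp_pos M 1 r ?v)) =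
      vertex_coeff M 1 (p - int n) ?v"
    by (subst vertex_single[of \<kappa> B]) (simp_all add: B_def)
  also have "shift 1 (\<Sum>r\<le>B. exp_neg_int M (p - k * int M + int r) (exp_pos M 1 r (heis M (int n) ?v)))
      = vertex_coeff M 1 p (heis M (int n) ?v)"
    unfolding h lin_scl[OF lin_vertex] vertex_single[OF B']
    by (simp only: lin_scl[OF lin_exp_pos] lin_scl[OF lin_exp_neg_int] lin_scl[OF lin_shift] flip: fvs.scale_sum_right)
  finally show "heis M (int n) (vertex_coeff M 1 p (single x 1)) =
      vertex_coeff M 1 p (heis M (int n) (single x 1)) + scl (sqrtM M) (vertex_coeff M 1 (p - int n) (single x 1))"
    by (simp add: x)
qed

section \<open>Moving the annihilation exponential through a vertex operator\<close>

definition sbinom :: "nat \<Rightarrow> nat \<Rightarrow> complex" where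
  "sbinom M j = (-1) ^ j * of_nat (M choose j)"

text \<open>Compare coefficients of x^k in x d/dx (1-x)^M = -M (x/(1-x)) (1-x)^M, where
  \<open>sbinom M j\<close> is the coefficient of x^j in (1-x)^M.\<close>

lemma sbinom_sum: "- (of_nat M * (\<Sum>j<k. sbinom M j)) = of_nat k * sbinom M k"
proof (induction k)
  case (Suc k)
  have "Suc k * (M choose Suc k) + k * (M choose k) = M * (M choose k)"
  proof (cases "k \<le> M")
    case True
    then show ?thesis
      by (metis binomial_absorb_comp binomial_absorption distrib_right le_add_diff_inverse2)
  qed (simp add: binomial_eq_0)
  then have "of_nat (Suc k) * of_nat (M choose Suc k) + of_nat k * of_nat (M choose k) = (of_nat M * of_nat (M choose k) :: complex)"
    by (metis of_nat_add of_nat_mult)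
  then have *: "of_nat (Suc k) * of_nat (M choose Suc k) = (of_nat M * of_nat (M choose k) - of_nat k * of_nat (M choose k) :: complex)"
    by (simp add: algebra_simps)
  have "- (of_nat M * (\<Sum>j<Suc k. sbinom M j)) = of_nat k * sbinom M k - of_nat M * sbinom M k"
    unfolding Suc.IH[symmetric] by (simp add: algebra_simps)
  also have "\<dots> = (-1) ^ Suc k * (of_nat (Suc k) * of_nat (M choose Suc k))"
    unfolding * by (simp add: sbinom_def algebra_simps)
  finally show ?case
    by (simp add: sbinom_def mult_ac)
qed simp

lemma triangle_sum_swap:
  fixes g :: "nat \<Rightarrow> nat \<Rightarrow> 'a::comm_monoid_add"
  shows "(\<Sum>n=1..r. \<Sum>j\<le>r-n. g j n) = (\<Sum>j\<le>r. \<Sum>n=1..r-j. g j n)"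
proof -
  have "(\<Sum>n=1..r. \<Sum>j\<le>r-n. g j n) = (\<Sum>n=1..r. \<Sum>j\<in>{j\<in>{..r}. j + n \<le> r}. g j n)"
    by (intro sum.cong) auto
  also have "\<dots> = (\<Sum>j\<le>r. \<Sum>n\<in>{n\<in>{1..r}. j + n \<le> r}. g j n)"
    by (rule sum.swap_restrict) auto
  also have "\<dots> = (\<Sum>j\<le>r. \<Sum>n=1..r-j. g j n)"
    by (intro sum.cong) auto
  finally show ?thesis .
qed

lemma triangle_sum_diagonal:
  fixes g :: "nat \<Rightarrow> nat \<Rightarrow> 'a::comm_monoid_add"
  shows "(\<Sum>n=1..r. \<Sum>j\<le>r-n. g j (j + n)) = (\<Sum>k\<le>r. \<Sum>j<k. g j k)"
proof -
  have "(\<Sum>n=1..r. \<Sum>j\<le>r-n. g j (j + n)) = (\<Sum>j\<le>r. \<Sum>n=1..r-j. g j (j + n))"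
    by (rule triangle_sum_swap)
  also have "\<dots> = (\<Sum>j\<le>r. \<Sum>k\<in>{k\<in>{..r}. j < k}. g j k)"
  proof (rule sum.cong[OF refl])
    fix j assume "j \<in> {..r}"
    then show "(\<Sum>n=1..r-j. g j (j + n)) = (\<Sum>k\<in>{k\<in>{..r}. j < k}. g j k)"
      by (intro sum.reindex_bij_witness[where i = "\<lambda>k. k - j" and j = "\<lambda>n. j + n"]) auto
  qed
  also have "\<dots> = (\<Sum>k\<le>r. \<Sum>j\<in>{j\<in>{..r}. j < k}. g j k)"
    by (rule sum.swap_restrict) auto
  also have "\<dots> = (\<Sum>k\<le>r. \<Sum>j<k. g j k)"
    by (intro sum.cong) auto
  finally show ?thesis .
qed

text \<open>This is \<open>exp_pos(w) Y(z) = (1 - z/w)\<^sup>M Y(z) exp_pos(w)\<close>.\<close>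

lemma exp_pos_vertex:
  "exp_pos M 1 r (vertex_coeff M 1 p v) =
    (\<Sum>j\<le>r. scl (sbinom M j) (vertex_coeff M 1 (p - int j) (exp_pos M 1 (r - j) v)))"
proof (induction r rule: less_induct)
  case (less r)
  let ?Y = "\<lambda>j r. vertex_coeff M 1 (p - int j) (exp_pos M 1 r v)"
  show ?case
  proof (cases "r = 0")
    case True
    then show ?thesis by (simp add: exp_pos_0 sbinom_def)
  next
    case False
    \<comment> \<open>The induction hypothesis moves \<open>exp_pos\<close> of index r - n through
      the vertex operator, then \<open>heis_vertex\<close> moves a_n; the extra term carries minus
      the square of \<open>sqrtM M\<close>, that is -M.\<close>
    have step: "scl (- sqrtM M) (heis M (int n) (exp_pos M 1 (r - n) (vertex_coeff M 1 p v))) =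
        (\<Sum>j\<le>r-n. scl (sbinom M j) (vertex_coeff M 1 (p - int j) (scl (- sqrtM M) (heis M (int n) (exp_pos M 1 (r - j - n) v))))
          + scl (- of_nat M * sbinom M j) (?Y (j + n) (r - (j + n))))" if "n \<in> {1..r}" for n
    proof -
      have "scl (- sqrtM M) (heis M (int n) (exp_pos M 1 (r - n) (vertex_coeff M 1 p v))) =
          (\<Sum>j\<le>r-n. scl (- sqrtM M * sbinom M j) (heis M (int n) (?Y j (r - n - j))))"
        using that by (subst less.IH) (auto simp: lin_sum[OF lin_heis] heis_scl fvs.scale_sum_right)
      also have "\<dots> = (\<Sum>j\<le>r-n. scl (sbinom M j) (vertex_coeff M 1 (p - int j) (scl (- sqrtM M) (heis M (int n) (exp_pos M 1 (r - j - n) v))))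
          + scl (- of_nat M * sbinom M j) (?Y (j + n) (r - (j + n))))"
      proof (rule sum.cong[OF refl])
        fix j assume "j \<in> {..r - n}"
        have "heis M (int n) (?Y j (r - n - j)) = vertex_coeff M 1 (p - int j) (heis M (int n) (exp_pos M 1 (r - j - n) v))
            + scl (sqrtM M) (?Y (j + n) (r - (j + n)))"
          using that by (subst heis_vertex) (simp_all add: add.commute diff_diff_eq)
        moreover have "- sqrtM M * sbinom M j * sqrtM M = - of_nat M * sbinom M j"
          using sqrtM_mult_self[of M] by (metis minus_mult_left mult.assoc mult.commute)
        ultimately show "scl (- sqrtM M * sbinom M j) (heis M (int n) (?Y j (r - n - j))) =
            scl (sbinom M j) (vertex_coeff M 1 (p - int j) (scl (- sqrtM M) (heis M (int n) (exp_pos M 1 (r - j - n) v))))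
            + scl (- of_nat M * sbinom M j) (?Y (j + n) (r - (j + n)))"
          by (simp only: fvs.scale_right_distrib lin_scl[OF lin_vertex] fvs.scale_scale mult.commute[of "sbinom M j"])
      qed
      finally show ?thesis .
    qed
    have "scl (of_nat r) (exp_pos M 1 r (vertex_coeff M 1 p v)) =
        (\<Sum>n=1..r. \<Sum>j\<le>r-n. scl (sbinom M j) (vertex_coeff M 1 (p - int j) (scl (- sqrtM M) (heis M (int n) (exp_pos M 1 (r - j - n) v)))))
        + (\<Sum>n=1..r. \<Sum>j\<le>r-n. scl (- of_nat M * sbinom M j) (?Y (j + n) (r - (j + n))))"
      unfolding sum.distrib[symmetric]
      by (subst exp_pos_recursion) (simp only: of_int_1 mult_1_left step cong: sum.cong)
    also have "\<dots> = (\<Sum>j\<le>r. \<Sum>n=1..r-j. scl (sbinom M j) (vertex_coeff M 1 (p - int j) (scl (- sqrtM M) (heis M (int n) (exp_pos M 1 (r - j - n) v)))))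
        + (\<Sum>k\<le>r. \<Sum>j<k. scl (- of_nat M * sbinom M j) (?Y k (r - k)))"
      by (subst triangle_sum_swap, subst triangle_sum_diagonal) simp
    also have "\<dots> = (\<Sum>j\<le>r. scl (sbinom M j) (vertex_coeff M 1 (p - int j) (scl (of_nat (r - j)) (exp_pos M 1 (r - j) v))))
        + (\<Sum>k\<le>r. scl (- of_nat M * (\<Sum>j<k. sbinom M j)) (?Y k (r - k)))"
      unfolding exp_pos_recursion
      by (simp only: lin_sum[OF lin_vertex] fvs.scale_sum_right fvs.scale_sum_left sum_distrib_left of_int_1 mult_1_left)
    \<comment> \<open>The first sum has weight r - j by the recursion of \<open>exp_pos\<close>, the
      second weight j by \<open>sbinom_sum\<close>; together they give the factor r of the left
      side.\<close>
    also have "\<dots> = (\<Sum>j\<le>r. scl (of_nat (r - j) * sbinom M j) (?Y j (r - j)) + scl (of_nat j * sbinom M j) (?Y j (r - j)))"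
      by (simp only: sbinom_sum[symmetric] sum.distrib lin_scl[OF lin_vertex] fvs.scale_scale mult.commute minus_mult_left)
    also have "\<dots> = (\<Sum>j\<le>r. scl (of_nat r) (scl (sbinom M j) (?Y j (r - j))))"
      by (rule sum.cong[OF refl])
         (simp only: fvs.scale_scale atMost_iff le_add_diff_inverse2 flip: fvs.scale_left_distrib distrib_right of_nat_add)
    also have "\<dots> = scl (of_nat r) (\<Sum>j\<le>r. scl (sbinom M j) (?Y j (r - j)))"
      by (simp only: fvs.scale_sum_right)
    finally show ?thesis
      by (rule fvs.scale_left_imp_eq[rotated]) (use False in simp)
  qed
qed

section \<open>Matrix coefficients of products of modes\<close>

lemma lookup_shift: "lookup (shift 1 v) (k + 1, \<kappa>) = lookup v (k, \<kappa>)"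
proof (induction v rule: fvs_induct)
  case (single x c)
  show ?case
    by (cases x) (auto simp: shift_def lookup_single when_def split: if_splits)
qed (simp_all add: lookup_add lin_zero[OF lin_shift] lin_add[OF lin_shift])

text \<open>a_{l+1} sends the basis vector of \<open>add_mset l \<kappa>\<close> to a positive
  multiple of that of \<kappa>, and sends no other basis vector there. Read backwards, this reaches
  every basis coefficient from the one at the empty multiset.\<close>

lemma lookup_heis_pos:
  "lookup (heis M (int (Suc l)) v) (k, \<kappa>) =
    of_nat (Suc l * Suc (count \<kappa> l)) * lookup v (k, add_mset l \<kappa>)"
proof (induction v rule: fvs_induct)
  case (single x c)
  obtain k' \<rho> where x: "x = (k', \<rho>)" by fastforce
  have h: "heis M (int (Suc l)) (single x c) =
      single (k', \<rho> - {#l#}) (c * (of_nat (Suc l) * of_nat (count \<rho> l)))"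
    by (simp add: x heis_def nat_add_distrib)
  show ?case
  proof (cases "l \<in># \<rho>")
    case True
    then obtain \<rho>' where "\<rho> = add_mset l \<rho>'"
      by (metis insert_DiffM)
    then show ?thesis
      unfolding h by (auto simp: x lookup_single when_def algebra_simps)
  next
    case False
    then have "\<rho> \<noteq> add_mset l \<kappa>" by auto
    with False show ?thesis
      unfolding h by (simp add: x lookup_single when_def not_in_iff)
  qed
qed (simp_all add: lookup_add heis_add distrib_left)

lemma lookup_heis_neg:
  assumes "n > 0"
  shows "lookup (heis M (- int n) v) (k, {#}) = 0"
proof (induction v rule: fvs_induct)
  case (single x c)
  show ?case
    using assms by (cases x) (auto simp: heis_def lookup_single when_def)
qed (simp_all add: lookup_add heis_add)

text \<open>Each a_{-n} adds a part, so at the empty multiset only the constant term of the creation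
  exponential is visible.\<close>

lemma lookup_exp_neg_int:
  "lookup (exp_neg_int M s v) (k, {#}) = (if s = 0 then lookup v (k, {#}) else 0)"
proof (cases "s > 0")
  case True
  define b where "b = (\<lambda>n v. scl (- (of_int 1 * sqrtM M) / of_int (- int n)) (heis M (- int n) v))"
  have "lookup (foldr b ns v) (k, {#}) = 0" if ns: "0 \<notin> set ns" "sum_list ns = nat s" for ns
  proof (cases ns)
    case (Cons n ns')
    with ns(1) show ?thesis
      by (simp add: b_def lookup_heis_neg)
  qed (use ns True in auto)
  then have "lookup (exp_coeff b (nat s) v) (k, {#}) = 0"
    by (auto simp: exp_coeff_def lookup_sum intro!: sum.neutral)
  then show ?thesis
    using True by (simp add: exp_neg_int_def exp_neg_def b_def)
qed (auto simp: exp_neg_int_def exp_neg_0)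

section \<open>The charge grading of the Fock modules\<close>

definition charged :: "int \<Rightarrow> fock \<Rightarrow> bool" where
  "charged k v \<longleftrightarrow> (\<forall>x\<in>keys v. fst x = k)"

lemma charged_zero: "charged k 0"
  and charged_scl: "charged k v \<Longrightarrow> charged k (scl c v)"
  and charged_uminus: "charged k v \<Longrightarrow> charged k (- v)"
  by (auto simp: charged_def in_keys_iff)

lemma charged_add: "charged k u \<Longrightarrow> charged k v \<Longrightarrow> charged k (u + v)"
  using keys_add[of u v] by (auto simp: charged_def)

lemma charged_sum: "(\<And>x. x \<in> A \<Longrightarrow> charged k (g x)) \<Longrightarrow> charged k (\<Sum>x\<in>A. g x)"
  by (induction A rule: infinite_finite_induct) (auto simp: charged_zero charged_add)

lemma charged_linext:
  "(\<And>x. x \<in> keys v \<Longrightarrow> charged k (f x)) \<Longrightarrow> charged k (linext f v)"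
  by (simp add: linext_def charged_sum charged_scl)

lemma charged_single: "charged k (single (k, \<kappa>) c)"
  by (simp add: charged_def)

lemma charged_heis: "charged k v \<Longrightarrow> charged k (heis M n v)"
  unfolding heis_def by (rule charged_linext) (auto simp: charged_def split: prod.splits if_splits)

lemma charged_exp_coeff:
  assumes "\<And>n v. charged k v \<Longrightarrow> charged k (b n v)" "charged k v"
  shows "charged k (exp_coeff b r v)"
proof -
  have "charged k (foldr b ns v)" for ns
    by (induction ns) (simp_all add: assms)
  then show ?thesis
    unfolding exp_coeff_def by (intro charged_sum charged_scl)
qed

lemma charged_vertex:
  assumes "charged k v"
  shows "charged (k + 1) (vertex_coeff M 1 p v)"
proof -
  have sh: "charged (k + 1) (shift 1 u)" if "charged k u" for u
    using that unfolding shift_def by (intro charged_linext) (auto simp: charged_def)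
  have "charged (k + 1) (vertex_coeff M 1 p (single (k, \<kappa>) 1))" for \<kappa>
    unfolding vertex_single[OF order_refl] exp_neg_int_def exp_neg_def exp_pos_def
    by (auto intro!: sh charged_sum charged_exp_coeff charged_scl charged_uminus charged_heis charged_single charged_zero)
  moreover have "vertex_coeff M 1 p v = linext (\<lambda>x. vertex_coeff M 1 p (single x 1)) v"
    by (rule lin_eqI[OF lin_vertex lin_linext]) simp
  ultimately show ?thesis
    using assms by (auto simp: charged_def[of k] intro!: charged_linext)
qed

text \<open>On charge k the factor z^(\<mu> a_0) is z^(k M), and at the highest weight vector the
  creation exponential acts as 1, so the annihilation exponential has to supply z^(p - k M).\<close>

lemma lookup_vertex_vac:
  assumes "charged k v"
  shows "lookup (vertex_coeff M 1 p v) (k + 1, {#}) =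
    (if p \<le> k * int M then lookup (exp_pos M 1 (nat (k * int M - p)) v) (k, {#}) else 0)"
proof -
  let ?r = "nat (k * int M - p)"
  have *: "lookup (vertex_coeff M 1 p (single (k, \<kappa>) 1)) (k + 1, {#}) =
    (if p \<le> k * int M then lookup (exp_pos M 1 ?r (single (k, \<kappa>) 1)) (k, {#}) else 0)" for \<kappa>
  proof -
    \<comment> \<open>The maximum puts the only surviving index into the range even when it exceeds
      the degree of \<kappa>.\<close>
    have "lookup (vertex_coeff M 1 p (single (k, \<kappa>) 1)) (k + 1, {#}) =
        (\<Sum>r\<le>max ?r (\<Sum>i\<in>#\<kappa>. Suc i). if p - k * int M + int r = 0 then lookup (exp_pos M 1 r (single (k, \<kappa>) 1)) (k, {#}) else 0)"
      by (subst vertex_single[OF max.cobounded2[of _ ?r]]) (simp add: lookup_shift lookup_sum lookup_exp_neg_int)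
    also have "\<dots> = (\<Sum>r\<in>(if p \<le> k * int M then {?r} else {}). lookup (exp_pos M 1 r (single (k, \<kappa>) 1)) (k, {#}))"
      by (rule sum.mono_neutral_cong_right) (auto split: if_splits)
    finally show ?thesis by simp
  qed
  have **: "lookup (vertex_coeff M 1 p (single x 1)) (k + 1, {#}) =
    (if p \<le> k * int M then lookup (exp_pos M 1 ?r (single x 1)) (k, {#}) else 0)" if "x \<in> keys v" for x
    using that assms * by (cases x) (auto simp: charged_def)
  show ?thesis
    by (subst (1 2) lookup_lin) (simp_all add: lin_vertex lin_exp_pos ** cong: sum.cong)
qed

text \<open>The variable \<open>z\<^sub>i\<close> belongs to the \<open>i\<close>-th factor counted from the right, so that a new leftmost
  factor leaves the indices of the others unchanged.\<close>

primrec chain :: "nat \<Rightarrow> nat \<Rightarrow> (nat \<Rightarrow>\<^sub>0 int) \<Rightarrow> fock" where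
  "chain M 0 \<alpha> = vac"
| "chain M (Suc m) \<alpha> = vertex_coeff M 1 (lookup \<alpha> m) (chain M m \<alpha>)"

lemma chain_cong: "(\<And>i. i < m \<Longrightarrow> lookup \<alpha> i = lookup \<beta> i) \<Longrightarrow> chain M m \<alpha> = chain M m \<beta>"
  by (induction m) auto

lemma charged_chain: "charged (int m) (chain M m \<alpha>)"
proof (induction m)
  case (Suc m)
  then show ?case
    using charged_vertex[of "int m"] by (simp add: add.commute)
qed (simp add: vac_def charged_single)

section \<open>Laurent polynomials in the first m variables\<close>

definition vars_below :: "nat \<Rightarrow> laurent \<Rightarrow> bool" where
  "vars_below m F \<longleftrightarrow> (\<forall>\<beta>\<in>keys F. keys \<beta> \<subseteq> {..<m})"

lemma vars_below_mono: "vars_below m F \<Longrightarrow> m \<le> n \<Longrightarrow> vars_below n F"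
  unfolding vars_below_def by fastforce

lemma vars_below_one: "vars_below m 1"
  and vars_below_zero: "vars_below m 0"
  and vars_below_zpow: "i < m \<Longrightarrow> vars_below m (zpow i n)"
  by (auto simp: vars_below_def zpow_def simp flip: single_one)

lemma vars_below_scl: "vars_below m F \<Longrightarrow> vars_below m (scl c F)"
  by (auto simp: vars_below_def in_keys_iff)

lemma vars_below_add: "vars_below m F \<Longrightarrow> vars_below m G \<Longrightarrow> vars_below m (F + G)"
  using keys_add[of F G] by (auto simp: vars_below_def)

lemma vars_below_uminus: "vars_below m F \<Longrightarrow> vars_below m (- F)"
  by (simp add: vars_below_def)

lemma vars_below_minus: "vars_below m F \<Longrightarrow> vars_below m G \<Longrightarrow> vars_below m (F - G)"
  using vars_below_add[of m F "- G"] by (simp add: vars_below_uminus)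

lemma vars_below_mult:
  assumes "vars_below m F" "vars_below m G"
  shows "vars_below m (F * G)"
  unfolding vars_below_def
proof
  fix \<gamma> assume "\<gamma> \<in> keys (F * G)"
  then obtain \<alpha> \<beta> where "\<alpha> \<in> keys F" "\<beta> \<in> keys G" "\<gamma> = \<alpha> + \<beta>"
    using keys_mult[of F G] by blast
  with assms keys_add[of \<alpha> \<beta>] show "keys \<gamma> \<subseteq> {..<m}"
    unfolding vars_below_def by blast
qed

lemma vars_below_sum: "(\<And>x. x \<in> A \<Longrightarrow> vars_below m (g x)) \<Longrightarrow> vars_below m (\<Sum>x\<in>A. g x)"
  by (induction A rule: infinite_finite_induct) (auto simp: vars_below_zero vars_below_add)

lemma vars_below_prod: "(\<And>x. x \<in> A \<Longrightarrow> vars_below m (g x)) \<Longrightarrow> vars_below m (\<Prod>x\<in>A. g x)"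
  by (induction A rule: infinite_finite_induct) (auto simp: vars_below_one vars_below_mult)

lemma vars_below_power: "vars_below m F \<Longrightarrow> vars_below m (F ^ n)"
  by (induction n) (auto simp: vars_below_one vars_below_mult)

lemmas vars_below_intros = vars_below_one vars_below_zero vars_below_zpow vars_below_scl vars_below_add
  vars_below_minus vars_below_mult vars_below_sum vars_below_prod vars_below_power

lemma lookup_eq_0_vars_below: "vars_below m F \<Longrightarrow> m \<le> i \<Longrightarrow> lookup \<alpha> i \<noteq> 0 \<Longrightarrow> lookup F \<alpha> = 0"
  by (fastforce simp: vars_below_def in_keys_iff)

lemma lin_times: "lin (\<lambda>F. G * F)" for G :: laurent
proof -
  have scl: "scl c F = single 0 c * F" for c and F :: laurent
    by (induction F rule: fvs_induct) (auto simp: mult_single fvs.scale_right_distrib distrib_left)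
  show ?thesis
    by (simp add: lin_def distrib_left scl mult.left_commute)
qed

lemma scl_mult_right: "G * scl c F = scl c (G * F)" and scl_mult_left: "scl c F * G = scl c (F * G)" for F G :: laurent
  using lin_scl[OF lin_times, of G c F] by (simp_all add: mult.commute)

lemma lookup_times:
  "lookup (F * G) \<alpha> = (\<Sum>\<beta>\<in>keys F. lookup F \<beta> * lookup G (\<alpha> - \<beta>))" for F G :: laurent
proof -
  have "lookup (G * F) \<alpha> = (\<Sum>\<beta>\<in>keys F. lookup F \<beta> * lookup (G * single \<beta> 1) \<alpha>)"
    by (rule lookup_lin[OF lin_times])
  then show ?thesis
    by (simp add: lookup_times_monomial mult.commute)
qed

lemma zpow_mult: "zpow i a * zpow i b = zpow i (a + b)"
  by (simp add: zpow_def mult_single flip: single_add)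

lemma zpow_0: "zpow i 0 = 1"
  by (simp add: zpow_def)

lemma zpow_power: "zpow i a ^ n = zpow i (int n * a)"
  by (induction n) (simp_all add: zpow_0 zpow_mult algebra_simps)

lemma lookup_zpow_times: "lookup (zpow i n * F) \<alpha> = lookup F (\<alpha> - single i n)"
  using lookup_times_monomial[of F "single i n" \<alpha>] by (simp add: zpow_def mult.commute)

text \<open>\<open>linext (\<lambda>\<beta>. chain M m (\<alpha> - \<beta>)) F\<close> is the
  coefficient at \<alpha> of F times the product of m vertex operators on the vacuum. As F does not
  involve z_m, it passes to the inner m factors, while z_m^j shifts the mode of the new leftmost
  one.\<close>

lemma linext_chain_Suc:
  assumes "vars_below m F"
  shows "linext (\<lambda>\<beta>. chain M (Suc m) (\<alpha> - \<beta>)) (zpow m j * F) =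
    vertex_coeff M 1 (lookup \<alpha> m - j) (linext (\<lambda>\<beta>. chain M m (\<alpha> - \<beta>)) F)"
proof (rule lin_eq_on[where f = "\<lambda>F. linext (\<lambda>\<beta>. chain M (Suc m) (\<alpha> - \<beta>)) (zpow m j * F)"])
  fix \<beta> assume \<beta>: "\<beta> \<in> keys F"
  with assms have "lookup \<beta> m = 0"
    by (metis in_keys_iff lessThan_iff less_irrefl subsetD vars_below_def)
  moreover have "chain M m (\<alpha> - (single m j + \<beta>)) = chain M m (\<alpha> - \<beta>)"
    by (rule chain_cong) (simp add: lookup_minus lookup_add lookup_single)
  ultimately show "linext (\<lambda>\<beta>. chain M (Suc m) (\<alpha> - \<beta>)) (zpow m j * single \<beta> 1) =
      vertex_coeff M 1 (lookup \<alpha> m - j) (linext (\<lambda>\<beta>. chain M m (\<alpha> - \<beta>)) (single \<beta> 1))"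
    by (simp add: zpow_def mult_single lookup_minus lookup_add)
qed (rule lin_compose[OF lin_linext lin_times] lin_compose[OF lin_vertex lin_linext])+

section \<open>Annihilation operators on products of vertex operators\<close>

definition psum :: "nat \<Rightarrow> int \<Rightarrow> laurent" where
  "psum m n = (\<Sum>i<m. zpow i n)"

lemma vars_below_psum: "vars_below m (psum m n)"
  by (auto simp: psum_def intro!: vars_below_intros)

lemma heis_chain:
  assumes "n > 0"
  shows "heis M (int n) (chain M m \<alpha>) =
    linext (\<lambda>\<beta>. chain M m (\<alpha> - \<beta>)) (scl (sqrtM M) (psum m (int n)))"
proof (induction m)
  case 0
  then show ?case using assms by (simp add: psum_def vac_def heis_def)
next
  case (Suc m)
  let ?F = "scl (sqrtM M) (psum m (int n))"
  have one: "linext (\<lambda>\<beta>. chain M m (\<alpha> - \<beta>)) 1 = chain M m \<alpha>"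
    by (simp flip: single_one)
  \<comment> \<open>The new power sum is the old one times z_m^0 plus z_m^n times 1, two products of
    the shape handled by \<open>linext_chain_Suc\<close>.\<close>
  have "linext (\<lambda>\<beta>. chain M (Suc m) (\<alpha> - \<beta>)) (scl (sqrtM M) (psum (Suc m) (int n))) =
      linext (\<lambda>\<beta>. chain M (Suc m) (\<alpha> - \<beta>)) (zpow m 0 * ?F) +
      scl (sqrtM M) (linext (\<lambda>\<beta>. chain M (Suc m) (\<alpha> - \<beta>)) (zpow m (int n) * 1))"
    by (simp add: psum_def zpow_0 fvs.scale_right_distrib linext_add linext_scl)
  also have "\<dots> = vertex_coeff M 1 (lookup \<alpha> m) (heis M (int n) (chain M m \<alpha>)) +
      scl (sqrtM M) (vertex_coeff M 1 (lookup \<alpha> m - int n) (chain M m \<alpha>))"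
    by (subst (1 2) linext_chain_Suc) (simp_all add: Suc.IH vars_below_intros vars_below_psum one)
  finally show ?case
    by (simp add: heis_vertex[OF assms])
qed

text \<open>The coefficient of \<open>w\<^bsup>-r\<^esup>\<close> in \<open>\<Prod>i<m. (1 - z\<^sub>i/w)\<^sup>M\<close>.\<close>

primrec eigen_poly :: "nat \<Rightarrow> nat \<Rightarrow> nat \<Rightarrow> laurent" where
  "eigen_poly M 0 r = (if r = 0 then 1 else 0)"
| "eigen_poly M (Suc m) r = (\<Sum>j\<le>r. scl (sbinom M j) (zpow m (int j) * eigen_poly M m (r - j)))"

lemma vars_below_eigen_poly: "vars_below m (eigen_poly M m r)"
proof (induction m arbitrary: r)
  case (Suc m)
  then have "vars_below (Suc m) (eigen_poly M m r)" for r
    by (rule vars_below_mono) simp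
  then show ?case
    by (auto intro!: vars_below_intros)
qed (simp add: vars_below_intros)

text \<open>The annihilation exponential passes one factor after the other and finally acts as 1 on
  the vacuum, so only the factors (1 - z_i/w)^M remain.\<close>

lemma exp_pos_chain:
  "exp_pos M 1 r (chain M m \<alpha>) = linext (\<lambda>\<beta>. chain M m (\<alpha> - \<beta>)) (eigen_poly M m r)"
proof (induction m arbitrary: r)
  case 0
  have "exp_pos M 1 r vac = (if r = 0 then vac else 0)"
    using exp_pos_eq_0[of "{#}" r M 1 0] by (simp add: exp_pos_0 vac_def)
  then show ?case by (simp flip: single_one)
next
  case (Suc m)
  have "exp_pos M 1 r (chain M (Suc m) \<alpha>) =
      (\<Sum>j\<le>r. scl (sbinom M j) (linext (\<lambda>\<beta>. chain M (Suc m) (\<alpha> - \<beta>)) (zpow m (int j) * eigen_poly M m (r - j))))"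
    unfolding linext_chain_Suc[OF vars_below_eigen_poly] Suc.IH[symmetric] by (simp add: exp_pos_vertex)
  also have "\<dots> = linext (\<lambda>\<beta>. chain M (Suc m) (\<alpha> - \<beta>)) (eigen_poly M (Suc m) r)"
    by (simp add: lin_sum[OF lin_linext] linext_scl del: chain.simps)
  finally show ?case .
qed

lemma eigen_poly_eq_0: "r > m * M \<Longrightarrow> eigen_poly M m r = 0"
proof (induction m arbitrary: r)
  case (Suc m)
  have *: "scl (sbinom M j) (zpow m (int j) * eigen_poly M m (r - j)) = 0" if "j \<in> {..r}" for j
  proof (cases "j \<le> M")
    case True
    with Suc show ?thesis by simp
  qed (simp add: sbinom_def)
  show ?case
    by (simp only: eigen_poly.simps * sum.neutral_const cong: sum.cong)
qed simp

lemma one_minus_power: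
  "(1 - zpow i 1 * x) ^ M = (\<Sum>j\<le>M. scl (sbinom M j) (zpow i (int j)) * x ^ j)"
proof -
  have of_nat: "of_nat n * F = scl (of_nat n) F" for n and F :: laurent
    by (induction n) (simp_all add: distrib_right fvs.scale_left_distrib)
  have sgn: "(-1) ^ n * F = scl ((-1) ^ n) F" for n and F :: laurent
    by (induction n) simp_all
  have "(1 - zpow i 1 * x) ^ M = (- (zpow i 1 * x) + 1) ^ M"
    by simp
  also have "\<dots> = (\<Sum>j\<le>M. of_nat (M choose j) * ((- 1) ^ j * (zpow i (int j) * x ^ j)))"
    unfolding binomial_ring
    by (rule sum.cong) (simp_all add: power_minus[of "_ * _"] power_mult_distrib zpow_power mult_ac)
  also have "\<dots> = (\<Sum>j\<le>M. scl (sbinom M j) (zpow i (int j)) * x ^ j)"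
    by (simp only: of_nat sgn sbinom_def scl_mult_left fvs.scale_scale mult.commute[of "(-1) ^ _"])
  finally show ?thesis .
qed

text \<open>Here x stands for 1/w. It is arbitrary so that it can be specialised to
  z_m^(-1).\<close>

lemma prod_eigen_poly:
  "(\<Prod>i<m. (1 - zpow i 1 * x) ^ M) = (\<Sum>r\<le>m * M. eigen_poly M m r * x ^ r)"
proof (induction m)
  case (Suc m)
  have "(\<Prod>i<Suc m. (1 - zpow i 1 * x) ^ M) =
      (\<Sum>j\<le>M. scl (sbinom M j) (zpow m (int j)) * x ^ j) * (\<Sum>r\<le>m * M. eigen_poly M m r * x ^ r)"
    unfolding prod.lessThan_Suc Suc.IH one_minus_power[of m] by (rule mult.commute)
  also have "\<dots> = (\<Sum>r\<le>M + m * M. (\<Sum>j\<le>r. scl (sbinom M j) (zpow m (int j)) * eigen_poly M m (r - j)) * x ^ r)"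
    by (rule polynomial_product) (auto simp: sbinom_def eigen_poly_eq_0)
  finally show ?case by (simp add: scl_mult_left)
qed simp

text \<open>The factors are grouped by their larger index j, so that a new leftmost vertex operator
  contributes exactly the factors with z_m, with the sign in which z_m^M (1 - z_i/z_m)^M produces
  them.\<close>

definition vpoly :: "nat \<Rightarrow> nat \<Rightarrow> laurent" where
  "vpoly M m = (\<Prod>j<m. \<Prod>i<j. (zpow j 1 - zpow i 1) ^ M)"

lemma vars_below_vpoly: "vars_below m (vpoly M m)"
  by (auto simp: vpoly_def intro!: vars_below_intros)

text \<open>z_m - z_i = z_m (1 - z_i/z_m), so the new factors are z_m^(m M) times the generating
  function of \<open>eigen_poly\<close> at w = z_m.\<close>

lemma vpoly_Suc:
  "vpoly M (Suc m) = (\<Sum>r\<le>m * M. zpow m (int (m * M) - int r) * (eigen_poly M m r * vpoly M m))"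
proof -
  have "zpow m 1 - zpow i 1 = zpow m 1 * (1 - zpow i 1 * zpow m (-1))" for i
    by (simp add: algebra_simps zpow_mult zpow_0)
  then have "(\<Prod>i<m. (zpow m 1 - zpow i 1) ^ M) =
      zpow m (int (m * M)) * (\<Prod>i<m. (1 - zpow i 1 * zpow m (-1)) ^ M)"
    by (simp add: power_mult_distrib prod.distrib zpow_power)
  also have "\<dots> = (\<Sum>r\<le>m * M. zpow m (int (m * M) - int r) * eigen_poly M m r)"
    by (simp add: prod_eigen_poly sum_distrib_left zpow_power zpow_mult mult.left_commute)
      (simp add: mult.commute)
  finally show ?thesis
    by (simp add: vpoly_def sum_distrib_left mult_ac)
qed

text \<open>G is the generating Laurent polynomial of the matrix coefficient at (m, \<kappa>).
  Exponents outside the first m variables are excluded because \<open>chain M m\<close> ignores them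
  while \<open>lookup G\<close> does not.\<close>

definition represents :: "nat \<Rightarrow> nat \<Rightarrow> nat multiset \<Rightarrow> laurent \<Rightarrow> bool" where
  "represents M m \<kappa> G \<longleftrightarrow>
    (\<forall>\<alpha>. keys \<alpha> \<subseteq> {..<m} \<longrightarrow> lookup (chain M m \<alpha>) (int m, \<kappa>) = lookup G \<alpha>)"

lemma lookup_linext_chain:
  assumes "represents M m \<kappa> G" "vars_below m F" "keys \<alpha> \<subseteq> {..<m}"
  shows "lookup (linext (\<lambda>\<beta>. chain M m (\<alpha> - \<beta>)) F) (int m, \<kappa>) = lookup (F * G) \<alpha>"
proof -
  have "keys (\<alpha> - \<beta>) \<subseteq> {..<m}" if "\<beta> \<in> keys F" for \<beta>
    using that assms(2,3) keys_diff[of \<alpha> \<beta>] by (auto simp: vars_below_def)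
  then show ?thesis
    using assms(1) by (simp add: represents_def linext_def lookup_sum lookup_times)
qed

text \<open>\<open>lookup_vertex_vac\<close> matches \<open>vpoly_Suc\<close>: the coefficient of
  z_m^p selects r = m M - p on both sides, and what is left is the induction hypothesis multiplied
  by \<open>eigen_poly\<close>.\<close>

lemma represents_vac: "represents M m {#} (vpoly M m)"
proof (induction m)
  case 0
  show ?case
    by (auto simp: represents_def vpoly_def vac_def lookup_one)
next
  case (Suc m)
  show ?case
    unfolding represents_def
  proof (intro allI impI)
    fix \<alpha> :: "nat \<Rightarrow>\<^sub>0 int" assume \<alpha>: "keys \<alpha> \<subseteq> {..<Suc m}"
    define p where "p = lookup \<alpha> m"
    define \<alpha>' where "\<alpha>' = \<alpha> - single m p"
    let ?G = "\<lambda>r. eigen_poly M m r * vpoly M m"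
    have "i \<noteq> m" "i \<in> keys \<alpha>" if "i \<in> keys \<alpha>'" for i
      using that by (auto simp: \<alpha>'_def p_def in_keys_iff lookup_minus lookup_single when_def split: if_splits)
    with \<alpha> have \<alpha>': "keys \<alpha>' \<subseteq> {..<m}"
      by fastforce
    have ch: "chain M m \<alpha> = chain M m \<alpha>'"
      by (rule chain_cong) (simp add: \<alpha>'_def lookup_minus lookup_single)
    \<comment> \<open>The factor \<open>?G r\<close> is free of z_m, so the exponent of z_m alone
      decides which r contributes.\<close>
    have *: "lookup (zpow m (int (m * M) - int r) * ?G r) \<alpha> =
        (if p = int (m * M) - int r then lookup (?G r) \<alpha>' else 0)" for r
    proof (cases "p = int (m * M) - int r")
      case False
      then have "lookup (\<alpha> - single m (int (m * M) - int r)) m \<noteq> 0"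
        by (simp add: lookup_minus p_def)
      moreover have "vars_below m (?G r)"
        by (intro vars_below_mult vars_below_eigen_poly vars_below_vpoly)
      ultimately show ?thesis
        using False lookup_eq_0_vars_below[of m "?G r" m] by (simp add: lookup_zpow_times)
    qed (simp add: lookup_zpow_times \<alpha>'_def)
    have "lookup (vpoly M (Suc m)) \<alpha> = (\<Sum>r\<le>m * M. if p = int (m * M) - int r then lookup (?G r) \<alpha>' else 0)"
      by (simp only: vpoly_Suc lookup_sum *)
    also have "\<dots> = (if p \<le> int (m * M) then lookup (?G (nat (int (m * M) - p))) \<alpha>' else 0)"
    proof (cases "p \<le> int (m * M)")
      case True
      let ?r = "nat (int (m * M) - p)"
      have eq: "p = int (m * M) - int r \<longleftrightarrow> r = ?r" for r
        using True by auto
      show ?thesis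
        unfolding eq using True by (simp add: eigen_poly_eq_0)
    qed (auto intro!: sum.neutral)
    also have "\<dots> = lookup (chain M (Suc m) \<alpha>) (int (Suc m), {#})"
      using lookup_vertex_vac[OF charged_chain[of m M \<alpha>], of M p]
      by (simp add: ch exp_pos_chain lookup_linext_chain[OF Suc vars_below_eigen_poly \<alpha>'] add.commute flip: p_def)
    finally show "lookup (chain M (Suc m) \<alpha>) (int (Suc m), {#}) = lookup (vpoly M (Suc m)) \<alpha>" ..
  qed
qed

definition psum_prod :: "nat \<Rightarrow> nat multiset \<Rightarrow> laurent" where
  "psum_prod m \<kappa> = (\<Prod>l\<in>#\<kappa>. psum m (int (Suc l)))"

lemma represents_psum_prod:
  assumes "M > 0"
  shows "\<exists>c. c \<noteq> 0 \<and> represents M m \<kappa> (scl c (psum_prod m \<kappa> * vpoly M m))"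
proof (induction \<kappa>)
  case empty
  show ?case
    using represents_vac by (intro exI[of _ 1]) (simp add: psum_prod_def)
next
  case (add l \<kappa>)
  then obtain c where c: "c \<noteq> 0" "represents M m \<kappa> (scl c (psum_prod m \<kappa> * vpoly M m))"
    by blast
  \<comment> \<open>The numerator is c times the factor of the power sum in
    \<open>heis_chain\<close>, the denominator the factor in \<open>lookup_heis_pos\<close>; M > 0
    makes d nonzero.\<close>
  define d where "d = sqrtM M * c / of_nat (Suc l * Suc (count \<kappa> l))"
  have "represents M m (add_mset l \<kappa>) (scl d (psum_prod m (add_mset l \<kappa>) * vpoly M m))"
    unfolding represents_def
  proof (intro allI impI)
    fix \<alpha> :: "nat \<Rightarrow>\<^sub>0 int" assume \<alpha>: "keys \<alpha> \<subseteq> {..<m}"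
    have "of_nat (Suc l * Suc (count \<kappa> l)) * lookup (chain M m \<alpha>) (int m, add_mset l \<kappa>) =
        lookup (heis M (int (Suc l)) (chain M m \<alpha>)) (int m, \<kappa>)"
      by (rule lookup_heis_pos[symmetric])
    also have "\<dots> = lookup (scl (sqrtM M) (psum m (int (Suc l))) * scl c (psum_prod m \<kappa> * vpoly M m)) \<alpha>"
      by (subst heis_chain, simp, subst lookup_linext_chain[OF c(2) _ \<alpha>])
        (auto intro: vars_below_scl vars_below_psum)
    also have "\<dots> = sqrtM M * c * lookup (psum_prod m (add_mset l \<kappa>) * vpoly M m) \<alpha>"
      by (simp only: scl_mult_left scl_mult_right lookup_scl) (simp add: psum_prod_def mult_ac)
    finally show "lookup (chain M m \<alpha>) (int m, add_mset l \<kappa>) = lookup (scl d (psum_prod m (add_mset l \<kappa>) * vpoly M m)) \<alpha>"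
      by (simp add: d_def field_simps del: of_nat_Suc of_nat_mult)
  qed
  moreover have "d \<noteq> 0"
    using c(1) assms by (simp add: d_def sqrtM_def del: of_nat_Suc of_nat_mult)
  ultimately show ?case by blast
qed

section \<open>Symmetric and antisymmetric polynomials\<close>

lemma is_poly_iff: "is_poly m F \<longleftrightarrow> vars_below m F \<and> (\<forall>\<alpha>\<in>keys F. \<forall>i. 0 \<le> lookup \<alpha> i)"
  by (auto simp: is_poly_def vars_below_def)

lemma is_poly_one: "is_poly m 1"
  and is_poly_zero: "is_poly m 0"
  by (auto simp: is_poly_def simp flip: single_one)

lemma is_poly_zpow: "i < m \<Longrightarrow> 0 \<le> n \<Longrightarrow> is_poly m (zpow i n)"
  by (auto simp: is_poly_def zpow_def lookup_single when_def)

lemma is_poly_scl: "is_poly m F \<Longrightarrow> is_poly m (scl c F)"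
  by (auto simp: is_poly_def in_keys_iff)

lemma is_poly_add: "is_poly m F \<Longrightarrow> is_poly m G \<Longrightarrow> is_poly m (F + G)"
  using keys_add[of F G] unfolding is_poly_def by blast

lemma is_poly_minus: "is_poly m F \<Longrightarrow> is_poly m G \<Longrightarrow> is_poly m (F - G)"
  using keys_diff[of F G] unfolding is_poly_def by blast

lemma is_poly_mult:
  assumes "is_poly m F" "is_poly m G"
  shows "is_poly m (F * G)"
proof -
  have "0 \<le> lookup \<gamma> i" if \<gamma>: "\<gamma> \<in> keys (F * G)" for \<gamma> i
  proof -
    obtain \<alpha> \<beta> where "\<alpha> \<in> keys F" "\<beta> \<in> keys G" "\<gamma> = \<alpha> + \<beta>"
      using \<gamma> keys_mult[of F G] by blast
    with assms show ?thesis
      by (auto simp: is_poly_def lookup_add)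
  qed
  with assms vars_below_mult show ?thesis
    by (auto simp: is_poly_iff)
qed

lemma is_poly_sum: "(\<And>x. x \<in> A \<Longrightarrow> is_poly m (g x)) \<Longrightarrow> is_poly m (\<Sum>x\<in>A. g x)"
  by (induction A rule: infinite_finite_induct) (auto simp: is_poly_zero is_poly_add)

lemma is_poly_prod: "(\<And>x. x \<in> A \<Longrightarrow> is_poly m (g x)) \<Longrightarrow> is_poly m (\<Prod>x\<in>A. g x)"
  by (induction A rule: infinite_finite_induct) (auto simp: is_poly_one is_poly_mult)

section \<open>Permutations of the variables\<close>

lemma lookup_map_key: "\<pi> permutes S \<Longrightarrow> lookup (Poly_Mapping.map_key \<pi> \<alpha>) i = lookup \<alpha> (\<pi> i)"
  by (simp add: map_key.rep_eq permutes_inj)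

lemma map_key_permutes_compose:
  assumes "\<pi> permutes S" "\<sigma> permutes S"
  shows "Poly_Mapping.map_key \<sigma> (Poly_Mapping.map_key \<pi> \<alpha>) = Poly_Mapping.map_key (\<pi> \<circ> \<sigma>) \<alpha>"
  by (rule poly_mapping_eqI)
    (simp add: lookup_map_key[OF assms(1)] lookup_map_key[OF assms(2)] lookup_map_key[OF permutes_compose[OF assms(2,1)]])

lemma map_key_inv:
  assumes "\<pi> permutes S"
  shows "Poly_Mapping.map_key \<pi> (Poly_Mapping.map_key (inv \<pi>) \<alpha>) = \<alpha>"
    and "Poly_Mapping.map_key (inv \<pi>) (Poly_Mapping.map_key \<pi> \<alpha>) = \<alpha>"
  by (rule poly_mapping_eqI, simp add: lookup_map_key[OF assms] lookup_map_key[OF permutes_inv[OF assms]]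
      permutes_inverses[OF assms])+

lemma map_key_eq_iff:
  "\<pi> permutes S \<Longrightarrow> Poly_Mapping.map_key \<pi> \<alpha> = Poly_Mapping.map_key \<pi> \<beta> \<longleftrightarrow> \<alpha> = \<beta>"
  by (metis map_key_inv(2))

lemma keys_map_key_subset:
  assumes "\<pi> permutes {..<m::nat}" "keys \<alpha> \<subseteq> {..<m}"
  shows "keys (Poly_Mapping.map_key \<pi> \<alpha>) \<subseteq> {..<m}"
  using assms by (auto simp: keys_map_key[OF permutes_inj[OF assms(1)]] permutes_in_image)
    (metis lessThan_iff permutes_in_image subsetD)

text \<open>For a permutation \<pi> this is the ring automorphism that replaces z_{\<pi> i} by z_i.
  It turns the coefficientwise symmetry conditions into identities compatible with products. It is a
  right action, so compositions appear in reversed order.\<close>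

definition perm_act :: "(nat \<Rightarrow> nat) \<Rightarrow> laurent \<Rightarrow> laurent" where
  "perm_act \<pi> = linext (\<lambda>\<alpha>. single (Poly_Mapping.map_key \<pi> \<alpha>) 1)"

lemma lin_perm_act: "lin (perm_act \<pi>)"
  by (simp add: perm_act_def lin_linext)

lemma lookup_perm_act:
  assumes "\<pi> permutes S"
  shows "lookup (perm_act \<pi> F) (Poly_Mapping.map_key \<pi> \<alpha>) = lookup F \<alpha>"
  by (induction F rule: fvs_induct)
    (simp_all add: perm_act_def linext_add lookup_add lookup_single when_def map_key_eq_iff[OF assms])

lemma perm_act_mult:
  assumes "\<pi> permutes S"
  shows "perm_act \<pi> (F * G) = perm_act \<pi> F * perm_act \<pi> G"
proof (rule lin_eqI[where f = "\<lambda>G. perm_act \<pi> (F * G)"])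
  fix \<beta>
  have "perm_act \<pi> (single \<beta> 1 * F) = perm_act \<pi> (single \<beta> 1) * perm_act \<pi> F"
  proof (rule lin_eqI[where f = "\<lambda>F. perm_act \<pi> (single \<beta> 1 * F)"])
    show "perm_act \<pi> (single \<beta> 1 * single \<alpha> 1) = perm_act \<pi> (single \<beta> 1) * perm_act \<pi> (single \<alpha> 1)" for \<alpha>
      by (simp add: perm_act_def mult_single map_key_plus permutes_inj[OF assms])
  qed (rule lin_compose[OF lin_perm_act lin_times] lin_compose[OF lin_times lin_perm_act])+
  then show "perm_act \<pi> (F * single \<beta> 1) = perm_act \<pi> F * perm_act \<pi> (single \<beta> 1)"
    by (simp only: mult.commute)
qed (rule lin_compose[OF lin_perm_act lin_times] lin_compose[OF lin_times lin_perm_act])+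

lemma perm_act_one: "\<pi> permutes S \<Longrightarrow> perm_act \<pi> 1 = 1"
  by (simp add: perm_act_def permutes_inj flip: single_one)

lemma perm_act_id: "perm_act id F = F"
  by (induction F rule: fvs_induct)
    (simp_all add: perm_act_def linext_add id_def map_key_id)

lemma perm_act_prod:
  "\<pi> permutes S \<Longrightarrow> perm_act \<pi> (\<Prod>x\<in>A. g x) = (\<Prod>x\<in>A. perm_act \<pi> (g x))"
  by (induction A rule: infinite_finite_induct) (auto simp: perm_act_one perm_act_mult)

lemma perm_act_zpow:
  assumes "\<pi> permutes S"
  shows "perm_act \<pi> (zpow (\<pi> i) n) = zpow i n"
  by (simp add: perm_act_def zpow_def map_key_single permutes_inj[OF assms])

lemma perm_act_zpow':
  assumes "\<pi> permutes S"
  shows "perm_act \<pi> (zpow i n) = zpow (inv \<pi> i) n"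
  using perm_act_zpow[OF assms, of "inv \<pi> i" n] by (simp add: permutes_inverses[OF assms])

lemma perm_act_compose:
  assumes "\<pi> permutes S" "\<sigma> permutes S"
  shows "perm_act \<sigma> (perm_act \<pi> F) = perm_act (\<pi> \<circ> \<sigma>) F"
  by (induction F rule: fvs_induct)
    (simp_all add: perm_act_def linext_add map_key_permutes_compose[OF assms] o_def)

text \<open>Even \<open>M\<close> gives the symmetric polynomials, odd \<open>M\<close> the antisymmetric ones.\<close>

definition sign_poly :: "nat \<Rightarrow> nat \<Rightarrow> laurent \<Rightarrow> bool" where
  "sign_poly M m f \<longleftrightarrow> is_poly m f \<and>
    (\<forall>\<pi> \<alpha>. \<pi> permutes {..<m} \<longrightarrow>
      lookup f (Poly_Mapping.map_key \<pi> \<alpha>) = of_int (sign \<pi>) ^ M * lookup f \<alpha>)"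

lemma sign_mult_self: "of_int (sign \<pi>) ^ M * of_int (sign \<pi>) ^ M = (1::complex)"
  by (simp add: sign_def flip: power_mult_distrib)

lemma sign_poly_even: "sign_poly (2 * N) m f \<longleftrightarrow> sym_poly m f"
  by (simp add: sign_poly_def sym_poly_def sign_def power_mult)

lemma sign_poly_odd: "sign_poly (2 * N + 1) m f \<longleftrightarrow> antisym_poly m f"
  by (simp add: sign_poly_def antisym_poly_def sign_def power_mult)

lemma sign_poly_0: "sign_poly 0 m f \<longleftrightarrow> sym_poly m f"
  using sign_poly_even[of 0] by simp

text \<open>The coefficient of \<open>perm_act \<pi> f\<close> at \<alpha> composed with \<pi> is
  that of f at \<alpha>, so the two conditions carry inverse scalars; these agree because sign^M
  squares to 1.\<close>

lemma sign_poly_perm_act: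
  "sign_poly M m f \<longleftrightarrow> is_poly m f \<and>
    (\<forall>\<pi>. \<pi> permutes {..<m} \<longrightarrow> perm_act \<pi> f = scl (of_int (sign \<pi>) ^ M) f)"
proof -
  have "(\<forall>\<alpha>. lookup f (Poly_Mapping.map_key \<pi> \<alpha>) = of_int (sign \<pi>) ^ M * lookup f \<alpha>) \<longleftrightarrow>
      perm_act \<pi> f = scl (of_int (sign \<pi>) ^ M) f" if \<pi>: "\<pi> permutes {..<m}" for \<pi>
  proof
    assume *: "\<forall>\<alpha>. lookup f (Poly_Mapping.map_key \<pi> \<alpha>) = of_int (sign \<pi>) ^ M * lookup f \<alpha>"
    show "perm_act \<pi> f = scl (of_int (sign \<pi>) ^ M) f"
    proof (rule poly_mapping_eqI)
      fix \<gamma> :: "nat \<Rightarrow>\<^sub>0 int"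
      define \<alpha> where "\<alpha> = Poly_Mapping.map_key (inv \<pi>) \<gamma>"
      have \<gamma>: "\<gamma> = Poly_Mapping.map_key \<pi> \<alpha>"
        by (simp add: \<alpha>_def map_key_inv[OF \<pi>])
      show "lookup (perm_act \<pi> f) \<gamma> = lookup (scl (of_int (sign \<pi>) ^ M) f) \<gamma>"
        unfolding \<gamma> lookup_perm_act[OF \<pi>] lookup_scl using *
        by (simp add: sign_mult_self mult.assoc[symmetric])
    qed
  next
    assume *: "perm_act \<pi> f = scl (of_int (sign \<pi>) ^ M) f"
    show "\<forall>\<alpha>. lookup f (Poly_Mapping.map_key \<pi> \<alpha>) = of_int (sign \<pi>) ^ M * lookup f \<alpha>"
    proof
      fix \<alpha>
      have "of_int (sign \<pi>) ^ M * lookup f \<alpha> = (of_int (sign \<pi>) ^ M * of_int (sign \<pi>) ^ M) * lookup f (Poly_Mapping.map_key \<pi> \<alpha>)"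
        using lookup_perm_act[OF \<pi>, of f \<alpha>] unfolding * by simp
      then show "lookup f (Poly_Mapping.map_key \<pi> \<alpha>) = of_int (sign \<pi>) ^ M * lookup f \<alpha>"
        by (simp add: sign_mult_self)
    qed
  qed
  then show ?thesis
    unfolding sign_poly_def by blast
qed

lemma sign_poly_mult:
  assumes "sign_poly M m f" "sign_poly N m g"
  shows "sign_poly (M + N) m (f * g)"
  using assms by (simp add: sign_poly_perm_act is_poly_mult perm_act_mult scl_mult_left scl_mult_right power_add mult.commute)

lemma sign_poly_add: "sign_poly M m f \<Longrightarrow> sign_poly M m g \<Longrightarrow> sign_poly M m (f + g)"
  by (simp add: sign_poly_def is_poly_add lookup_add distrib_left)

lemma sign_poly_scl: "sign_poly M m f \<Longrightarrow> sign_poly M m (scl c f)"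
  by (simp add: sign_poly_def is_poly_scl)

lemma sign_poly_zero: "sign_poly M m 0"
  by (simp add: sign_poly_def is_poly_zero)

lemma sign_poly_sum: "(\<And>x. x \<in> A \<Longrightarrow> sign_poly M m (g x)) \<Longrightarrow> sign_poly M m (\<Sum>x\<in>A. g x)"
  by (induction A rule: infinite_finite_induct) (auto simp: sign_poly_zero sign_poly_add)

lemma sign_poly_power:
  assumes "sign_poly M m f"
  shows "sign_poly (n * M) m (f ^ n)"
proof (induction n)
  case 0
  show ?case by (simp add: sign_poly_perm_act is_poly_one perm_act_one)
next
  case (Suc n)
  with sign_poly_mult[OF assms this] show ?case by simp
qed

text \<open>The pairs whose order the transposition inverts are (a, b) together with (a, j) and (i,
  b) for i, j strictly between a and b: 2 (b - a - 1) + 1 of them, an odd number.\<close>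

lemma vandermonde_transpose:
  assumes "a < b" "b < m"
  shows "perm_act (transpose a b) (vandermonde m) = - vandermonde m"
proof -
  define \<tau> where "\<tau> = transpose a b"
  have \<tau>: "\<tau> permutes {..<m}"
    unfolding \<tau>_def by (rule permutes_swap_id) (use assms in auto)
  have \<tau>\<tau>: "\<tau> (\<tau> i) = i" for i by (simp add: \<tau>_def)
  have inj: "\<tau> i = \<tau> j \<longleftrightarrow> i = j" for i j by (metis \<tau>\<tau>)
  have lt: "\<tau> i < m \<longleftrightarrow> i < m" for i
    using permutes_in_image[OF \<tau>, of i] by simp
  define P where "P = {(i, j). i < j \<and> j < m}"
  have fin: "finite P"
    by (rule finite_subset[of _ "{..<m} \<times> {..<m}"]) (auto simp: P_def)
  \<comment> \<open>g is the factor of a pair, h puts the transposed pair back into increasing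
    order, and s is the sign this costs.\<close>
  define g where "g = (\<lambda>(i, j). zpow i 1 - zpow j 1)"
  define s :: "nat \<times> nat \<Rightarrow> laurent" where "s = (\<lambda>(i, j). if \<tau> i < \<tau> j then 1 else -1)"
  define h where "h = (\<lambda>(i, j). if \<tau> i < \<tau> j then (\<tau> i, \<tau> j) else (\<tau> j, \<tau> i))"
  have act: "perm_act \<tau> (g p) = s p * g (h p)" if "p \<in> P" for p
  proof (cases p)
    case (Pair i j)
    have inv: "inv \<tau> = \<tau>" by (rule inv_unique_comp) (auto simp: \<tau>\<tau>)
    have "perm_act \<tau> (zpow i 1 - zpow j 1) = zpow (\<tau> i) 1 - zpow (\<tau> j) 1"
      by (simp add: lin_minus[OF lin_perm_act] perm_act_zpow'[OF \<tau>] inv)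
    then show ?thesis
      using Pair by (auto simp: g_def s_def h_def)
  qed
  have bij: "bij_betw h P P"
  proof (rule bij_betw_byWitness[where f' = h])
    show "\<forall>p\<in>P. h (h p) = p" "\<forall>p\<in>P. h (h p) = p"
      by (auto simp: h_def P_def \<tau>\<tau>)
    have "h p \<in> P" if "p \<in> P" for p
    proof (cases p)
      case (Pair i j)
      with that have ij: "i < j" "j < m" by (simp_all add: P_def)
      then have "\<tau> i < m" "\<tau> j < m" "\<tau> i \<noteq> \<tau> j"
        by (simp_all add: lt inj)
      then show ?thesis
        by (simp add: Pair h_def P_def)
    qed
    then show "h ` P \<subseteq> P" "h ` P \<subseteq> P"
      by blast+
  qed
  let ?I = "{p \<in> P. \<not> \<tau> (fst p) < \<tau> (snd p)}"
  have I: "?I = insert (a, b) ((\<lambda>j. (a, j)) ` {a<..<b} \<union> (\<lambda>i. (i, b)) ` {a<..<b})"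
  proof -
    have inv: "\<tau> i < \<tau> j \<longleftrightarrow> \<not> (i = a \<and> j \<le> b \<or> j = b \<and> a \<le> i)" if "i < j" for i j
    proof -
      have \<tau>_simps: "\<tau> a = b" "\<tau> b = a" "k \<noteq> a \<Longrightarrow> k \<noteq> b \<Longrightarrow> \<tau> k = k" for k
        by (simp_all add: \<tau>_def)
      consider "i = a" "j = b" | "i = a" "j \<noteq> b" | "j = b" "i \<noteq> a" | "i = b" | "j = a" | "i \<notin> {a, b}" "j \<notin> {a, b}"
        by blast
      then show ?thesis
        by cases (use that assms(1) in \<open>simp_all add: \<tau>_simps\<close>, arith+)
    qed
    show ?thesis
    proof (intro set_eqI)
      fix p :: "nat \<times> nat"
      obtain i j where p: "p = (i, j)" by fastforce
      have "p \<in> ?I \<longleftrightarrow> i < j \<and> j < m \<and> (i = a \<and> j \<le> b \<or> j = b \<and> a \<le> i)"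
        using inv[of i j] by (auto simp: p P_def)
      also have "\<dots> \<longleftrightarrow> i = a \<and> j = b \<or> i = a \<and> a < j \<and> j < b \<or> j = b \<and> a < i \<and> i < b"
        using assms by linarith
      also have "\<dots> \<longleftrightarrow> p \<in> insert (a, b) ((\<lambda>j. (a, j)) ` {a<..<b} \<union> (\<lambda>i. (i, b)) ` {a<..<b})"
        by (auto simp: p)
      finally show "p \<in> ?I \<longleftrightarrow> p \<in> insert (a, b) ((\<lambda>j. (a, j)) ` {a<..<b} \<union> (\<lambda>i. (i, b)) ` {a<..<b})" .
    qed
  qed
  have "card ?I = Suc (card {a<..<b} + card {a<..<b})"
    unfolding I by (subst card_insert_disjoint, simp, force, subst card_Un_disjoint) (auto simp: card_image inj_on_def)
  then have "(\<Prod>p\<in>?I. -1 :: laurent) = -1"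
    by (simp flip: mult_2)
  moreover have "(\<Prod>p\<in>P. s p) = (\<Prod>p\<in>P. if \<not> \<tau> (fst p) < \<tau> (snd p) then -1 else 1)"
    by (rule prod.cong) (auto simp: s_def)
  ultimately have s: "(\<Prod>p\<in>P. s p) = -1"
    by (simp only: prod.inter_filter[OF fin])
  have "perm_act \<tau> (vandermonde m) = (\<Prod>p\<in>P. s p * g (h p))"
    using act by (simp add: vandermonde_def perm_act_prod[OF \<tau>] flip: P_def g_def cong: prod.cong)
  also have "\<dots> = - (\<Prod>p\<in>P. g (h p))"
    by (simp add: prod.distrib s)
  also have "(\<Prod>p\<in>P. g (h p)) = vandermonde m"
    unfolding prod.reindex_bij_betw[OF bij] by (simp add: vandermonde_def g_def P_def)
  finally show ?thesis by (simp add: \<tau>_def)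
qed

text \<open>Signs multiply along a decomposition into transpositions.
  \<open>permutes_rev_induct\<close> appends them on the right, which fits the right action
  \<open>perm_act\<close>.\<close>

lemma sign_poly_vandermonde: "sign_poly 1 m (vandermonde m)"
  unfolding sign_poly_perm_act
proof (intro conjI allI impI)
  show "is_poly m (vandermonde m)"
    by (auto simp: vandermonde_def intro!: is_poly_prod is_poly_minus is_poly_zpow)
  fix \<pi> assume "\<pi> permutes {..<m}"
  with finite_lessThan show "perm_act \<pi> (vandermonde m) = scl (of_int (sign \<pi>) ^ 1) (vandermonde m)"
  proof (induction rule: permutes_rev_induct)
    case id
    show ?case by (simp add: perm_act_id[unfolded id_def] id_def)
  next
    case (swap a b p)
    have ab: "perm_act (transpose a b) (vandermonde m) = - vandermonde m"
      using swap(1-3) vandermonde_transpose[of a b m] vandermonde_transpose[of b a m]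
      by (cases a b rule: linorder_cases) (auto simp: transpose_commute)
    have \<tau>: "transpose a b permutes {..<m}"
      by (rule permutes_swap_id) (use swap in auto)
    have "perm_act (p \<circ> transpose a b) (vandermonde m) = perm_act (transpose a b) (perm_act p (vandermonde m))"
      using perm_act_compose[OF swap(4) \<tau>] by simp
    also have "\<dots> = scl (- of_int (sign p)) (vandermonde m)"
      unfolding swap(5) lin_scl[OF lin_perm_act] ab by simp
    also have "- sign p = sign (p \<circ> transpose a b)"
      using swap(3,4) by (subst sign_compose) (auto simp: sign_swap_id permutation_swap_id intro: permutes_imp_permutation)
    then have "scl (- of_int (sign p)) (vandermonde m) = scl (of_int (sign (p \<circ> transpose a b)) ^ 1) (vandermonde m)"
      by (simp flip: of_int_minus)
    finally show ?case .
  qed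
qed

text \<open>The products differ by reversing every difference, so the constant is a sign.\<close>

lemma vpoly_vandermonde: "\<exists>c. c \<noteq> 0 \<and> vpoly M m = scl c (vandermonde m ^ M)"
proof -
  let ?P = "{(i, j). i < j \<and> j < m}"
  have P: "?P = (\<lambda>(j, i). (i, j)) ` (SIGMA j:{..<m}. {..<j})"
    by auto
  have "vpoly M m = (\<Prod>(j, i)\<in>(SIGMA j:{..<m}. {..<j}). zpow j 1 - zpow i 1) ^ M"
    unfolding vpoly_def by (subst prod.Sigma) (auto simp: prod_power_distrib case_prod_beta)
  also have "(\<Prod>(j, i)\<in>(SIGMA j:{..<m}. {..<j}). zpow j 1 - zpow i 1) = (\<Prod>p\<in>?P. - (case p of (i, j) \<Rightarrow> zpow i 1 - zpow j 1))"
    unfolding P by (subst prod.reindex) (auto simp: inj_on_def case_prod_beta)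
  also have "\<dots> = (-1) ^ card ?P * vandermonde m"
    by (simp only: prod_uminus vandermonde_def)
  also have "(-1) ^ k * F = scl ((-1) ^ k) F" for k and F :: laurent
    by (induction k) simp_all
  also have "(scl c F) ^ M = scl (c ^ M) (F ^ M)" for c and F :: laurent
    by (induction M) (simp_all add: scl_mult_left scl_mult_right mult.commute)
  finally show ?thesis
    by (intro exI[of _ "((-1) ^ card ?P) ^ M"]) simp
qed

section \<open>Power sums span the symmetric polynomials\<close>

text \<open>The sum runs over permutations rather than distinct monomials, so each monomial of the
  orbit occurs as often as its stabilizer has elements. This keeps the product rule with power sums
  free of multiplicities.\<close>

definition monomial_sym :: "nat \<Rightarrow> (nat \<Rightarrow>\<^sub>0 int) \<Rightarrow> laurent" where
  "monomial_sym m \<alpha> = (\<Sum>\<pi> | \<pi> permutes {..<m}. single (Poly_Mapping.map_key \<pi> \<alpha>) 1)"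

lemma monomial_sym_map_key:
  assumes "\<tau> permutes {..<m}"
  shows "monomial_sym m (Poly_Mapping.map_key \<tau> \<alpha>) = monomial_sym m \<alpha>"
proof -
  have "monomial_sym m \<alpha> = (\<Sum>\<pi> | \<pi> permutes {..<m}. single (Poly_Mapping.map_key (\<tau> \<circ> \<pi>) \<alpha>) 1)"
    unfolding monomial_sym_def by (rule setum_permutations_compose_left[OF assms])
  also have "\<dots> = monomial_sym m (Poly_Mapping.map_key \<tau> \<alpha>)"
    unfolding monomial_sym_def by (rule sum.cong) (simp_all add: map_key_permutes_compose[OF assms])
  finally show ?thesis ..
qed

text \<open>Raising \<alpha> composed with \<pi> at i means raising \<alpha> at \<pi> i; reindexing
  the sum over i by the bijection \<pi> removes \<pi> from the shift.\<close>

lemma psum_times_monomial_sym: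
  "psum m a * monomial_sym m \<alpha> = (\<Sum>i<m. monomial_sym m (\<alpha> + single i a))"
proof -
  have *: "psum m a * single (Poly_Mapping.map_key \<pi> \<alpha>) 1 = (\<Sum>i<m. single (Poly_Mapping.map_key \<pi> (\<alpha> + single i a)) 1)"
    if \<pi>: "\<pi> permutes {..<m}" for \<pi>
  proof -
    have "psum m a * single (Poly_Mapping.map_key \<pi> \<alpha>) 1 =
        (\<Sum>i<m. single (Poly_Mapping.map_key \<pi> (\<alpha> + single (\<pi> i) a)) 1)"
      using permutes_inj[OF \<pi>]
      by (simp add: psum_def zpow_def sum_distrib_right mult_single map_key_plus map_key_single add.commute)
    also have "\<dots> = (\<Sum>i<m. single (Poly_Mapping.map_key \<pi> (\<alpha> + single i a)) 1)"
      by (rule sum.reindex_bij_betw[OF permutes_imp_bij[OF \<pi>]])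
    finally show ?thesis .
  qed
  have "psum m a * monomial_sym m \<alpha> = (\<Sum>\<pi> | \<pi> permutes {..<m}. \<Sum>i<m. single (Poly_Mapping.map_key \<pi> (\<alpha> + single i a)) 1)"
    by (simp add: monomial_sym_def sum_distrib_left *)
  then show ?thesis
    unfolding monomial_sym_def by (subst (asm) sum.swap)
qed

lemma of_nat_times_laurent: "of_nat n * F = scl (of_nat n) F" for F :: laurent
  by (induction n) (simp_all add: distrib_right fvs.scale_left_distrib)

definition psum_span :: "nat \<Rightarrow> laurent set" where
  "psum_span m = fvs.span (range (psum_prod m))"

lemma psum_times_psum_span:
  assumes "F \<in> psum_span m"
  shows "psum m (int (Suc l)) * F \<in> psum_span m"
  using assms unfolding psum_span_def
proof (induction rule: fvs.span_induct_alt)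
  case base
  then show ?case by (simp add: fvs.span_zero)
next
  case (step c F G)
  then obtain \<kappa> where "F = psum_prod m \<kappa>" by auto
  then have "psum m (int (Suc l)) * F = psum_prod m (add_mset l \<kappa>)"
    by (simp add: psum_prod_def)
  with step show ?case
    by (auto simp: distrib_left scl_mult_right intro!: fvs.span_add fvs.span_scale intro: fvs.span_base)
qed

text \<open>If \<open>\<beta>\<close> arises from \<open>\<alpha>\<close> by dropping an exponent \<open>a\<close>, then \<open>p\<^sub>a\<close> times \<open>monomial_sym m \<beta>\<close> is a nonzero
  multiple of \<open>monomial_sym m \<alpha>\<close> plus terms in fewer variables.\<close>

lemma monomial_sym_in_psum_span:
  assumes "keys \<alpha> \<subseteq> {..<m}" "\<And>i. 0 \<le> lookup \<alpha> i"
  shows "monomial_sym m \<alpha> \<in> psum_span m"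
  using assms
proof (induction "card (keys \<alpha>)" arbitrary: \<alpha>)
  case 0
  then have "\<alpha> = 0" by simp
  moreover have "monomial_sym m 0 = scl (of_nat (card {\<pi>. \<pi> permutes {..<m}})) (psum_prod m {#})"
  proof -
    have "monomial_sym m 0 = (\<Sum>\<pi> | \<pi> permutes {..<m}. 1)"
      unfolding monomial_sym_def by (rule sum.cong) (auto simp: permutes_inj)
    then show ?thesis
      by (simp add: psum_prod_def flip: of_nat_times_laurent)
  qed
  ultimately show ?case
    by (simp add: psum_span_def fvs.span_scale fvs.span_base)
next
  case (Suc l)
  then have "keys \<alpha> \<noteq> {}" by auto
  then obtain j where j: "j \<in> keys \<alpha>" by blast
  define a where "a = lookup \<alpha> j"
  define \<beta> where "\<beta> = \<alpha> - single j a"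
  have lookup_\<beta>: "lookup \<beta> i = (if i = j then 0 else lookup \<alpha> i)" for i
    by (simp add: \<beta>_def a_def lookup_minus lookup_single when_def)
  then have keys_\<beta>: "keys \<beta> = keys \<alpha> - {j}"
    by (auto simp: in_keys_iff split: if_splits)
  have \<beta>\<alpha>: "\<beta> + single j a = \<alpha>" by (simp add: \<beta>_def)
  have a: "a > 0"
    using Suc.prems(2)[of j] j by (simp add: a_def in_keys_iff)
  have card: "card (keys \<beta>) = l"
    using Suc.hyps(2) j by (simp add: keys_\<beta>)
  have \<beta>: "keys \<beta> \<subseteq> {..<m}" "0 \<le> lookup \<beta> i" for i
    using Suc.prems by (auto simp: keys_\<beta> lookup_\<beta>)
  \<comment> \<open>As a > 0, raising an exponent already in use keeps the set of used variables, so
    the induction hypothesis for l covers these terms.\<close>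
  have in_keys: "monomial_sym m (\<beta> + single i a) \<in> psum_span m" if "i \<in> keys \<beta>" for i
  proof (rule Suc.hyps(1))
    have "keys (\<beta> + single i a) = keys \<beta>"
      using that a \<beta>(2)[of i] by (auto simp: in_keys_iff lookup_add lookup_single when_def split: if_splits)
    then show "l = card (keys (\<beta> + single i a))" "keys (\<beta> + single i a) \<subseteq> {..<m}"
      using card \<beta>(1) by simp_all
    show "0 \<le> lookup (\<beta> + single i a) k" for k
      using \<beta>(2)[of k] a by (simp add: lookup_add lookup_single when_def)
  qed
  have notin_keys: "monomial_sym m (\<beta> + single i a) = monomial_sym m \<alpha>" if "i \<in> {..<m} - keys \<beta>" for i
  proof -
    have jm: "j < m" using Suc.prems(1) j by auto
    have \<tau>: "transpose i j permutes {..<m}"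
      by (rule permutes_swap_id) (use that jm in auto)
    have z: "lookup \<beta> i = 0" "lookup \<beta> j = 0"
      using that lookup_\<beta> by (auto simp: in_keys_iff)
    have "\<beta> + single i a = Poly_Mapping.map_key (transpose i j) (\<beta> + single j a)"
      by (rule poly_mapping_eqI)
        (use z in \<open>auto simp: lookup_map_key[OF \<tau>] lookup_add lookup_single when_def transpose_def\<close>)
    then show ?thesis
      using monomial_sym_map_key[OF \<tau>] by (simp add: \<beta>\<alpha>)
  qed
  have "psum m a * monomial_sym m \<beta> = (\<Sum>i\<in>{..<m} - keys \<beta>. monomial_sym m (\<beta> + single i a)) + (\<Sum>i\<in>keys \<beta>. monomial_sym m (\<beta> + single i a))"
    unfolding psum_times_monomial_sym by (rule sum.subset_diff) (use \<beta>(1) in auto)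
  also have "(\<Sum>i\<in>{..<m} - keys \<beta>. monomial_sym m (\<beta> + single i a)) = scl (of_nat (card ({..<m} - keys \<beta>))) (monomial_sym m \<alpha>)"
    by (simp add: notin_keys of_nat_times_laurent)
  finally have eq: "scl (of_nat (card ({..<m} - keys \<beta>))) (monomial_sym m \<alpha>) =
      psum m a * monomial_sym m \<beta> - (\<Sum>i\<in>keys \<beta>. monomial_sym m (\<beta> + single i a))"
    by simp
  obtain l' where "a = int (Suc l')"
    using a by (metis not0_implies_Suc of_nat_0 order_less_irrefl zero_less_imp_eq_int)
  then have "psum m a * monomial_sym m \<beta> \<in> psum_span m"
    using psum_times_psum_span Suc.hyps(1)[of \<beta>] card \<beta> by simp
  then have "psum m a * monomial_sym m \<beta> - (\<Sum>i\<in>keys \<beta>. monomial_sym m (\<beta> + single i a)) \<in> psum_span m"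
    using in_keys unfolding psum_span_def by (intro fvs.span_diff fvs.span_sum) auto
  then have "scl (of_nat (card ({..<m} - keys \<beta>))) (monomial_sym m \<alpha>) \<in> psum_span m"
    by (simp only: eq)
  then have "scl (1 / of_nat (card ({..<m} - keys \<beta>))) (scl (of_nat (card ({..<m} - keys \<beta>))) (monomial_sym m \<alpha>)) \<in> psum_span m"
    unfolding psum_span_def by (rule fvs.span_scale)
  moreover have "j \<in> {..<m} - keys \<beta>"
    using Suc.prems(1) j by (auto simp: keys_\<beta>)
  then have "card ({..<m} - keys \<beta>) \<noteq> 0"
    by auto
  ultimately show ?case by simp
qed

text \<open>Summing over all permutations gives m! g on the one hand and, monomial by monomial, the
  functions \<open>monomial_sym\<close> on the other; m! is then divided out.\<close>

lemma sym_poly_in_psum_span: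
  assumes "sym_poly m g"
  shows "g \<in> psum_span m"
proof -
  have act: "perm_act \<pi> g = g" if "\<pi> permutes {..<m}" for \<pi>
    using assms that by (simp add: sign_poly_perm_act flip: sign_poly_0)
  have poly: "keys \<alpha> \<subseteq> {..<m}" "0 \<le> lookup \<alpha> i" if "\<alpha> \<in> keys g" for \<alpha> i
    using assms that by (auto simp: sym_poly_def is_poly_def)
  have "(\<Sum>\<pi> | \<pi> permutes {..<m}. perm_act \<pi> g) = of_nat (card {\<pi>. \<pi> permutes {..<m}}) * g"
    by (simp add: act)
  then have "scl (fact m) g = (\<Sum>\<pi> | \<pi> permutes {..<m}. perm_act \<pi> g)"
    using of_nat_times_laurent[of "fact m" g] by (simp add: card_permutations[of "{..<m}" m])
  also have "\<dots> = (\<Sum>\<alpha>\<in>keys g. scl (lookup g \<alpha>) (monomial_sym m \<alpha>))"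
    unfolding perm_act_def linext_def monomial_sym_def fvs.scale_sum_right by (rule sum.swap)
  also have "\<dots> \<in> psum_span m"
    using monomial_sym_in_psum_span[unfolded psum_span_def] poly unfolding psum_span_def
    by (intro fvs.span_sum fvs.span_scale) auto
  finally have "scl (1 / fact m) (scl (fact m) g) \<in> psum_span m"
    unfolding psum_span_def by (rule fvs.span_scale)
  then show ?thesis by simp
qed

lemma sym_poly_psum_prod: "sym_poly m (psum_prod m \<kappa>)"
proof -
  have psum: "sign_poly 0 m (psum m (int n))" for n
    unfolding sign_poly_perm_act
  proof (intro conjI allI impI)
    show "is_poly m (psum m (int n))"
      by (auto simp: psum_def intro!: is_poly_sum is_poly_zpow)
    fix \<pi> assume \<pi>: "\<pi> permutes {..<m}"
    have "perm_act \<pi> (psum m (int n)) = (\<Sum>i<m. zpow (inv \<pi> i) (int n))"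
      by (simp add: psum_def lin_sum[OF lin_perm_act] perm_act_zpow'[OF \<pi>])
    also have "\<dots> = psum m (int n)"
      unfolding psum_def by (rule sum.reindex_bij_betw[OF permutes_imp_bij[OF permutes_inv[OF \<pi>]]])
    finally show "perm_act \<pi> (psum m (int n)) = scl (of_int (sign \<pi>) ^ 0) (psum m (int n))"
      by simp
  qed
  have one: "sign_poly 0 m 1"
    by (simp add: sign_poly_perm_act is_poly_one perm_act_one)
  have "sign_poly 0 m (psum_prod m \<kappa>)"
    unfolding psum_prod_def
    by (induction \<kappa>) (use one sign_poly_mult[OF psum, of 0] in \<open>simp_all del: of_nat_Suc\<close>)
  then show ?thesis by (simp add: sign_poly_0)
qed

section \<open>Total degree\<close>

definition homogeneous :: "nat \<Rightarrow> int \<Rightarrow> laurent \<Rightarrow> bool" where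
  "homogeneous m d F \<longleftrightarrow> (\<forall>\<alpha>\<in>keys F. (\<Sum>i<m. lookup \<alpha> i) = d)"

lemma homogeneous_one: "homogeneous m 0 1"
  by (simp add: homogeneous_def flip: single_one)

lemma homogeneous_zpow: "i < m \<Longrightarrow> homogeneous m n (zpow i n)"
  by (simp add: homogeneous_def zpow_def lookup_single when_def)

lemma homogeneous_add: "homogeneous m d F \<Longrightarrow> homogeneous m d G \<Longrightarrow> homogeneous m d (F + G)"
  using keys_add[of F G] by (auto simp: homogeneous_def)

lemma homogeneous_minus: "homogeneous m d F \<Longrightarrow> homogeneous m d G \<Longrightarrow> homogeneous m d (F - G)"
  using keys_diff[of F G] by (auto simp: homogeneous_def)

lemma homogeneous_sum: "(\<And>x. x \<in> A \<Longrightarrow> homogeneous m d (g x)) \<Longrightarrow> homogeneous m d (\<Sum>x\<in>A. g x)"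
  by (induction A rule: infinite_finite_induct) (auto simp: homogeneous_add homogeneous_def[of _ _ 0])

lemma homogeneous_mult:
  assumes "homogeneous m d F" "homogeneous m e G"
  shows "homogeneous m (d + e) (F * G)"
  unfolding homogeneous_def
proof
  fix \<gamma> assume "\<gamma> \<in> keys (F * G)"
  then obtain \<alpha> \<beta> where "\<alpha> \<in> keys F" "\<beta> \<in> keys G" "\<gamma> = \<alpha> + \<beta>"
    using keys_mult[of F G] by blast
  with assms show "(\<Sum>i<m. lookup \<gamma> i) = d + e"
    by (simp add: homogeneous_def lookup_add sum.distrib)
qed

lemma homogeneous_power: "\<exists>e. homogeneous m d F \<longrightarrow> homogeneous m e (F ^ n)"
proof (induction n)
  case (Suc n)
  then show ?case
    using homogeneous_mult[of m d F _ "F ^ n"] by auto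
qed (use homogeneous_one in auto)

lemma homogeneous_prod: "(\<And>x. x \<in> A \<Longrightarrow> \<exists>d. homogeneous m d (g x)) \<Longrightarrow> \<exists>d. homogeneous m d (\<Prod>x\<in>A. g x)"
proof (induction A rule: infinite_finite_induct)
  case (insert x A)
  then obtain d e where "homogeneous m d (g x)" "homogeneous m e (\<Prod>x\<in>A. g x)"
    by blast
  from homogeneous_mult[OF this] insert(1,2) show ?case by auto
qed (use homogeneous_one in auto)

lemma homogeneous_generator: "\<exists>d. homogeneous m d (psum_prod m \<kappa> * vandermonde m ^ M)"
proof -
  have "\<exists>d. homogeneous m d (zpow i 1 - zpow j 1)" if "i < m" "j < m" for i j
    using homogeneous_minus[OF homogeneous_zpow[OF that(1)] homogeneous_zpow[OF that(2)]] by blast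
  then have "\<exists>d. homogeneous m d (vandermonde m)"
    unfolding vandermonde_def by (intro homogeneous_prod) auto
  then have V: "\<exists>d. homogeneous m d (vandermonde m ^ M)"
    using homogeneous_power[of m _ "vandermonde m" M] by blast
  have psum: "homogeneous m n (psum m n)" for n
    by (auto simp: psum_def intro!: homogeneous_sum homogeneous_zpow)
  have "\<exists>d. homogeneous m d (psum_prod m \<kappa>)"
  proof (induction \<kappa>)
    case (add l \<kappa>)
    then obtain d where "homogeneous m d (psum_prod m \<kappa>)" ..
    from homogeneous_mult[OF psum[of "int (Suc l)"] this] show ?case
      by (auto simp: psum_prod_def)
  qed (use homogeneous_one in \<open>auto simp: psum_prod_def\<close>)
  then obtain d where "homogeneous m d (psum_prod m \<kappa>)" ..
  with V show ?thesis
    using homogeneous_mult by blast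
qed

section \<open>The double annihilator\<close>

text \<open>The family \<open>G\<close> need not span a finite-dimensional space: since each \<open>G i\<close> lives inside or outside
  of \<open>A\<close>, a separating functional can be truncated to the monomials in \<open>A\<close>.\<close>

lemma separating_coefficients:
  fixes f :: "'a \<Rightarrow>\<^sub>0 complex"
  assumes "finite A" "keys f \<subseteq> A" "\<And>i. keys (G i) \<subseteq> A \<or> keys (G i) \<inter> A = {}"
    and "f \<notin> fvs.span (range G)"
  shows "\<exists>c. (\<Sum>\<alpha>\<in>A. c \<alpha> * lookup f \<alpha>) \<noteq> 0 \<and> (\<forall>i. (\<Sum>\<alpha>\<in>A. c \<alpha> * lookup (G i) \<alpha>) = 0)"
proof -
  interpret pair: vector_space_pair "scl :: complex \<Rightarrow> ('a \<Rightarrow>\<^sub>0 complex) \<Rightarrow> _" "(*) :: complex \<Rightarrow> complex \<Rightarrow> complex"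
    by standard (auto simp: algebra_simps)
  \<comment> \<open>A basis B of the span, enlarged by f, carries a functional with value 1 at f and
    0 on B; its values on monomials are the coefficients sought.\<close>
  obtain B where B: "B \<subseteq> range G" "fvs.independent B" "range G \<subseteq> fvs.span B"
    using fvs.maximal_independent_subset by blast
  then have "f \<notin> fvs.span B"
    using assms(4) fvs.span_mono[OF B(1)] by blast
  with B(2) have "fvs.independent (insert f B)"
    by (simp add: fvs.independent_insertI)
  then obtain \<psi> where \<psi>: "Vector_Spaces.linear scl (*) \<psi>"
      and \<psi>_eq: "\<forall>x\<in>insert f B. \<psi> x = (if x = f then 1 else 0)"
    using pair.linear_independent_extend[of "insert f B" "\<lambda>x. if x = f then 1 else 0"] by blast
  have \<psi>B: "\<psi> x = 0" if "x \<in> fvs.span B" for x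
  proof (rule pair.linear_eq_0_on_span[OF \<psi> _ that])
    show "\<psi> x = 0" if "x \<in> B" for x
      using that \<psi>_eq \<open>f \<notin> fvs.span B\<close> fvs.span_base by auto
  qed
  have expand: "\<psi> g = (\<Sum>\<alpha>\<in>A. \<psi> (single \<alpha> 1) * lookup g \<alpha>)" if "keys g \<subseteq> A" for g
  proof -
    have "g = (\<Sum>\<alpha>\<in>A. scl (lookup g \<alpha>) (single \<alpha> 1))"
      by (rule poly_mapping_eqI)
        (use that assms(1) in \<open>auto simp: lookup_sum lookup_single when_def in_keys_iff sum.If_cases\<close>)
    then have "\<psi> g = \<psi> (\<Sum>\<alpha>\<in>A. scl (lookup g \<alpha>) (single \<alpha> 1))" by simp
    also have "\<dots> = (\<Sum>\<alpha>\<in>A. lookup g \<alpha> * \<psi> (single \<alpha> 1))"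
      using \<psi> by (simp only: pair.linear_sum pair.linear_scale)
    finally show ?thesis by (simp add: mult.commute)
  qed
  show ?thesis
  proof (intro exI[of _ "\<lambda>\<alpha>. \<psi> (single \<alpha> 1)"] conjI allI)
    show "(\<Sum>\<alpha>\<in>A. \<psi> (single \<alpha> 1) * lookup f \<alpha>) \<noteq> 0"
      using expand[OF assms(2)] \<psi>_eq by simp
    fix i
    have "G i \<in> fvs.span B" using B(3) by blast
    then have "\<psi> (G i) = 0" by (rule \<psi>B)
    then show "(\<Sum>\<alpha>\<in>A. \<psi> (single \<alpha> 1) * lookup (G i) \<alpha>) = 0"
    proof (cases "keys (G i) \<subseteq> A")
      case False
      with assms(3)[of i] show ?thesis
        by (intro sum.neutral) (auto simp: in_keys_iff disjoint_iff)
    qed (use expand in simp)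
  qed
qed

section \<open>Polynomials in the modes acting on the vacuum\<close>

definition word_exp :: "int list \<Rightarrow> (nat \<Rightarrow>\<^sub>0 int)" where
  "word_exp ns = (\<Sum>i<length ns. single i (ns ! i))"

lemma lookup_word_exp: "lookup (word_exp ns) i = (if i < length ns then ns ! i else 0)"
  by (simp add: word_exp_def lookup_sum_single)

lemma keys_word_exp: "keys (word_exp ns) \<subseteq> {..<length ns}"
  by (auto simp: in_keys_iff lookup_word_exp split: if_splits)

lemma word_exp_eq_iff:
  assumes "length ns = length ms"
  shows "word_exp ns = word_exp ms \<longleftrightarrow> ns = ms"
proof
  assume *: "word_exp ns = word_exp ms"
  show "ns = ms"
  proof (rule nth_equalityI[OF assms])
    fix i assume "i < length ns"
    then show "ns ! i = ms ! i"
      using arg_cong[OF *, of "\<lambda>\<alpha>. lookup \<alpha> i"] assms by (simp add: lookup_word_exp)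
  qed
qed simp

text \<open>The last entry of the list acts on the vacuum first and belongs to z_0 in
  \<open>chain\<close>: hence \<open>rev\<close>.\<close>

lemma foldr_vertex_chain:
  "foldr (vertex_coeff M 1) ns vac = chain M (length ns) (word_exp (rev ns))"
proof (induction ns)
  case (Cons n ns)
  have "chain M (length ns) (word_exp (rev (n # ns))) = chain M (length ns) (word_exp (rev ns))"
    by (rule chain_cong) (simp add: lookup_word_exp nth_append)
  with Cons show ?case
    by (simp add: lookup_word_exp nth_append)
qed simp

definition generator :: "nat \<Rightarrow> nat \<Rightarrow> nat multiset \<Rightarrow> laurent" where
  "generator M m \<kappa> = psum_prod m \<kappa> * vandermonde m ^ M"

lemma sign_poly_generator: "sign_poly M m (generator M m \<kappa>)"
  using sign_poly_mult[of 0 m "psum_prod m \<kappa>" M] sign_poly_power[OF sign_poly_vandermonde, of M m]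
  by (simp add: generator_def sign_poly_0 sym_poly_psum_prod)

text \<open>Reversal of the variables is a permutation, so on the generators it costs only a scalar
  sign^M that the constants can absorb.\<close>

lemma word_exp_rev:
  "\<exists>\<rho>. \<rho> permutes {..<m} \<and>
    (\<forall>ns. length ns = m \<longrightarrow> word_exp (rev ns) = Poly_Mapping.map_key \<rho> (word_exp ns))"
proof (intro exI conjI allI impI)
  let ?\<rho> = "\<lambda>i. if i < m then m - Suc i else i"
  show \<rho>: "?\<rho> permutes {..<m}"
    by (rule bij_imp_permutes, rule bij_betw_byWitness[where f' = ?\<rho>]) auto
  show "word_exp (rev ns) = Poly_Mapping.map_key ?\<rho> (word_exp ns)" if "length ns = m" for ns
    by (rule poly_mapping_eqI) (use that in \<open>auto simp: lookup_map_key[OF \<rho>] lookup_word_exp rev_nth\<close>)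
qed

text \<open>The constant does not depend on the word. This uniformity lets the vanishing of a linear
  combination of words be tested on the same combination of coefficients of the generators.\<close>

lemma lookup_foldr_vertex:
  assumes "M > 0"
  shows "\<exists>c. (\<forall>\<kappa>. c \<kappa> \<noteq> 0) \<and> (\<forall>ns \<kappa>. length ns = m \<longrightarrow>
    lookup (foldr (vertex_coeff M 1) ns vac) (int m, \<kappa>) = c \<kappa> * lookup (generator M m \<kappa>) (word_exp ns))"
proof -
  obtain c1 where c1: "\<And>\<kappa>. c1 \<kappa> \<noteq> 0 \<and> represents M m \<kappa> (scl (c1 \<kappa>) (psum_prod m \<kappa> * vpoly M m))"
    using represents_psum_prod[OF assms] by metis
  obtain c2 where c2: "c2 \<noteq> 0" "vpoly M m = scl c2 (vandermonde m ^ M)"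
    using vpoly_vandermonde by blast
  obtain \<rho> where \<rho>: "\<rho> permutes {..<m}"
      "\<And>ns. length ns = m \<Longrightarrow> word_exp (rev ns) = Poly_Mapping.map_key \<rho> (word_exp ns)"
    using word_exp_rev by blast
  define \<chi> :: complex where "\<chi> = of_int (sign \<rho>) ^ M"
  have "\<chi> \<noteq> 0" by (simp add: \<chi>_def sign_def)
  have "lookup (foldr (vertex_coeff M 1) ns vac) (int m, \<kappa>) =
      c1 \<kappa> * c2 * \<chi> * lookup (generator M m \<kappa>) (word_exp ns)" if ns: "length ns = m" for ns \<kappa>
  proof -
    have "lookup (foldr (vertex_coeff M 1) ns vac) (int m, \<kappa>) =
        lookup (scl (c1 \<kappa>) (psum_prod m \<kappa> * vpoly M m)) (word_exp (rev ns))"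
      using c1[of \<kappa>] keys_word_exp[of "rev ns"] ns by (simp add: foldr_vertex_chain represents_def)
    also have "\<dots> = c1 \<kappa> * c2 * lookup (generator M m \<kappa>) (Poly_Mapping.map_key \<rho> (word_exp ns))"
      by (simp add: c2(2) scl_mult_right generator_def \<rho>(2)[OF ns])
    also have "lookup (generator M m \<kappa>) (Poly_Mapping.map_key \<rho> (word_exp ns)) = \<chi> * lookup (generator M m \<kappa>) (word_exp ns)"
      using sign_poly_generator \<rho>(1) by (simp add: sign_poly_def \<chi>_def)
    finally show ?thesis by simp
  qed
  with c1 c2(1) \<open>\<chi> \<noteq> 0\<close> show ?thesis
    by (intro exI[of _ "\<lambda>\<kappa>. c1 \<kappa> * c2 * \<chi>"]) simp
qed

lemma lookup_foldr_vertex_charge: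
  assumes "k \<noteq> int (length ns)"
  shows "lookup (foldr (vertex_coeff M 1) ns vac) (k, \<kappa>) = 0"
proof -
  have "(k, \<kappa>) \<notin> keys (foldr (vertex_coeff M 1) ns vac)"
    using charged_chain[of "length ns" M "word_exp (rev ns)"] assms
    by (auto simp: foldr_vertex_chain charged_def)
  then show ?thesis by (simp add: in_keys_iff)
qed

definition exp_word :: "nat \<Rightarrow> (nat \<Rightarrow>\<^sub>0 int) \<Rightarrow> nat list" where
  "exp_word m \<alpha> = map (\<lambda>i. nat (lookup \<alpha> i)) [0..<m]"

lemma length_exp_word: "length (exp_word m \<alpha>) = m"
  by (simp add: exp_word_def)

lemma word_exp_exp_word:
  assumes "keys \<alpha> \<subseteq> {..<m}" "\<And>i. 0 \<le> lookup \<alpha> i"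
  shows "word_exp (map int (exp_word m \<alpha>)) = \<alpha>"
proof (rule poly_mapping_eqI)
  fix i
  have "i \<in> keys \<alpha> \<Longrightarrow> i < m" using assms(1) by auto
  then show "lookup (word_exp (map int (exp_word m \<alpha>))) i = lookup \<alpha> i"
    using assms(2)[of i] by (auto simp: lookup_word_exp exp_word_def in_keys_iff)
qed

lemma finite_exponents:
  fixes m :: nat
  shows "finite {\<alpha>. keys \<alpha> \<subseteq> {..<m} \<and> (\<forall>i. 0 \<le> lookup \<alpha> i) \<and> (\<Sum>i<m. lookup \<alpha> i) = (d::int)}"
proof (rule finite_subset)
  show "{\<alpha>. keys \<alpha> \<subseteq> {..<m} \<and> (\<forall>i. 0 \<le> lookup \<alpha> i) \<and> (\<Sum>i<m. lookup \<alpha> i) = d} \<subseteq>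
      (\<lambda>ks. word_exp (map int ks)) ` {ks. set ks \<subseteq> {..nat d} \<and> length ks = m}"
  proof
    fix \<alpha> assume "\<alpha> \<in> {\<alpha>. keys \<alpha> \<subseteq> {..<m} \<and> (\<forall>i. 0 \<le> lookup \<alpha> i) \<and> (\<Sum>i<m. lookup \<alpha> i) = d}"
    then have \<alpha>: "keys \<alpha> \<subseteq> {..<m}" "\<And>i. 0 \<le> lookup \<alpha> i" "(\<Sum>i<m. lookup \<alpha> i) = d"
      by auto
    have "lookup \<alpha> i \<le> d" if "i < m" for i
      unfolding \<alpha>(3)[symmetric] using that \<alpha>(2) by (intro member_le_sum) auto
    then have "set (exp_word m \<alpha>) \<subseteq> {..nat d}"
      by (auto simp: exp_word_def nat_mono)
    then show "\<alpha> \<in> (\<lambda>ks. word_exp (map int ks)) ` {ks. set ks \<subseteq> {..nat d} \<and> length ks = m}"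
      using word_exp_exp_word[OF \<alpha>(1,2)] length_exp_word by (intro image_eqI[of _ _ "exp_word m \<alpha>"]) auto
  qed
qed (simp add: finite_lists_length_eq)

text \<open>\<open>'b\<close> indexes the monomials in the modes, \<open>srt x\<close> lists the factors of the monomial \<open>x\<close> in
  increasing order and \<open>wd ks\<close> expresses the product with factors \<open>ks\<close> through monomials.\<close>

locale mode_polynomials =
  fixes M :: nat and srt :: "'b \<Rightarrow> nat list" and wd :: "nat list \<Rightarrow> ('b \<Rightarrow>\<^sub>0 complex)"
  assumes M_pos: "M > 0"
    and sorted_srt: "sorted (srt x)"
    and srt_inject: "srt x = srt y \<Longrightarrow> x = y"
    and stabilizer: "\<pi> permutes {..<length (srt x)} \<Longrightarrow>
      Poly_Mapping.map_key \<pi> (word_exp (map int (srt x))) = word_exp (map int (srt x)) \<Longrightarrow>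
      of_int (sign \<pi>) ^ M = (1::complex)"
    and length_wd: "x \<in> keys (wd ks) \<Longrightarrow> length (srt x) = length ks"
    and pair_wd: "sign_poly M (length ks) f \<Longrightarrow>
      (\<Sum>x\<in>keys (wd ks). lookup (wd ks) x * lookup f (word_exp (map int (srt x)))) = lookup f (word_exp (map int ks))"
begin

definition ev :: "('b \<Rightarrow>\<^sub>0 complex) \<Rightarrow> fock" where
  "ev = linext (\<lambda>x. foldr (vertex_coeff M 1) (map int (srt x)) vac)"

definition charge_part :: "nat \<Rightarrow> ('b \<Rightarrow>\<^sub>0 complex) set" where
  "charge_part m = {P. \<forall>x\<in>keys P. length (srt x) = m}"

text \<open>The residue pairing after the monomial factor of the form is cancelled: what remains is
  a coefficient of f.\<close>

definition pair :: "laurent \<Rightarrow> ('b \<Rightarrow>\<^sub>0 complex) \<Rightarrow> complex" where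
  "pair f P = (\<Sum>x\<in>keys P. lookup P x * lookup f (word_exp (map int (srt x))))"

text \<open>With values in the one-dimensional space with basis \<open>()\<close>, the pairing
  inherits linearity from \<open>linext\<close>.\<close>

lemma pair_linext: "pair f P = lookup (linext (\<lambda>x. single () (lookup f (word_exp (map int (srt x))))) P) ()"
  by (simp add: pair_def linext_def lookup_sum)

lemma pair_add_right: "pair f (P + Q) = pair f P + pair f Q"
  and pair_scl_right: "pair f (scl c P) = c * pair f P"
  and pair_zero_right: "pair f 0 = 0"
  and pair_sum_right: "pair f (\<Sum>x\<in>A. g x) = (\<Sum>x\<in>A. pair f (g x))"
  and pair_minus_right: "pair f (P - Q) = pair f P - pair f Q"
  by (simp_all add: pair_linext linext_add linext_scl lookup_add lin_sum[OF lin_linext] lookup_sum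
      lin_minus[OF lin_linext] lookup_minus)

lemma pair_single: "pair f (single x c) = c * lookup f (word_exp (map int (srt x)))"
  by (simp add: pair_linext)

lemma pair_add_left: "pair (f + g) P = pair f P + pair g P"
  and pair_scl_left: "pair (scl c f) P = c * pair f P"
  and pair_zero_left: "pair 0 P = 0"
  by (simp_all add: pair_def lookup_add distrib_left sum.distrib sum_distrib_left mult.left_commute)

lemma pair_word: "sign_poly M (length ks) f \<Longrightarrow> pair f (wd ks) = lookup f (word_exp (map int ks))"
  by (simp add: pair_def pair_wd)

lemma charge_part_add: "P \<in> charge_part m \<Longrightarrow> Q \<in> charge_part m \<Longrightarrow> P + Q \<in> charge_part m"
  using keys_add[of P Q] by (auto simp: charge_part_def)

lemma charge_part_scl: "P \<in> charge_part m \<Longrightarrow> scl c P \<in> charge_part m"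
  by (auto simp: charge_part_def in_keys_iff)

lemma charge_part_zero: "0 \<in> charge_part m"
  by (simp add: charge_part_def)

lemma charge_part_sum: "(\<And>x. x \<in> A \<Longrightarrow> g x \<in> charge_part m) \<Longrightarrow> (\<Sum>x\<in>A. g x) \<in> charge_part m"
  by (induction A rule: infinite_finite_induct) (auto simp: charge_part_add charge_part_zero)

lemma wd_in_charge_part: "length ks = m \<Longrightarrow> wd ks \<in> charge_part m"
  using length_wd by (auto simp: charge_part_def)

lemma lin_ev: "lin ev"
  by (simp add: ev_def lin_linext)

text \<open>One constant serves both arbitrary words and polynomials P, so that a word can be
  compared with \<open>ev P\<close> coefficient by coefficient.\<close>

lemma lookup_ev:
  "\<exists>c. (\<forall>\<kappa>. c \<kappa> \<noteq> 0) \<and> (\<forall>ns \<kappa>. length ns = m \<longrightarrow>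
      lookup (foldr (vertex_coeff M 1) ns vac) (int m, \<kappa>) = c \<kappa> * lookup (generator M m \<kappa>) (word_exp ns)) \<and>
    (\<forall>P\<in>charge_part m. \<forall>\<kappa>. lookup (ev P) (int m, \<kappa>) = c \<kappa> * pair (generator M m \<kappa>) P)"
proof -
  obtain c where c: "\<forall>\<kappa>. c \<kappa> \<noteq> 0" "\<forall>ns \<kappa>. length ns = m \<longrightarrow>
      lookup (foldr (vertex_coeff M 1) ns vac) (int m, \<kappa>) = c \<kappa> * lookup (generator M m \<kappa>) (word_exp ns)"
    using lookup_foldr_vertex[OF M_pos] by blast
  then show ?thesis
    by (intro exI[of _ c])
      (simp add: ev_def pair_def linext_def lookup_sum charge_part_def sum_distrib_left mult.left_commute)
qed

lemma lookup_ev_charge: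
  "P \<in> charge_part m \<Longrightarrow> k \<noteq> int m \<Longrightarrow> lookup (ev P) (k, \<kappa>) = 0"
  by (simp add: ev_def linext_def lookup_sum charge_part_def lookup_foldr_vertex_charge)

lemma ev_eq_0_iff:
  assumes "P \<in> charge_part m"
  shows "ev P = 0 \<longleftrightarrow> (\<forall>\<kappa>. pair (generator M m \<kappa>) P = 0)"
proof -
  obtain c where c: "\<forall>\<kappa>. c \<kappa> \<noteq> 0" "\<forall>\<kappa>. lookup (ev P) (int m, \<kappa>) = c \<kappa> * pair (generator M m \<kappa>) P"
    using lookup_ev[of m] assms by blast
  have "ev P = 0 \<longleftrightarrow> (\<forall>\<kappa>. lookup (ev P) (int m, \<kappa>) = 0)"
  proof
    assume *: "\<forall>\<kappa>. lookup (ev P) (int m, \<kappa>) = 0"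
    show "ev P = 0"
    proof (rule poly_mapping_eqI)
      fix x :: "int \<times> nat multiset"
      obtain k \<kappa> where "x = (k, \<kappa>)" by fastforce
      then show "lookup (ev P) x = lookup 0 x"
        using * lookup_ev_charge[OF assms] by (cases "k = int m") auto
    qed
  qed simp
  with c show ?thesis by simp
qed

subsection \<open>The annihilator of the relations\<close>

definition annihilator :: "nat \<Rightarrow> laurent set" where
  "annihilator m = {f. sign_poly M m f \<and> (\<forall>P\<in>charge_part m. ev P = 0 \<longrightarrow> pair f P = 0)}"

text \<open>A functional separating f from the generators is a family of numbers on exponents. Taken
  as coefficients of words in the modes, it gives a P that kills the vacuum and yet pairs
  nontrivially with f.\<close>

lemma annihilator_subset_span: "annihilator m \<subseteq> fvs.span (range (generator M m))"
proof (rule subsetI, rule ccontr)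
  fix f assume f: "f \<in> annihilator m" and not_span: "f \<notin> fvs.span (range (generator M m))"
  have sign: "sign_poly M m f" using f by (simp add: annihilator_def)
  let ?deg = "\<lambda>\<alpha>. \<Sum>i<m. lookup \<alpha> i"
  \<comment> \<open>All exponents whose total degree occurs in f. Made of whole degree components, A
    contains or misses the support of each homogeneous generator.\<close>
  define A where "A = (\<Union>d\<in>?deg ` keys f. {\<alpha>. keys \<alpha> \<subseteq> {..<m} \<and> (\<forall>i. 0 \<le> lookup \<alpha> i) \<and> ?deg \<alpha> = d})"
  have "finite A"
    unfolding A_def using finite_exponents by (intro finite_UN_I) auto
  moreover have "keys f \<subseteq> A"
    using sign unfolding A_def sign_poly_def is_poly_def by blast
  moreover have "keys (generator M m \<kappa>) \<subseteq> A \<or> keys (generator M m \<kappa>) \<inter> A = {}" for \<kappa>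
  proof -
    obtain d where d: "homogeneous m d (generator M m \<kappa>)"
      unfolding generator_def using homogeneous_generator by blast
    have "is_poly m (generator M m \<kappa>)"
      using sign_poly_generator by (simp add: sign_poly_def)
    with d have "\<alpha> \<in> A \<longleftrightarrow> d \<in> ?deg ` keys f" if "\<alpha> \<in> keys (generator M m \<kappa>)" for \<alpha>
      using that by (simp add: A_def homogeneous_def is_poly_def image_iff)
    then show ?thesis by blast
  qed
  ultimately obtain c where c: "(\<Sum>\<alpha>\<in>A. c \<alpha> * lookup f \<alpha>) \<noteq> 0"
      "\<And>\<kappa>. (\<Sum>\<alpha>\<in>A. c \<alpha> * lookup (generator M m \<kappa>) \<alpha>) = 0"
    using separating_coefficients[of A f "generator M m"] not_span by blast
  define P where "P = (\<Sum>\<alpha>\<in>A. scl (c \<alpha>) (wd (exp_word m \<alpha>)))"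
  have P: "P \<in> charge_part m"
    unfolding P_def by (intro charge_part_sum charge_part_scl wd_in_charge_part length_exp_word)
  \<comment> \<open>The words in P need not be sorted; \<open>pair_word\<close> accounts for the
    reordering through the sign behaviour of g.\<close>
  have pair_P: "pair g P = (\<Sum>\<alpha>\<in>A. c \<alpha> * lookup g \<alpha>)" if "sign_poly M m g" for g
    unfolding P_def pair_sum_right pair_scl_right
  proof (rule sum.cong[OF refl])
    fix \<alpha> assume "\<alpha> \<in> A"
    then have "word_exp (map int (exp_word m \<alpha>)) = \<alpha>"
      by (intro word_exp_exp_word) (auto simp: A_def)
    then show "c \<alpha> * pair g (wd (exp_word m \<alpha>)) = c \<alpha> * lookup g \<alpha>"
      using pair_word[of "exp_word m \<alpha>" g] that by (simp add: length_exp_word)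
  qed
  have "ev P = 0"
    using c(2) by (simp add: ev_eq_0_iff[OF P] pair_P[OF sign_poly_generator])
  with f P have "pair f P = 0" by (simp add: annihilator_def)
  with c(1) pair_P[OF sign] show False by simp
qed

lemma annihilator_eq: "annihilator m = {vandermonde m ^ M * g | g. sym_poly m g}"
proof (intro equalityI subsetI)
  fix f assume "f \<in> annihilator m"
  then have "f \<in> fvs.span (range (generator M m))"
    using annihilator_subset_span by blast
  then have "\<exists>g. sign_poly 0 m g \<and> f = vandermonde m ^ M * g"
  proof (induction rule: fvs.span_induct_alt)
    case base
    show ?case by (intro exI[of _ 0]) (simp add: sign_poly_zero)
  next
    case (step c x y)
    then obtain \<kappa> g where "x = generator M m \<kappa>" "sign_poly 0 m g" "y = vandermonde m ^ M * g"
      by auto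
    then show ?case
      by (intro exI[of _ "scl c (psum_prod m \<kappa>) + g"])
        (simp add: generator_def distrib_left scl_mult_right mult.commute sign_poly_add sign_poly_scl
          sign_poly_0[of m "psum_prod m \<kappa>"] sym_poly_psum_prod)
  qed
  then show "f \<in> {vandermonde m ^ M * g | g. sym_poly m g}"
    by (auto simp: sign_poly_0)
next
  fix f assume "f \<in> {vandermonde m ^ M * g | g. sym_poly m g}"
  then obtain g where g: "sym_poly m g" and f: "f = vandermonde m ^ M * g"
    by blast
  have "sign_poly M m f"
    unfolding f using sign_poly_mult[OF sign_poly_power[OF sign_poly_vandermonde, of M m], of 0 g] g
    by (simp add: sign_poly_0)
  moreover have "pair f P = 0" if P: "P \<in> charge_part m" "ev P = 0" for P
  proof -
    have "g \<in> fvs.span (range (psum_prod m))"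
      using sym_poly_in_psum_span[OF g] by (simp add: psum_span_def)
    then have "pair (vandermonde m ^ M * g) P = 0"
    proof (induction rule: fvs.span_induct_alt)
      case (step c x y)
      then obtain \<kappa> where x: "x = psum_prod m \<kappa>" by auto
      have "pair (vandermonde m ^ M * x) P = 0"
        using P ev_eq_0_iff by (simp add: x generator_def mult.commute)
      with step show ?case
        by (simp add: distrib_left scl_mult_right pair_add_left pair_scl_left)
    qed (simp add: pair_zero_left)
    then show ?thesis by (simp add: f)
  qed
  ultimately show "f \<in> annihilator m"
    by (simp add: annihilator_def)
qed

text \<open>A word with a negative exponent has only zero matrix coefficients, since the generators
  are polynomials; any other word has those of \<open>ev\<close> of its expansion \<open>wd\<close>.
  Hence arbitrary modes in arbitrary order give nothing beyond the chosen monomials.\<close>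

lemma foldr_vertex_in_range: "foldr (vertex_coeff M 1) ns vac \<in> range ev"
proof -
  define m where "m = length ns"
  obtain c where c: "\<forall>ns \<kappa>. length ns = m \<longrightarrow>
        lookup (foldr (vertex_coeff M 1) ns vac) (int m, \<kappa>) = c \<kappa> * lookup (generator M m \<kappa>) (word_exp ns)"
      "\<forall>P\<in>charge_part m. \<forall>\<kappa>. lookup (ev P) (int m, \<kappa>) = c \<kappa> * pair (generator M m \<kappa>) P"
    using lookup_ev[of m] by blast
  define P where "P = (if \<forall>n\<in>set ns. 0 \<le> n then wd (map nat ns) else 0)"
  have P: "P \<in> charge_part m"
    by (auto simp: P_def m_def intro!: wd_in_charge_part) (simp add: charge_part_def)
  have pair_P: "pair (generator M m \<kappa>) P = lookup (generator M m \<kappa>) (word_exp ns)" for \<kappa>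
  proof (cases "\<forall>n\<in>set ns. 0 \<le> n")
    case True
    then have "map int (map nat ns) = ns"
      by (simp add: map_idI)
    then show ?thesis
      using True pair_word[of "map nat ns"] sign_poly_generator by (simp add: P_def m_def)
  next
    case False
    then obtain i where "i < m" "ns ! i < 0"
      by (auto simp: in_set_conv_nth m_def)
    then have "\<not> 0 \<le> lookup (word_exp ns) i"
      by (simp add: lookup_word_exp m_def)
    then have "word_exp ns \<notin> keys (generator M m \<kappa>)"
      using sign_poly_generator[of M m \<kappa>] unfolding sign_poly_def is_poly_def by blast
    then have "lookup (generator M m \<kappa>) (word_exp ns) = 0"
      by (simp add: in_keys_iff)
    moreover have "P = 0"
      using False by (auto simp: P_def)
    ultimately show ?thesis
      by (simp add: pair_zero_right)
  qed
  have "foldr (vertex_coeff M 1) ns vac = ev P"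
  proof (rule poly_mapping_eqI)
    fix x :: "int \<times> nat multiset"
    obtain k \<kappa> where x: "x = (k, \<kappa>)" by fastforce
    show "lookup (foldr (vertex_coeff M 1) ns vac) x = lookup (ev P) x"
    proof (cases "k = int m")
      case True
      with c P pair_P show ?thesis by (simp add: x m_def)
    next
      case False
      with lookup_ev_charge[OF P] lookup_foldr_vertex_charge show ?thesis
        by (simp add: x m_def)
    qed
  qed
  then show ?thesis by blast
qed

text \<open>The passage n to - n - s between mode numbers and exponents of z is an involution of the
  integers, so both indexings produce the same words.\<close>

lemma principal_subspace_eq_range:
  assumes "\<And>n. Y n = vertex_coeff M 1 (- n - s)"
  shows "principal_subspace Y = range ev"
proof (intro equalityI subsetI)
  have "Y = (\<lambda>n. vertex_coeff M 1 (- n - s))"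
    using assms by blast
  then have Y: "foldr Y ns vac = foldr (vertex_coeff M 1) (map (\<lambda>n. - n - s) ns) vac" for ns
    by (simp add: foldr_map comp_def)
  have "fvs.subspace (range ev)"
  proof (rule fvs.subspaceI)
    show "0 \<in> range ev"
      using lin_zero[OF lin_ev] by (metis rangeI)
    show "u + v \<in> range ev" if uv: "u \<in> range ev" "v \<in> range ev" for u v
    proof -
      obtain P Q where "u = ev P" "v = ev Q" using uv by blast
      then have "u + v = ev (P + Q)" by (simp add: lin_add[OF lin_ev])
      then show ?thesis by simp
    qed
    show "scl c u \<in> range ev" if u: "u \<in> range ev" for c u
    proof -
      obtain P where "u = ev P" using u by blast
      then have "scl c u = ev (scl c P)" by (simp add: lin_scl[OF lin_ev])
      then show ?thesis by simp
    qed
  qed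
  moreover have "{foldr Y ns vac | ns. True} \<subseteq> range ev"
    using foldr_vertex_in_range by (auto simp only: Y)
  ultimately show "w \<in> range ev" if "w \<in> principal_subspace Y" for w
    using that fvs.span_minimal unfolding principal_subspace_def by blast
  show "w \<in> principal_subspace Y" if w: "w \<in> range ev" for w
  proof -
    have "foldr (vertex_coeff M 1) ns vac = foldr Y (map (\<lambda>n. - n - s) ns) vac" for ns
      by (simp add: Y comp_def)
    then have "foldr (vertex_coeff M 1) ns vac \<in> principal_subspace Y" for ns
      unfolding principal_subspace_def by (intro fvs.span_base) blast
    then have "ev P \<in> principal_subspace Y" for P
      unfolding ev_def linext_def principal_subspace_def by (intro fvs.span_sum fvs.span_scale)
    with w show ?thesis by blast
  qed
qed

subsection \<open>The restricted dual\<close>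

definition proj :: "nat \<Rightarrow> ('b \<Rightarrow>\<^sub>0 complex) \<Rightarrow> ('b \<Rightarrow>\<^sub>0 complex)" where
  "proj m = linext (\<lambda>x. if length (srt x) = m then single x 1 else 0)"

lemma lin_proj: "lin (proj m)"
  by (simp add: proj_def lin_linext)

lemma lookup_proj: "lookup (proj m P) x = (if length (srt x) = m then lookup P x else 0)"
proof (induction P rule: fvs_induct)
  case (single y c)
  show ?case by (auto simp: proj_def lookup_single when_def)
qed (simp_all add: lin_zero[OF lin_proj] lin_add[OF lin_proj] lookup_add)

lemma proj_in_charge_part: "proj m P \<in> charge_part m"
  by (auto simp: charge_part_def in_keys_iff lookup_proj split: if_splits)

lemma proj_charge_part: "P \<in> charge_part m' \<Longrightarrow> proj m P = (if m' = m then P else 0)"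
  by (rule poly_mapping_eqI) (auto simp: charge_part_def lookup_proj in_keys_iff)

text \<open>\<open>ev\<close> respects the charge, so its kernel is graded and a relation may be cut
  down to its part of charge m.\<close>

lemma ev_proj:
  assumes "ev P = 0"
  shows "ev (proj m P) = 0"
proof -
  have *: "lookup (ev (proj m P)) (int m, \<kappa>) = lookup (ev P) (int m, \<kappa>)" for P \<kappa>
  proof (induction P rule: fvs_induct)
    case (single x c)
    have x: "single x c \<in> charge_part (length (srt x))"
      by (simp add: charge_part_def)
    show ?case
      using lookup_ev_charge[OF x, of "int m"] by (auto simp: proj_charge_part[OF x] lin_zero[OF lin_ev])
  qed (simp_all add: lin_zero[OF lin_ev] lin_zero[OF lin_proj] lin_add[OF lin_ev] lin_add[OF lin_proj] lookup_add)
  show ?thesis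
  proof (rule poly_mapping_eqI)
    fix x :: "int \<times> nat multiset"
    obtain k \<kappa> where x: "x = (k, \<kappa>)" by fastforce
    show "lookup (ev (proj m P)) x = lookup 0 x"
      using * assms lookup_ev_charge[OF proj_in_charge_part] by (cases "k = int m") (auto simp: x)
  qed
qed

text \<open>The value is computed from a chosen preimage; the value 0 off the range follows the
  convention of \<open>functionals\<close>.\<close>

definition functional :: "nat \<Rightarrow> laurent \<Rightarrow> fock \<Rightarrow> complex" where
  "functional m f w = (if w \<in> range ev then pair f (proj m (SOME P. ev P = w)) else 0)"

text \<open>Two preimages differ by a relation, whose charge m part is again a relation and pairs to
  zero with f.\<close>

lemma functional_ev:
  assumes "f \<in> annihilator m"
  shows "functional m f (ev P) = pair f (proj m P)"
proof -
  define P' where "P' = (SOME P'. ev P' = ev P)"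
  have "ev P' = ev P"
    unfolding P'_def by (rule someI) simp
  then have "ev (proj m (P - P')) = 0"
    by (intro ev_proj) (simp add: lin_minus[OF lin_ev])
  then have "pair f (proj m (P - P')) = 0"
    using assms proj_in_charge_part by (simp add: annihilator_def)
  then show ?thesis
    by (simp add: functional_def lin_minus[OF lin_proj] pair_minus_right flip: P'_def)
qed

text \<open>Nondegeneracy on the side of forms: each coefficient of f is its pairing with the word
  of that exponent.\<close>

lemma sign_poly_eqI:
  assumes "sign_poly M m f" "sign_poly M m g" "\<And>P. P \<in> charge_part m \<Longrightarrow> pair f P = pair g P"
  shows "f = g"
proof (rule poly_mapping_eqI)
  fix \<alpha>
  show "lookup f \<alpha> = lookup g \<alpha>"
  proof (cases "keys \<alpha> \<subseteq> {..<m} \<and> (\<forall>i. 0 \<le> lookup \<alpha> i)")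
    case True
    then have "word_exp (map int (exp_word m \<alpha>)) = \<alpha>"
      by (intro word_exp_exp_word) auto
    then show ?thesis
      using assms(3)[OF wd_in_charge_part[OF length_exp_word]] assms(1,2)
        pair_word[of "exp_word m \<alpha>" f] pair_word[of "exp_word m \<alpha>" g]
      by (simp add: length_exp_word)
  next
    case False
    with assms(1,2) have "\<alpha> \<notin> keys f" "\<alpha> \<notin> keys g"
      unfolding sign_poly_def is_poly_def by blast+
    then show ?thesis by (simp add: in_keys_iff)
  qed
qed

text \<open>The signed orbit sum of a monomial: a multiple of a monomial symmetric function for even
  M, an alternant for odd M.\<close>

definition orbit_poly :: "'b \<Rightarrow> laurent" where
  "orbit_poly x = (\<Sum>\<pi> | \<pi> permutes {..<length (srt x)}.
    single (Poly_Mapping.map_key \<pi> (word_exp (map int (srt x)))) (of_int (sign \<pi>) ^ M))"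

lemma sign_poly_orbit_poly: "sign_poly M (length (srt x)) (orbit_poly x)"
proof -
  let ?m = "length (srt x)" and ?\<alpha> = "word_exp (map int (srt x))"
  have keys: "keys ?\<alpha> \<subseteq> {..<?m}"
    using keys_word_exp[of "map int (srt x)"] by simp
  show ?thesis
    unfolding sign_poly_perm_act
  proof (intro conjI allI impI)
    show "is_poly ?m (orbit_poly x)"
      unfolding orbit_poly_def
    proof (rule is_poly_sum)
      fix \<pi> assume "\<pi> \<in> {\<pi>. \<pi> permutes {..<?m}}"
      then have \<pi>: "\<pi> permutes {..<?m}" by simp
      show "is_poly ?m (single (Poly_Mapping.map_key \<pi> ?\<alpha>) (of_int (sign \<pi>) ^ M))"
        using keys_map_key_subset[OF \<pi> keys]
        by (auto simp: is_poly_def lookup_map_key[OF \<pi>] lookup_word_exp)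
    qed
    fix \<sigma> assume \<sigma>: "\<sigma> permutes {..<?m}"
    have "scl (of_int (sign \<sigma>) ^ M) (orbit_poly x) =
        (\<Sum>\<pi> | \<pi> permutes {..<?m}. single (Poly_Mapping.map_key (\<pi> \<circ> \<sigma>) ?\<alpha>) (of_int (sign \<sigma>) ^ M * of_int (sign (\<pi> \<circ> \<sigma>)) ^ M))"
      unfolding orbit_poly_def fvs.scale_sum_right scl_single by (rule sum_permutations_compose_right[OF \<sigma>])
    also have "\<dots> = (\<Sum>\<pi> | \<pi> permutes {..<?m}. perm_act \<sigma> (single (Poly_Mapping.map_key \<pi> ?\<alpha>) (of_int (sign \<pi>) ^ M)))"
    proof (rule sum.cong[OF refl])
      fix \<pi> assume "\<pi> \<in> {\<pi>. \<pi> permutes {..<?m}}"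
      then have \<pi>: "\<pi> permutes {..<?m}" by simp
      have "sign (\<pi> \<circ> \<sigma>) = sign \<pi> * sign \<sigma>"
        using \<pi> \<sigma> by (intro sign_compose) (auto intro: permutes_imp_permutation)
      then have "of_int (sign \<sigma>) ^ M * of_int (sign (\<pi> \<circ> \<sigma>)) ^ M = (of_int (sign \<pi>) ^ M :: complex)"
        using sign_mult_self[of \<sigma> M] by (simp add: power_mult_distrib mult.left_commute)
      then show "single (Poly_Mapping.map_key (\<pi> \<circ> \<sigma>) ?\<alpha>) (of_int (sign \<sigma>) ^ M * of_int (sign (\<pi> \<circ> \<sigma>)) ^ M) =
          perm_act \<sigma> (single (Poly_Mapping.map_key \<pi> ?\<alpha>) (of_int (sign \<pi>) ^ M))"
        by (simp add: perm_act_def map_key_permutes_compose[OF \<pi> \<sigma>])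
    qed
    finally show "perm_act \<sigma> (orbit_poly x) = scl (of_int (sign \<sigma>) ^ M) (orbit_poly x)"
      by (simp add: orbit_poly_def lin_sum[OF lin_perm_act])
  qed
qed

text \<open>The sign is trivial on the stabilizer of the word, so nothing cancels and the
  coefficient is the order of the stabilizer. A different x has a different sorted word, hence lies
  in another orbit.\<close>

lemma lookup_orbit_poly:
  "\<exists>n. n \<noteq> 0 \<and> (\<forall>y. length (srt y) = length (srt x) \<longrightarrow>
    lookup (orbit_poly x) (word_exp (map int (srt y))) = (if y = x then n else 0))"
proof -
  let ?m = "length (srt x)" and ?\<alpha> = "word_exp (map int (srt x))"
  let ?S = "{\<pi>. \<pi> permutes {..<?m} \<and> Poly_Mapping.map_key \<pi> ?\<alpha> = ?\<alpha>}"
  have fin: "finite {\<pi>. \<pi> permutes {..<?m}}"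
    by (rule finite_permutations) simp
  have eq: "y = x" if len: "length (srt y) = ?m" and \<pi>: "\<pi> permutes {..<?m}"
    and *: "Poly_Mapping.map_key \<pi> ?\<alpha> = word_exp (map int (srt y))" for y \<pi>
  proof (rule srt_inject)
    have "permute_list \<pi> (srt x) = srt y"
    proof (rule nth_equalityI)
      fix i assume "i < length (permute_list \<pi> (srt x))"
      then have i: "i < ?m" by simp
      then have "\<pi> i < ?m" using permutes_in_image[OF \<pi>, of i] by simp
      then show "permute_list \<pi> (srt x) ! i = srt y ! i"
        using arg_cong[OF *, of "\<lambda>\<alpha>. lookup \<alpha> i"] i len
        by (simp add: lookup_map_key[OF \<pi>] lookup_word_exp permute_list_nth[OF \<pi>])
    qed (simp add: len)
    then have "mset (srt y) = mset (srt x)"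
      using mset_permute_list[OF \<pi>] by metis
    then show "srt y = srt x"
      using sorted_srt by (metis properties_for_sort)
  qed
  have "lookup (orbit_poly x) ?\<alpha> = (\<Sum>\<pi>\<in>?S. 1)"
    unfolding orbit_poly_def lookup_sum lookup_single
    by (rule sum.mono_neutral_cong_right[OF fin]) (auto simp: when_def stabilizer)
  then have x: "lookup (orbit_poly x) ?\<alpha> = of_nat (card ?S)" by simp
  have "id \<in> ?S"
    by (simp add: id_def map_key_id permutes_id[unfolded id_def])
  moreover have "finite ?S"
    by (rule finite_subset[OF _ fin]) auto
  ultimately have "card ?S \<noteq> 0"
    using card_0_eq by blast
  moreover have "lookup (orbit_poly x) (word_exp (map int (srt y))) = 0" if "length (srt y) = ?m" "y \<noteq> x" for y
    unfolding orbit_poly_def lookup_sum lookup_single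
    by (rule sum.neutral) (use eq that in \<open>auto simp: when_def\<close>)
  ultimately show ?thesis
    using x by (intro exI[of _ "of_nat (card ?S)"]) auto
qed

lemma dual_basis:
  assumes "finite T" "\<And>x. x \<in> T \<Longrightarrow> length (srt x) = m"
  shows "\<exists>f. sign_poly M m f \<and>
    (\<forall>y. length (srt y) = m \<longrightarrow> lookup f (word_exp (map int (srt y))) = (if y \<in> T then c y else 0))"
proof -
  obtain n where n: "\<And>x. n x \<noteq> 0 \<and> (\<forall>y. length (srt y) = length (srt x) \<longrightarrow>
      lookup (orbit_poly x) (word_exp (map int (srt y))) = (if y = x then n x else 0))"
    using lookup_orbit_poly by metis
  \<comment> \<open>Division by the diagonal value n turns the orbit sums into a dual basis.\<close>
  define f where "f = (\<Sum>x\<in>T. scl (c x / n x) (orbit_poly x))"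
  have "sign_poly M m f"
    unfolding f_def using sign_poly_orbit_poly assms(2) by (intro sign_poly_sum sign_poly_scl) metis
  moreover have "lookup f (word_exp (map int (srt y))) = (if y \<in> T then c y else 0)" if "length (srt y) = m" for y
  proof -
    have "lookup f (word_exp (map int (srt y))) = (\<Sum>x\<in>T. c x / n x * (if y = x then n x else 0))"
      using n assms(2) that by (simp add: f_def lookup_sum cong: sum.cong)
    also have "\<dots> = (\<Sum>x\<in>T. if y = x then c x else 0)"
      by (intro sum.cong refl) (use n in auto)
    finally show ?thesis using assms(1) by simp
  qed
  ultimately show ?thesis by blast
qed

text \<open>J is the monomial factor of the forms, and J' recovers f from f J. Bounding each index
  by \<open>dg\<close> leaves finitely many monomials per degree, so a functional in the restricted
  dual is nonzero on only finitely many monomials of charge m.\<close>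

lemma dual_iso_annihilator:
  fixes dg :: "'b \<Rightarrow> int"
  assumes dg: "\<And>x k. k \<in> set (srt x) \<Longrightarrow> int k \<le> dg x"
    and J: "J * J' = 1"
    and pairing: "\<And>f P. P \<in> charge_part m \<Longrightarrow> pairing (f * J) P = pair f P"
  shows "\<exists>\<Phi>. dual_iso ((\<lambda>f. f * J) ` annihilator m)
    (restricted_dual (range ev) (\<lambda>m d. ev ` {P \<in> charge_part m. \<forall>x\<in>keys P. dg x = d}) m)
    pairing ev (charge_part m) \<Phi>"
proof (intro exI)
  let ?A = "(\<lambda>f. f * J) ` annihilator m"
  let ?C = "\<lambda>m d. ev ` {P \<in> charge_part m. \<forall>x\<in>keys P. dg x = d}"
  let ?\<Phi> = "\<lambda>\<omega>. functional m (\<omega> * J')"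
  have cancel: "f * J * J' = f" for f
    by (simp add: J mult.assoc)
  have fin_hom: "finite {x. length (srt x) = m \<and> dg x = d}" for d
  proof (rule finite_imageD)
    show "finite (srt ` {x. length (srt x) = m \<and> dg x = d})"
    proof (rule finite_subset)
      show "srt ` {x. length (srt x) = m \<and> dg x = d} \<subseteq> {ks. set ks \<subseteq> {..nat d} \<and> length ks = m}"
      proof
        fix ks assume "ks \<in> srt ` {x. length (srt x) = m \<and> dg x = d}"
        then obtain x where x: "ks = srt x" "length (srt x) = m" "dg x = d"
          by blast
        have "k \<le> nat d" if "k \<in> set (srt x)" for k
          using dg[OF that] x(3) by linarith
        with x show "ks \<in> {ks. set ks \<subseteq> {..nat d} \<and> length ks = m}"
          by auto
      qed
    qed (simp add: finite_lists_length_eq)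
    show "inj_on srt {x. length (srt x) = m \<and> dg x = d}"
      by (rule inj_onI) (rule srt_inject)
  qed
  have into: "functional m f \<in> restricted_dual (range ev) ?C m" if f: "f \<in> annihilator m" for f
  proof -
    have "functional m f (u + v) = functional m f u + functional m f v"
      if u: "u \<in> range ev" and v: "v \<in> range ev" for u v
    proof -
      obtain P Q where PQ: "u = ev P" "v = ev Q" using u v by blast
      have uv: "u + v = ev (P + Q)" by (simp add: PQ lin_add[OF lin_ev])
      show ?thesis
        unfolding uv unfolding PQ functional_ev[OF f] by (simp add: lin_add[OF lin_proj] pair_add_right)
    qed
    moreover have "functional m f (scl c u) = c * functional m f u" if u: "u \<in> range ev" for c u
    proof -
      obtain P where P: "u = ev P" using u by blast
      have cu: "scl c u = ev (scl c P)" by (simp add: P lin_scl[OF lin_ev])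
      show ?thesis
        unfolding cu unfolding P functional_ev[OF f] by (simp add: lin_scl[OF lin_proj] pair_scl_right)
    qed
    moreover have "functional m f w = 0" if "m' \<noteq> m" "w \<in> ?C m' d" for m' d w
      using that by (auto simp: functional_ev[OF f] proj_charge_part pair_zero_right)
    \<comment> \<open>A degree with a nonzero value requires a monomial whose word is an exponent of
      f, and f has finitely many exponents.\<close>
    moreover have "finite {d. \<exists>w\<in>?C m d. functional m f w \<noteq> 0}"
    proof (rule finite_subset)
      let ?T = "{x. length (srt x) = m \<and> word_exp (map int (srt x)) \<in> keys f}"
      show "finite (dg ` ?T)"
      proof (rule finite_imageI, rule finite_imageD)
        show "finite ((\<lambda>x. word_exp (map int (srt x))) ` ?T)"
          by (rule finite_subset[OF _ finite_keys[of f]]) auto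
        show "inj_on (\<lambda>x. word_exp (map int (srt x))) ?T"
        proof (rule inj_onI)
          fix x y assume "x \<in> ?T" "y \<in> ?T" and "word_exp (map int (srt x)) = word_exp (map int (srt y))"
          then have "map int (srt x) = map int (srt y)"
            by (simp add: word_exp_eq_iff)
          then show "x = y"
            by (intro srt_inject) (simp add: inj_map_eq_map)
        qed
      qed
      show "{d. \<exists>w\<in>?C m d. functional m f w \<noteq> 0} \<subseteq> dg ` ?T"
      proof clarify
        fix d P assume P: "P \<in> charge_part m" "\<forall>x\<in>keys P. dg x = d" and "functional m f (ev P) \<noteq> 0"
        then have "pair f P \<noteq> 0"
          by (simp add: functional_ev[OF f] proj_charge_part)
        then obtain x where x: "x \<in> keys P" "lookup f (word_exp (map int (srt x))) \<noteq> 0"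
          unfolding pair_def by (metis (no_types, lifting) mult_zero_right sum.neutral)
        with P have "d = dg x" "length (srt x) = m"
          by (simp_all add: charge_part_def)
        with x(2) show "d \<in> dg ` ?T"
          by (intro image_eqI) (simp_all add: in_keys_iff)
      qed
    qed
    moreover have "functional m f w = 0" if "w \<notin> range ev" for w
      using that by (simp add: functional_def)
    ultimately show ?thesis
      unfolding restricted_dual_def functionals_def by blast
  qed
  have inj: "f = g" if f: "f \<in> annihilator m" and g: "g \<in> annihilator m"
    and "functional m f = functional m g" for f g
  proof (rule sign_poly_eqI[of m])
    show "pair f P = pair g P" if "P \<in> charge_part m" for P
      using functional_ev[OF f, of P] functional_ev[OF g, of P] \<open>functional m f = functional m g\<close> that
      by (simp add: proj_charge_part)
  qed (use f g in \<open>auto simp: annihilator_def\<close>)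
  have onto: "\<exists>f\<in>annihilator m. functional m f = l" if l: "l \<in> restricted_dual (range ev) ?C m" for l
  proof -
    have l_add: "l (ev P + ev Q) = l (ev P) + l (ev Q)" and l_scl: "l (scl c (ev P)) = c * l (ev P)"
      and l_out: "w \<notin> range ev \<Longrightarrow> l w = 0" for P Q c w
      using l by (auto simp: restricted_dual_def functionals_def)
    have l_charge: "l w = 0" if "m' \<noteq> m" "w \<in> ?C m' d" for m' d w
      using l that unfolding restricted_dual_def by blast
    have l_0: "l 0 = 0"
      using l_scl[of 0 0] by (simp add: lin_zero[OF lin_ev])
    have single_hom: "ev (single x 1) \<in> ?C (length (srt x)) (dg x)" for x
      by (rule imageI) (simp add: charge_part_def)
    let ?c = "\<lambda>x. l (ev (single x 1))"
    define T where "T = {x. length (srt x) = m \<and> ?c x \<noteq> 0}"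
    let ?D = "{d. \<exists>w\<in>?C m d. l w \<noteq> 0}"
    have "T \<subseteq> (\<Union>d\<in>?D. {x. length (srt x) = m \<and> dg x = d})"
    proof
      fix x assume "x \<in> T"
      then have "length (srt x) = m" "?c x \<noteq> 0" by (auto simp: T_def)
      then have "dg x \<in> ?D"
        using single_hom[of x] by blast
      with \<open>length (srt x) = m\<close> show "x \<in> (\<Union>d\<in>?D. {x. length (srt x) = m \<and> dg x = d})"
        by blast
    qed
    moreover have "finite ?D" using l by (simp add: restricted_dual_def)
    ultimately have "finite T"
      using fin_hom by (meson finite_UN_I finite_subset)
    then obtain f where f: "sign_poly M m f"
        and f_eq: "\<And>y. length (srt y) = m \<Longrightarrow> lookup f (word_exp (map int (srt y))) = (if y \<in> T then ?c y else 0)"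
      using dual_basis[of T m ?c] unfolding T_def by blast
    have f_l: "pair f (proj m P) = l (ev P)" for P
    proof (induction P rule: fvs_induct)
      case (single x c)
      have x: "single x c \<in> charge_part (length (srt x))"
        by (simp add: charge_part_def)
      have "ev (single x c) = scl c (ev (single x 1))"
        by (simp flip: lin_scl[OF lin_ev])
      then have lx: "l (ev (single x c)) = c * ?c x"
        by (simp add: l_scl)
      show ?case
      proof (cases "length (srt x) = m")
        case True
        then show ?thesis
          by (simp add: proj_charge_part[OF x] pair_single f_eq lx T_def)
      next
        case False
        then show ?thesis
          using l_charge[OF False single_hom] by (simp add: proj_charge_part[OF x] pair_zero_right lx)
      qed
    qed (simp_all add: lin_zero[OF lin_proj] lin_zero[OF lin_ev] pair_zero_right l_0
        lin_add[OF lin_proj] lin_add[OF lin_ev] pair_add_right l_add)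
    \<comment> \<open>By \<open>f_l\<close> the pairing with f factors through \<open>ev\<close>, so
      it vanishes on relations.\<close>
    have ann: "f \<in> annihilator m"
      unfolding annihilator_def
    proof (intro CollectI conjI ballI impI f)
      show "pair f P = 0" if "P \<in> charge_part m" "ev P = 0" for P
        using f_l[of P] l_0 that by (simp add: proj_charge_part)
    qed
    have "functional m f = l"
    proof
      show "functional m f w = l w" for w
      proof (cases "w \<in> range ev")
        case True
        then obtain P where "w = ev P" by blast
        then show ?thesis by (simp add: functional_ev[OF ann] f_l)
      qed (simp add: functional_def l_out)
    qed
    with ann show ?thesis by blast
  qed
  have bij: "bij_betw ?\<Phi> ?A (restricted_dual (range ev) ?C m)"
    unfolding bij_betw_def
  proof
    show "inj_on ?\<Phi> ?A"
    proof (rule inj_onI, elim imageE)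
      fix \<omega> \<eta> f g assume "?\<Phi> \<omega> = ?\<Phi> \<eta>" and "\<omega> = f * J" "f \<in> annihilator m" "\<eta> = g * J" "g \<in> annihilator m"
      then show "\<omega> = \<eta>"
        using inj[of f g] by (simp only: cancel)
    qed
    have "?\<Phi> ` ?A = functional m ` annihilator m"
      by (simp only: image_image cancel)
    also have "\<dots> = restricted_dual (range ev) ?C m"
    proof (intro equalityI subsetI)
      fix l assume "l \<in> restricted_dual (range ev) ?C m"
      from onto[OF this] obtain f where "f \<in> annihilator m" "functional m f = l" ..
      then show "l \<in> functional m ` annihilator m" by (intro image_eqI) simp_all
    qed (elim imageE, simp only: into)
    finally show "?\<Phi> ` ?A = restricted_dual (range ev) ?C m" .
  qed
  show "dual_iso ?A (restricted_dual (range ev) ?C m) pairing ev (charge_part m) ?\<Phi>"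
    unfolding dual_iso_def
  proof (intro conjI ballI allI)
    show "?\<Phi> (\<omega> + \<eta>) w = ?\<Phi> \<omega> w + ?\<Phi> \<eta> w" for \<omega> \<eta> w
      by (simp add: functional_def distrib_right pair_add_left)
    show "?\<Phi> (scl c \<omega>) w = c * ?\<Phi> \<omega> w" for c \<omega> w
      by (simp add: functional_def scl_mult_left pair_scl_left)
    fix \<omega> P assume "\<omega> \<in> ?A" and P: "P \<in> charge_part m"
    then obtain f where "f \<in> annihilator m" "\<omega> = f * J" by blast
    then show "?\<Phi> \<omega> (ev P) = pairing \<omega> P"
      using P by (simp add: cancel functional_ev proj_charge_part pairing)
  qed (rule bij)
qed

end

section \<open>Commuting and anticommuting modes\<close>

text \<open>The residue extracts the exponent -1; in each variable the mode contributes n and the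
  form c, so f has to supply -1 - n - c.\<close>

lemma res_modes_form:
  assumes "length ns = m"
  shows "res_modes (f * single (\<Sum>i<m. single i c) 1) ns = lookup f (word_exp (map (\<lambda>n. -1 - n - c) ns))"
proof -
  have "(\<Sum>i<m. single i (-1 - ns ! i)) - (\<Sum>i<m. single i c) = word_exp (map (\<lambda>n. -1 - n - c) ns)"
    by (rule poly_mapping_eqI) (simp add: lookup_minus lookup_sum_single lookup_word_exp assms)
  then show ?thesis
    by (simp add: res_modes_eq assms lookup_times_monomial)
qed

text \<open>An even power of the sign is 1, which settles the stabilizers, and coefficients of
  symmetric polynomials do not change when a word is sorted.\<close>

lemma mode_polynomials_commuting:
  assumes "N \<ge> 1"
  shows "mode_polynomials (2 * N) sorted_list_of_multiset (\<lambda>ks. single (mset ks) 1)"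
proof
  fix ks :: "nat list" and f assume f: "sign_poly (2 * N) (length ks) f"
  define \<pi> where "\<pi> = (SOME \<pi>. \<pi> permutes {..<length ks} \<and> permute_list \<pi> ks = sort ks)"
  have "\<exists>\<pi>. \<pi> permutes {..<length ks} \<and> permute_list \<pi> ks = sort ks"
    using mset_eq_permutation[of "sort ks" ks] by fastforce
  then have \<pi>: "\<pi> permutes {..<length ks}" "permute_list \<pi> ks = sort ks"
    unfolding \<pi>_def by (metis (mono_tags, lifting) someI_ex)+
  have "word_exp (map int (sort ks)) = Poly_Mapping.map_key \<pi> (word_exp (map int ks))"
  proof (rule poly_mapping_eqI)
    fix i
    show "lookup (word_exp (map int (sort ks))) i = lookup (Poly_Mapping.map_key \<pi> (word_exp (map int ks))) i"
      using permutes_in_image[OF \<pi>(1), of i]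
      by (simp add: lookup_map_key[OF \<pi>(1)] lookup_word_exp permute_list_nth[OF \<pi>(1)] flip: \<pi>(2))
  qed
  with f \<pi>(1) have "lookup f (word_exp (map int (sort ks))) = lookup f (word_exp (map int ks))"
    by (simp add: sign_poly_even sym_poly_def)
  then show "(\<Sum>x\<in>keys (single (mset ks) (1::complex)). lookup (single (mset ks) (1::complex)) x *
      lookup f (word_exp (map int (sorted_list_of_multiset x)))) = lookup f (word_exp (map int ks))"
    by (simp add: sorted_list_of_multiset_mset)
next
  show "x = y" if "sorted_list_of_multiset x = sorted_list_of_multiset y" for x y :: "nat multiset"
    using that by (metis mset_sorted_list_of_multiset)
next
  fix x :: "nat multiset" and ks assume "x \<in> keys (single (mset ks) (1::complex))"
  then show "length (sorted_list_of_multiset x) = length ks"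
    by (simp add: sorted_list_of_multiset_mset)
qed (use assms in \<open>simp_all add: sign_def power_mult\<close>)

lemma keys_theta_word: "S \<in> keys (theta_word ks) \<Longrightarrow> fcard S = length ks"
proof -
  have "theta_word ks = 0 \<or> (\<exists>S c. theta_word ks = single S c \<and> fcard S = length ks)"
  proof (induction ks)
    case Nil
    show ?case
      by (intro disjI2 exI[of _ "{||}"] exI[of _ 1]) (simp add: theta_word_def)
  next
    case (Cons k ks)
    have w: "theta_word (k # ks) = theta_mult k (theta_word ks)"
      by (simp add: theta_word_def)
    from Cons show ?case
    proof (elim disjE exE conjE)
      fix S c assume S: "theta_word ks = single S c" "fcard S = length ks"
      show ?thesis
      proof (cases "k |\<in>| S")
        case False
        then have "fcard (finsert k S) = length (k # ks)"
          by (simp add: S(2) fcard_finsert_disjoint)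
        with False show ?thesis
          unfolding w S(1) theta_mult_single by auto
      qed (simp add: w S(1) theta_mult_single)
    qed (simp add: w theta_mult_def)
  qed
  then show "S \<in> keys (theta_word ks) \<Longrightarrow> fcard S = length ks"
    by (auto split: if_splits)
qed

lemma length_sorted_list_of_fset: "length (sorted_list_of_fset S) = fcard S"
  by (simp add: sorted_list_of_fset.rep_eq fcard.rep_eq)

text \<open>A monomial has distinct factors, so its word has trivial stabilizer. The signs of
  reordering come from \<open>theta_pairing_word\<close>, applied to the form built from f.\<close>

lemma mode_polynomials_anticommuting:
  "mode_polynomials (2 * N + 1) sorted_list_of_fset theta_word"
proof
  fix ks :: "nat list" and f assume f: "sign_poly (2 * N + 1) (length ks) f"
  let ?\<omega> = "f * (\<Prod>i<length ks. zpow i (-1))"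
  have "?\<omega> \<in> odd_forms (length ks)"
    using f unfolding sign_poly_odd odd_forms_def by blast
  then have "theta_pairing ?\<omega> (theta_word ks) = res_modes ?\<omega> (map theta_index ks)"
    by (rule theta_pairing_word)
  then show "(\<Sum>S\<in>keys (theta_word ks). lookup (theta_word ks) S * lookup f (word_exp (map int (sorted_list_of_fset S)))) =
      lookup f (word_exp (map int ks))"
    by (simp add: theta_pairing_def prod_zpow res_modes_form length_sorted_list_of_fset keys_theta_word
        comp_def theta_index_def cong: sum.cong)
next
  fix \<pi> and S :: "nat fset"
  let ?ks = "sorted_list_of_fset S"
  assume \<pi>: "\<pi> permutes {..<length ?ks}"
    and *: "Poly_Mapping.map_key \<pi> (word_exp (map int ?ks)) = word_exp (map int ?ks)"
  have "\<pi> i = i" for i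
  proof (cases "i < length ?ks")
    case True
    then have "\<pi> i < length ?ks"
      using permutes_in_image[OF \<pi>, of i] by simp
    moreover have "distinct ?ks"
      by (simp add: sorted_list_of_fset.rep_eq)
    ultimately show ?thesis
      using arg_cong[OF *, of "\<lambda>\<alpha>. lookup \<alpha> i"] True
      by (simp add: lookup_map_key[OF \<pi>] lookup_word_exp nth_eq_iff_index_eq)
  qed (use permutes_not_in[OF \<pi>] in auto)
  then have "\<pi> = id" by auto
  then show "of_int (sign \<pi>) ^ (2 * N + 1) = (1 :: complex)"
    by (simp add: sign_id)
next
  show "S = T" if "sorted_list_of_fset S = sorted_list_of_fset T" for S T :: "nat fset"
    using that by (metis sorted_list_of_fset_simps(1) fset_inject sorted_list_of_fset.rep_eq set_sorted_list_of_set finite_fset)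
qed (simp_all add: sorted_list_of_fset.rep_eq[of _, symmetric] length_sorted_list_of_fset keys_theta_word,
    simp_all add: sorted_list_of_fset.rep_eq)

section \<open>The even and the odd lattice\<close>

lemma e_mode_index: "e_mode N (e_index N k) = vertex_coeff (2 * N) 1 (int k)"
  by (simp add: e_mode_def e_index_def)

lemma theta_mode_index: "theta_mode N (theta_index k) = vertex_coeff (2 * N + 1) 1 (int k)"
  by (simp add: theta_mode_def theta_index_def)

lemma W0_even_dual_iso:
  assumes N: "N \<ge> 1"
  shows "(\<exists>\<Phi>. dual_iso (e_annihilator N m) (W0_even_dual N m) (e_pairing N) (e_eval N) (V_charge m) \<Phi>) \<and>
    e_annihilator N m = {vandermonde m ^ (2 * N) * f * (\<Prod>i<m. zpow i 1) ^ (N - 1) | f. sym_poly m f}"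
proof
  interpret mode_polynomials "2 * N" sorted_list_of_multiset "\<lambda>ks. single (mset ks) (1::complex)"
    by (rule mode_polynomials_commuting[OF N])
  let ?J = "(\<Prod>i<m. zpow i 1) ^ (N - 1)" and ?J' = "single (\<Sum>i<m. single i (- int (N - 1))) 1 :: laurent"
  have J: "?J = single (\<Sum>i<m. single i (int (N - 1))) 1"
    by (rule prod_zpow_power)
  have inverse: "?J * ?J' = 1"
    unfolding J by (simp add: mult_single flip: sum.distrib single_add)
  have length: "length (sorted_list_of_multiset \<kappa>) = size \<kappa>" for \<kappa> :: "nat multiset"
    by (metis mset_sorted_list_of_multiset size_mset)
  have ev: "e_eval N = ev"
    by (simp add: e_eval_def ev_def foldr_map comp_def e_mode_index)
  have charge: "V_charge m = charge_part m" for m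
    by (simp add: V_charge_def charge_part_def length)
  have pairing: "e_pairing N (f * ?J) P = pair f P" if "P \<in> charge_part m" for f P
  proof -
    \<comment> \<open>-1 - (-N - k) - (N - 1) = k, where N \<ge> 1 makes the natural subtraction
      exact.\<close>
    have "-1 - e_index N k - int (N - 1) = int k" for k
      using N by (simp add: e_index_def)
    then have "res_modes (f * ?J) (map (e_index N) (sorted_list_of_multiset \<kappa>)) =
        lookup f (word_exp (map int (sorted_list_of_multiset \<kappa>)))" if "\<kappa> \<in> keys P" for \<kappa>
      using that \<open>P \<in> charge_part m\<close> unfolding J
      by (subst res_modes_form) (simp_all add: charge_part_def comp_def)
    then show ?thesis
      by (simp add: e_pairing_def pair_def cong: sum.cong)
  qed
  have ann: "e_annihilator N m = (\<lambda>f. f * ?J) ` annihilator m"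
  proof -
    have "even_forms N m = (\<lambda>f. f * ?J) ` {f. sign_poly (2 * N) m f}"
      unfolding even_forms_def sign_poly_even mult.commute[of ?J] by blast
    then show ?thesis
      unfolding e_annihilator_def annihilator_def I_even_def charge ev
      using pairing by (auto simp: Int_def)
  qed
  have dual: "W0_even_dual N m =
      restricted_dual (range ev) (\<lambda>m d. ev ` {P \<in> charge_part m. \<forall>\<kappa>\<in>keys P. (\<Sum>k\<in>#\<kappa>. - e_index N k) = d}) m"
  proof -
    have "W0_even N = range ev"
      unfolding W0_even_def by (rule principal_subspace_eq_range[of _ "int N"]) (simp add: e_mode_def)
    then show ?thesis
      by (simp add: W0_even_dual_def V_hom_def charge ev)
  qed
  \<comment> \<open>Every factor has degree N + k \<ge> 0, so a single index is bounded by the total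
    degree.\<close>
  have deg: "int k \<le> (\<Sum>k\<in>#\<kappa>. - e_index N k)" if "k \<in> set (sorted_list_of_multiset \<kappa>)" for k and \<kappa> :: "nat multiset"
  proof -
    have "k \<in># \<kappa>" using that by simp
    then obtain \<kappa>' where "\<kappa> = add_mset k \<kappa>'" by (metis insert_DiffM)
    moreover have "0 \<le> (\<Sum>k\<in>#\<kappa>'. - e_index N k)"
      by (induction \<kappa>') (simp_all add: e_index_def)
    ultimately show ?thesis by (simp add: e_index_def)
  qed
  show "\<exists>\<Phi>. dual_iso (e_annihilator N m) (W0_even_dual N m) (e_pairing N) (e_eval N) (V_charge m) \<Phi>"
    unfolding ann dual ev charge by (rule dual_iso_annihilator[OF deg inverse pairing])
  show "e_annihilator N m = {vandermonde m ^ (2 * N) * f * ?J | f. sym_poly m f}"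
    unfolding ann annihilator_eq by blast
qed

lemma W0_odd_dual_iso:
  "(\<exists>\<Phi>. dual_iso (theta_annihilator N m) (W0_odd_dual N m) theta_pairing (theta_eval N) (U_charge m) \<Phi>) \<and>
    theta_annihilator N m = {vandermonde m ^ (2 * N + 1) * f * (\<Prod>i<m. zpow i (-1)) | f. sym_poly m f}"
proof
  interpret mode_polynomials "2 * N + 1" sorted_list_of_fset theta_word
    by (rule mode_polynomials_anticommuting)
  let ?J = "\<Prod>i<m. zpow i (-1)" and ?J' = "\<Prod>i<m. zpow i 1"
  have inverse: "?J * ?J' = 1"
    by (simp add: zpow_mult zpow_0 flip: prod.distrib)
  have ev: "theta_eval N = ev"
    unfolding theta_eval_def ev_def by (simp only: foldr_map comp_def theta_mode_index)
  have charge: "U_charge m = charge_part m" for m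
    by (simp add: U_charge_def charge_part_def length_sorted_list_of_fset)
  have pairing: "theta_pairing (f * ?J) P = pair f P" if "P \<in> charge_part m" for f P
  proof -
    have "res_modes (f * ?J) (map theta_index (sorted_list_of_fset S)) =
        lookup f (word_exp (map int (sorted_list_of_fset S)))" if "S \<in> keys P" for S
      using that \<open>P \<in> charge_part m\<close> unfolding prod_zpow
      by (subst res_modes_form) (simp_all add: charge_part_def comp_def theta_index_def)
    then show ?thesis
      by (simp add: theta_pairing_def pair_def cong: sum.cong)
  qed
  have ann: "theta_annihilator N m = (\<lambda>f. f * ?J) ` annihilator m"
  proof -
    have "odd_forms m = (\<lambda>f. f * ?J) ` {f. sign_poly (2 * N + 1) m f}"
      unfolding odd_forms_def sign_poly_odd by blast
    then show ?thesis
      unfolding theta_annihilator_def annihilator_def I_odd_def charge ev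
      using pairing by (auto simp: Int_def)
  qed
  have dual: "W0_odd_dual N m =
      restricted_dual (range ev) (\<lambda>m d. ev ` {P \<in> charge_part m. \<forall>S\<in>keys P. (\<Sum>k\<in>fset S. - theta_index k) = d}) m"
  proof -
    have "W0_odd N = range ev"
      unfolding W0_odd_def by (rule principal_subspace_eq_range[of _ 0]) (simp add: theta_mode_def)
    then show ?thesis
      by (simp add: W0_odd_dual_def U_hom_def charge ev)
  qed
  have deg: "int k \<le> (\<Sum>k\<in>fset S. - theta_index k)" if "k \<in> set (sorted_list_of_fset S)" for k S
  proof -
    have "k \<in> fset S" using that by (simp add: sorted_list_of_fset.rep_eq)
    then show ?thesis
      using member_le_sum[of k "fset S" "\<lambda>k. - theta_index k"] by (simp add: theta_index_def)
  qed
  show "\<exists>\<Phi>. dual_iso (theta_annihilator N m) (W0_odd_dual N m) theta_pairing (theta_eval N) (U_charge m) \<Phi>"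
    unfolding ann dual ev charge by (rule dual_iso_annihilator[OF deg inverse pairing])
  show "theta_annihilator N m = {vandermonde m ^ (2 * N + 1) * f * ?J | f. sym_poly m f}"
    unfolding ann annihilator_eq by blast
qed

theorem mainTheorem6:
  fixes m :: nat
  shows "(\<forall>N\<ge>1.
      (\<exists>\<Phi>. dual_iso (e_annihilator N m) (W0_even_dual N m) (e_pairing N) (e_eval N) (V_charge m) \<Phi>) \<and>
      e_annihilator N m =
        {vandermonde m ^ (2 * N) * f * (\<Prod>i<m. zpow i 1) ^ (N - 1) | f. sym_poly m f}) \<and>
    (\<forall>N.
      (\<exists>\<Phi>. dual_iso (theta_annihilator N m) (W0_odd_dual N m) theta_pairing (theta_eval N) (U_charge m) \<Phi>) \<and>
      theta_annihilator N m =
        {vandermonde m ^ (2 * N + 1) * f * (\<Prod>i<m. zpow i (-1)) | f. sym_poly m f})"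
  using W0_even_dual_iso W0_odd_dual_iso by blast

end
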